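(* Assume that the problem $$dx(t)=f(t,x(t),x(t-\tau(t)))\,dt+g(t,x(t),x(t-\tau(t)))\,dw(t),\ t\in[a,b],\qquad x(t)=\xi(t),\ t\in[a-\tau_0,a],$$ belongs to $\mathcal{SD}(\alpha,\beta,\gamma_1,\gamma_2)$, let $x(t)$ be its solution, and let $y(t)$ be the solution of the perturbed problem with the same $f,g,\tau,w$ and initial function $\eta$ in place of $\xi$, where $\xi,\eta\in L^p_{\mathcal F_a}([a-\tau_0,a];\mathbb C^d)$. Let $$c=\max_{a\le t\le b}\big(2\alpha(t)+2\beta(t)+\gamma_1^2(t)+2\gamma_1(t)\gamma_2(t)+\gamma_2^2(t)\big).$$ Then for all $t\in[a,b]$, $$\mathbb E|x(t)-y(t)|^2\le e^{c(t-a)}\sup_{a-\tau_0\le\theta\le a}\mathbb E|\xi(\theta)-\eta(\theta)|^2\quad\text{if } c\ge 0,$$ $$\mathbb E|x(t)-y(t)|^2\le \sup_{a-\tau_0\le\theta\le a}\mathbb E|\xi(\theta)-\eta(\theta)|^2\quad\text{if } c\le 0.$$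
   Context: Setting. $(\Omega,\mathcal F,\{\mathcal F_t\}_{t\ge a},\mathbb P)$ is a complete probability space with a filtration satisfying the usual conditions (right continuous, $\mathcal F_a$ contains all $\mathbb P$-null sets), and $w$ is an $m$-dimensional Wiener process on it. $\langle\cdot,\cdot\rangle$ is the inner product on $\mathbb C^d$ and $|\cdot|$ the corresponding norm; on $\mathbb C^{d\times m}$, $|\cdot|$ is the trace (Frobenius) norm. $\Re$ denotes real part. A number $p>2$ is fixed, and $L^p_{\mathcal F_t}([t_1,t_2];\mathbb C^d)$ is the family of $\mathcal F_t$-measurable $C([t_1,t_2];\mathbb C^d)$-valued random variables $\psi$ with $\sup_{t_1\le u\le t_2}\mathbb E|\psi(u)|^p<\infty$. The constants $a,b,\tau_0$ satisfy $-\infty<a<b<+\infty$, $\tau_0\ge0$; the delay satisfies $\tau(t)\ge0$ and $\inf_{a\le t\le b}(t-\tau(t))\ge a-\tau_0$; $f:[a,b]\times\mathbb C^d\times\mathbb C^d\to\mathbb C^d$ and $g:[a,b]\times\mathbb C^d\times\mathbb C^d\to\mathbb C^{d\times m}$ are continuous. Equations are in the It\^o sense. The problem belongs to $\mathcal{SD}(\alpha,\beta,\gamma_1,\gamma_2)$, where $\alpha,\beta,\gamma_1,\gamma_2$ are continuous real-valued functions on $[a,b]$, if for all $t\in[a,b]$ and $x,x_1,x_2,y,y_1,y_2\in\mathbb C^d$: (1) for each $R>0$ there is a constant $C_R$ depending only on $R$ with $|f(t,x_1,y)-f(t,x_2,y)|\le C_R|x_1-x_2|$ whenever $|x_1|,|x_2|,|y|\le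 R$; (2) $\Re\langle x_1-x_2,f(t,x_1,y)-f(t,x_2,y)\rangle\le\alpha(t)|x_1-x_2|^2$; (3) $|f(t,x,y_1)-f(t,x,y_2)|\le\beta(t)|y_1-y_2|$; (4) $|g(t,x_1,y_1)-g(t,x_2,y_2)|\le\gamma_1(t)|x_1-x_2|+\gamma_2(t)|y_1-y_2|$. *)

theory Defs
  imports "HOL-Probability.Probability"
begin

text \<open>
  Vectors in \<open>\<complex>\<^sup>d\<close> have type \<open>complex ^ 'd\<close>, and \<open>d \<times> m\<close> matrices have type
  \<open>complex ^ 'm ^ 'd\<close> (\<open>d\<close> rows of length \<open>m\<close>).  The library norms on these types are the Hermitian
  norm and the Frobenius (trace) norm, respectively.  Stochastic processes are functions of time
  first and of the sample point second.
\<close>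

text \<open>The library inner product on \<open>complex ^ 'd\<close> is only the real one.\<close>

definition cinner :: "complex ^ 'd \<Rightarrow> complex ^ 'd \<Rightarrow> complex" where
  "cinner x y = (\<Sum>i\<in>UNIV. x $ i * cnj (y $ i))"


section \<open>Filtered probability spaces and Wiener processes\<close>

text \<open>The values of \<open>F\<close> and \<open>W\<close> at times before \<open>a\<close> are irrelevant.\<close>

locale filtered_prob_space = prob_space M + complete_measure M
  for M :: "'w measure" +
  fixes F :: "real \<Rightarrow> 'w measure" and a :: real
  assumes subalgebra_F: "\<And>t. a \<le> t \<Longrightarrow> subalgebra M (F t)"
    and mono_F: "\<And>s t. a \<le> s \<Longrightarrow> s \<le> t \<Longrightarrow> sets (F s) \<subseteq> sets (F t)"
    and right_continuous_F: "\<And>t. a \<le> t \<Longrightarrow> sets (F t) = (\<Inter>s\<in>{t<..}. sets (F s))"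
    and null_sets_F: "null_sets M \<subseteq> sets (F a)"

locale wiener_process = filtered_prob_space M F a
  for M :: "'w measure" and F :: "real \<Rightarrow> 'w measure" and a :: real +
  fixes W :: "real \<Rightarrow> 'w \<Rightarrow> real ^ 'm"
  assumes start: "AE \<omega> in M. W a \<omega> = 0"
    and continuous_paths: "AE \<omega> in M. continuous_on {a..} (\<lambda>t. W t \<omega>)"
    and adapted: "\<And>t. a \<le> t \<Longrightarrow> W t \<in> borel_measurable (F t)"
    and indep_increments: "\<And>s t. a \<le> s \<Longrightarrow> s < t \<Longrightarrow>
      indep_set (sets (F s)) (sets (vimage_algebra (space M) (\<lambda>\<omega>. W t \<omega> - W s \<omega>) borel))"
    and indep_components: "\<And>s t. a \<le> s \<Longrightarrow> s < t \<Longrightarrow>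
      indep_vars (\<lambda>_. borel) (\<lambda>j \<omega>. (W t \<omega> - W s \<omega>) $ j) UNIV"
    and normal_increments: "\<And>s t j. a \<le> s \<Longrightarrow> s < t \<Longrightarrow>
      distributed M lborel (\<lambda>\<omega>. (W t \<omega> - W s \<omega>) $ j)
        (\<lambda>u. ennreal (normal_density 0 (sqrt (t - s)) u))"


section \<open>The Ito integral\<close>

definition measurable_adapted ::
  "'w measure \<Rightarrow> (real \<Rightarrow> 'w measure) \<Rightarrow> real \<Rightarrow> real \<Rightarrow> (real \<Rightarrow> 'w \<Rightarrow> 'e::topological_space) \<Rightarrow> bool"
where
  "measurable_adapted M F a b h \<longleftrightarrow>
     (\<lambda>(t, \<omega>). h t \<omega>) \<in> borel_measurable (restrict_space borel {a..b} \<Otimes>\<^sub>M M) \<and>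
     (\<forall>t\<in>{a..b}. h t \<in> borel_measurable (F t))"

definition matrix_incr :: "complex ^ 'm ^ 'd \<Rightarrow> real ^ 'm \<Rightarrow> complex ^ 'd" where
  "matrix_incr A v = A *v (\<chi> j. complex_of_real (v $ j))"

text \<open>
  A simple process on \<open>[a,t]\<close> is given by a partition \<open>a = q 0 < \<dots> < q n = t\<close> and bounded
  coefficients \<open>Z i\<close>, known at time \<open>q i\<close> and valid on \<open>(q i, q (i + 1)]\<close>.
\<close>

definition simple_process ::
  "'w measure \<Rightarrow> (real \<Rightarrow> 'w measure) \<Rightarrow> real \<Rightarrow> real \<Rightarrow>
    nat \<Rightarrow> (nat \<Rightarrow> real) \<Rightarrow> (nat \<Rightarrow> 'w \<Rightarrow> complex ^ 'm ^ 'd) \<Rightarrow> bool"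
where
  "simple_process M F a t n q Z \<longleftrightarrow>
     q 0 = a \<and> q n = t \<and> (\<forall>i<n. q i < q (Suc i)) \<and>
     (\<forall>i<n. Z i \<in> borel_measurable (F (q i)) \<and> (\<exists>K. \<forall>\<omega>\<in>space M. norm (Z i \<omega>) \<le> K))"

definition simple_value ::
  "nat \<Rightarrow> (nat \<Rightarrow> real) \<Rightarrow> (nat \<Rightarrow> 'w \<Rightarrow> complex ^ 'm ^ 'd) \<Rightarrow> real \<Rightarrow> 'w \<Rightarrow> complex ^ 'm ^ 'd"
where
  "simple_value n q Z s \<omega> = (\<Sum>i<n. indicator {q i<..q (Suc i)} s *\<^sub>R Z i \<omega>)"

definition simple_integral ::
  "(real \<Rightarrow> 'w \<Rightarrow> real ^ 'm) \<Rightarrow>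
    nat \<Rightarrow> (nat \<Rightarrow> real) \<Rightarrow> (nat \<Rightarrow> 'w \<Rightarrow> complex ^ 'm ^ 'd) \<Rightarrow> 'w \<Rightarrow> complex ^ 'd"
where
  "simple_integral W n q Z \<omega> = (\<Sum>i<n. matrix_incr (Z i \<omega>) (W (q (Suc i)) \<omega> - W (q i) \<omega>))"

definition tends_in_prob_0 :: "'w measure \<Rightarrow> (nat \<Rightarrow> 'w \<Rightarrow> ennreal) \<Rightarrow> bool" where
  "tends_in_prob_0 M X \<longleftrightarrow>
     (\<forall>\<epsilon>>0. (\<lambda>k. measure M {\<omega> \<in> space M. ennreal \<epsilon> < X k \<omega>}) \<longlonglongrightarrow> 0)"

text \<open>
  \<open>ito_integral M F W a t h J\<close> says that \<open>h\<close> is a measurable adapted integrand with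
  \<open>\<integral>\<^sub>a\<^sup>t |h(s)|\<^sup>2 ds < \<infinity>\<close> almost surely and that \<open>J\<close> is (a version of) \<open>\<integral>\<^sub>a\<^sup>t h(s) dW(s)\<close>, that is,
  the limit in probability of the integrals of simple processes \<open>H\<^sub>k\<close> such that
  \<open>\<integral>\<^sub>a\<^sup>t |H\<^sub>k(s) - h(s)|\<^sup>2 ds\<close> tends to \<open>0\<close> in probability.  It is a relation because the integral is
  determined only up to null sets.
\<close>

definition ito_integral ::
  "'w measure \<Rightarrow> (real \<Rightarrow> 'w measure) \<Rightarrow> (real \<Rightarrow> 'w \<Rightarrow> real ^ 'm) \<Rightarrow> real \<Rightarrow> real \<Rightarrow>
    (real \<Rightarrow> 'w \<Rightarrow> complex ^ 'm ^ 'd) \<Rightarrow> ('w \<Rightarrow> complex ^ 'd) \<Rightarrow> bool"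
where
  "ito_integral M F W a t h J \<longleftrightarrow>
     measurable_adapted M F a t h \<and>
     (AE \<omega> in M. (\<integral>\<^sup>+s\<in>{a..t}. ennreal ((norm (h s \<omega>))\<^sup>2) \<partial>lborel) < \<infinity>) \<and>
     J \<in> borel_measurable M \<and>
     (\<exists>n q Z. (\<forall>k. simple_process M F a t (n k) (q k) (Z k)) \<and>
        tends_in_prob_0 M (\<lambda>k \<omega>.
          \<integral>\<^sup>+s\<in>{a..t}. ennreal ((norm (simple_value (n k) (q k) (Z k) s \<omega> - h s \<omega>))\<^sup>2) \<partial>lborel) \<and>
        tends_in_prob_0 M (\<lambda>k \<omega>.
          ennreal (norm (simple_integral W (n k) (q k) (Z k) \<omega> - J \<omega>))))"


section \<open>Stochastic delay differential equations\<close>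

text \<open>
  \<open>C([t1,t2])\<close> with the supremum norm is identified with the closed subspace of the bounded
  continuous functions on the real line that are constant on both sides of \<open>[t1,t2]\<close>; the function
  \<open>ext_cont \<phi> t1 t2\<close> extends \<open>\<phi>\<close> in this way.
\<close>

definition Lp_initial ::
  "'w measure \<Rightarrow> 'w measure \<Rightarrow> real \<Rightarrow> real \<Rightarrow> real \<Rightarrow> (real \<Rightarrow> 'w \<Rightarrow> complex ^ 'd) \<Rightarrow> bool"
where
  "Lp_initial M G p t1 t2 \<psi> \<longleftrightarrow>
     (\<forall>\<omega>\<in>space M. continuous_on {t1..t2} (\<lambda>u. \<psi> u \<omega>)) \<and>
     (\<lambda>\<omega>. Bcontfun (ext_cont (\<lambda>u. \<psi> u \<omega>) t1 t2)) \<in> borel_measurable G \<and>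
     (SUP u\<in>{t1..t2}. \<integral>\<^sup>+\<omega>. ennreal (norm (\<psi> u \<omega>) powr p) \<partial>M) < \<infinity>"

text \<open>
  A solution of \<open>dx(t) = f(t, x(t), x(t - \<tau>(t))) dt + g(t, x(t), x(t - \<tau>(t))) dW(t)\<close> on \<open>[a,b]\<close> with
  initial function \<open>\<xi>\<close> on \<open>[a - \<tau>0, a]\<close>.
\<close>

definition sdde_solution ::
  "'w measure \<Rightarrow> (real \<Rightarrow> 'w measure) \<Rightarrow> (real \<Rightarrow> 'w \<Rightarrow> real ^ 'm) \<Rightarrow> real \<Rightarrow> real \<Rightarrow> real \<Rightarrow>
    (real \<Rightarrow> real) \<Rightarrow>
    (real \<Rightarrow> complex ^ 'd \<Rightarrow> complex ^ 'd \<Rightarrow> complex ^ 'd) \<Rightarrow>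
    (real \<Rightarrow> complex ^ 'd \<Rightarrow> complex ^ 'd \<Rightarrow> complex ^ 'm ^ 'd) \<Rightarrow>
    (real \<Rightarrow> 'w \<Rightarrow> complex ^ 'd) \<Rightarrow> (real \<Rightarrow> 'w \<Rightarrow> complex ^ 'd) \<Rightarrow> bool"
where
  "sdde_solution M F W a b \<tau>0 \<tau> f g \<xi> x \<longleftrightarrow>
     (AE \<omega> in M. continuous_on {a - \<tau>0..b} (\<lambda>t. x t \<omega>)) \<and>
     (\<forall>t\<in>{a..b}. x t \<in> borel_measurable (F t)) \<and>
     (AE \<omega> in M. \<forall>t\<in>{a - \<tau>0..a}. x t \<omega> = \<xi> t \<omega>) \<and>
     measurable_adapted M F a b (\<lambda>s \<omega>. f s (x s \<omega>) (x (s - \<tau> s) \<omega>)) \<and>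
     (AE \<omega> in M. set_integrable lborel {a..b} (\<lambda>s. f s (x s \<omega>) (x (s - \<tau> s) \<omega>))) \<and>
     (\<forall>t\<in>{a..b}. \<exists>J. ito_integral M F W a t (\<lambda>s \<omega>. g s (x s \<omega>) (x (s - \<tau> s) \<omega>)) J \<and>
        (AE \<omega> in M. x t \<omega> =
           \<xi> a \<omega> + (LINT s:{a..t}|lborel. f s (x s \<omega>) (x (s - \<tau> s) \<omega>)) + J \<omega>))"

definition SD ::
  "real \<Rightarrow> real \<Rightarrow>
    (real \<Rightarrow> complex ^ 'd \<Rightarrow> complex ^ 'd \<Rightarrow> complex ^ 'd) \<Rightarrow>
    (real \<Rightarrow> complex ^ 'd \<Rightarrow> complex ^ 'd \<Rightarrow> complex ^ 'm ^ 'd) \<Rightarrow>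
    (real \<Rightarrow> real) \<Rightarrow> (real \<Rightarrow> real) \<Rightarrow> (real \<Rightarrow> real) \<Rightarrow> (real \<Rightarrow> real) \<Rightarrow> bool"
where
  "SD a b f g \<alpha> \<beta> \<gamma>1 \<gamma>2 \<longleftrightarrow>
     continuous_on {a..b} \<alpha> \<and> continuous_on {a..b} \<beta> \<and>
     continuous_on {a..b} \<gamma>1 \<and> continuous_on {a..b} \<gamma>2 \<and>
     (\<forall>R>0. \<exists>C. \<forall>t\<in>{a..b}. \<forall>x1 x2 y. norm x1 \<le> R \<longrightarrow> norm x2 \<le> R \<longrightarrow> norm y \<le> R \<longrightarrow>
        norm (f t x1 y - f t x2 y) \<le> C * norm (x1 - x2)) \<and>
     (\<forall>t\<in>{a..b}. \<forall>x1 x2 y.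
        Re (cinner (x1 - x2) (f t x1 y - f t x2 y)) \<le> \<alpha> t * (norm (x1 - x2))\<^sup>2) \<and>
     (\<forall>t\<in>{a..b}. \<forall>x y1 y2. norm (f t x y1 - f t x y2) \<le> \<beta> t * norm (y1 - y2)) \<and>
     (\<forall>t\<in>{a..b}. \<forall>x1 x2 y1 y2.
        norm (g t x1 y1 - g t x2 y2) \<le> \<gamma>1 t * norm (x1 - x2) + \<gamma>2 t * norm (y1 - y2))"

end

theory Submission
  imports Defs
begin

text \<open>
  Put \<open>u = x - y\<close>, and let \<open>\<phi>\<close> and \<open>h\<close> be the differences of the drift and of the diffusion
  coefficients along \<open>x\<close> and \<open>y\<close>.  Let \<open>D r\<close> be the event that \<open>x\<close> and \<open>y\<close> stay bounded by \<open>K\<close> up to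
  time \<open>r\<close>, and \<open>n r = E (1\<^bsub>D r\<^esub> |u r|\<^sup>2)\<close>.  No Ito formula is needed for the inequality
  \<open>n t \<le> n s + \<integral>\<^sub>s\<^sup>t E (1\<^bsub>D r\<^esub> (2 \<phi> r \<bullet> u r + |h r|\<^sup>2)) dr\<close>: on \<open>[s,t]\<close> the killed process is \<open>A + B\<close> with \<open>A\<close> of
  bounded variation and \<open>B\<close> a square integrable martingale, \<open>|A|\<^sup>2\<close> obeys the ordinary chain rule,
  \<open>E |B t|\<^sup>2\<close> is given by the Ito isometry, and \<open>E (A t \<bullet> B t) = E (A s \<bullet> B t) + \<integral> E (\<phi> r \<bullet> B r) dr\<close> by the
  martingale property.  Starting the killing anew at every \<open>s\<close> makes \<open>n\<close> jump only downwards.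
  The structure conditions bound the integrand by \<open>A n r + B sup n\<close> with \<open>A + B \<le> c\<close>, a first crossing
  argument bounds \<open>n\<close> uniformly in \<open>K\<close>, and \<open>K \<rightarrow> \<infinity>\<close> gives the claim.
\<close>

section \<open>Increments of the Wiener process\<close>

text \<open>\<open>ito_integral\<close> speaks of one time at a time, up to null sets, and the
  approximating simple processes for different times are unrelated. So there is no path of the
  integral that could be stopped at an exit time. The killing is done inside the approximating
  simple processes instead, and the outcome has to be compared with \<open>J r - J s\<close> for
  each \<open>r\<close> separately. That comparison is valid on \<open>D r\<close> only and gives
  weak convergence: expectations against bounded vectors that are known at time \<open>r\<close> and
  vanish off \<open>D r\<close>. Weak limits can lose norm, which is why the energy relation is an
  inequality; the direction is the favourable one. Without killing no moment of the solutions is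
  known to be finite. Killing anew from every \<open>s\<close> makes the starting energy
  \<open>n s\<close> itself and not the larger second moment of a process that was killed earlier
  and then frozen. The coefficients \<open>A\<close> and \<open>B\<close> arise by splitting every
  mixed product of current and delayed differences evenly, \<open>2 * p * q \<le> p^2 + q^2\<close>;
  their sum is then the expression maximised by \<open>c\<close>.\<close>

lemma norm_matrix_power2:
  fixes Z :: "complex ^ 'm ^ 'd"
  shows "(norm Z)\<^sup>2 = (\<Sum>j\<in>UNIV. (norm (column j Z))\<^sup>2)"
proof -
  have "(norm Z)\<^sup>2 = (\<Sum>i\<in>UNIV. \<Sum>j\<in>UNIV. (norm (Z $ i $ j))\<^sup>2)"
    by (simp add: norm_vec_def L2_set_def sum_nonneg)
  also have "\<dots> = (\<Sum>j\<in>UNIV. \<Sum>i\<in>UNIV. (norm (Z $ i $ j))\<^sup>2)"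
    by (rule sum.swap)
  also have "\<dots> = (\<Sum>j\<in>UNIV. (norm (column j Z))\<^sup>2)"
    by (simp add: norm_vec_def L2_set_def sum_nonneg column_def)
  finally show ?thesis .
qed

lemma norm_column_le: "norm (column j Z) \<le> norm (Z :: complex ^ 'm ^ 'd)"
proof -
  have "(norm (column j Z))\<^sup>2 \<le> (norm Z)\<^sup>2"
    unfolding norm_matrix_power2 by (intro member_le_sum) auto
  then show ?thesis by (simp add: power2_le_iff_abs_le)
qed

text \<open>Columns are the natural pieces: column \<open>j\<close> is paired with the
  \<open>j\<close>-th component of an increment, and different components are independent.\<close>

lemma matrix_incr_columns: "matrix_incr Z v = (\<Sum>j\<in>UNIV. v $ j *\<^sub>R column j Z)"
  by (simp add: matrix_incr_def matrix_vector_mult_def vec_eq_iff column_def)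
    (simp add: scaleR_conv_of_real mult.commute)

lemma matrix_incr_diff: "matrix_incr (Z - Z') v = matrix_incr Z v - matrix_incr Z' v"
  by (simp add: matrix_incr_def matrix_vector_mult_diff_rdistrib)

lemma matrix_incr_sum: "matrix_incr (\<Sum>i\<in>I. Z i) v = (\<Sum>i\<in>I. matrix_incr (Z i) v)"
  by (induction I rule: infinite_finite_induct)
    (simp_all add: matrix_incr_def matrix_vector_mult_add_rdistrib)

lemma matrix_incr_scaleR: "matrix_incr (c *\<^sub>R Z) v = c *\<^sub>R matrix_incr Z v"
  by (simp add: matrix_incr_columns scaleR_sum_right column_def vec_eq_iff) (simp add: mult.commute)

lemma borel_measurable_column [measurable]:
  "Z \<in> borel_measurable N \<Longrightarrow> (\<lambda>\<omega>. column j (Z \<omega> :: complex ^ 'm ^ 'd)) \<in> borel_measurable N"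
  unfolding column_def
  by (erule borel_measurable_continuous_on[rotated]) (intro continuous_intros)

lemma borel_measurable_vec_nth' [measurable]:
  "v \<in> borel_measurable N \<Longrightarrow> (\<lambda>\<omega>. (v \<omega> :: real ^ 'm) $ j) \<in> borel_measurable N"
  by (erule borel_measurable_continuous_on[rotated]) (intro continuous_intros)

lemma borel_measurable_matrix_incr [measurable (raw)]:
  assumes [measurable]: "Z \<in> borel_measurable N" "v \<in> borel_measurable N"
  shows "(\<lambda>\<omega>. matrix_incr (Z \<omega>) (v \<omega>)) \<in> borel_measurable N"
  unfolding matrix_incr_columns by measurable

lemma integrable_norm_power2_sum:
  fixes X Y :: "'a \<Rightarrow> 'b :: euclidean_space"
  assumes [measurable]: "X \<in> borel_measurable M" "Y \<in> borel_measurable M"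
    and "integrable M (\<lambda>\<omega>. (norm (X \<omega>))\<^sup>2)" "integrable M (\<lambda>\<omega>. (norm (Y \<omega>))\<^sup>2)"
  shows integrable_inner_of_power2: "integrable M (\<lambda>\<omega>. X \<omega> \<bullet> Y \<omega>)"
    and integrable_norm_add_power2: "integrable M (\<lambda>\<omega>. (norm (X \<omega> + Y \<omega>))\<^sup>2)"
proof -
  have *: "norm (X \<omega> \<bullet> Y \<omega>) \<le> norm ((norm (X \<omega>))\<^sup>2 + (norm (Y \<omega>))\<^sup>2)" for \<omega>
  proof -
    have "\<bar>X \<omega> \<bullet> Y \<omega>\<bar> \<le> norm (X \<omega>) * norm (Y \<omega>)"
      by (rule Cauchy_Schwarz_ineq2)
    also have "\<dots> \<le> (norm (X \<omega>))\<^sup>2 + (norm (Y \<omega>))\<^sup>2"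
      using sum_squares_bound[of "norm (X \<omega>)" "norm (Y \<omega>)"]
        mult_nonneg_nonneg[OF norm_ge_zero norm_ge_zero, of "X \<omega>" "Y \<omega>"] by linarith
    finally show ?thesis by simp
  qed
  show 1: "integrable M (\<lambda>\<omega>. X \<omega> \<bullet> Y \<omega>)"
    by (rule Bochner_Integration.integrable_bound[OF Bochner_Integration.integrable_add[OF assms(3,4)]])
      (use * in auto)
  have "(norm (X \<omega> + Y \<omega>))\<^sup>2 = (norm (X \<omega>))\<^sup>2 + 2 * (X \<omega> \<bullet> Y \<omega>) + (norm (Y \<omega>))\<^sup>2" for \<omega>
    by (simp add: power2_norm_eq_inner inner_add_left inner_add_right inner_commute)
  then show "integrable M (\<lambda>\<omega>. (norm (X \<omega> + Y \<omega>))\<^sup>2)"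
    using 1 assms(3,4) by simp
qed

lemma norm_add_power2: "(norm (x + y))\<^sup>2 = (norm x)\<^sup>2 + 2 * (x \<bullet> y) + (norm (y :: 'a :: real_inner))\<^sup>2"
  by (simp add: power2_norm_eq_inner inner_add_left inner_add_right inner_commute)

section \<open>Measurability along the filtration\<close>

context filtered_prob_space
begin

lemma borel_measurable_F_mono:
  "X \<in> borel_measurable (F s) \<Longrightarrow> a \<le> s \<Longrightarrow> s \<le> t \<Longrightarrow> X \<in> borel_measurable (F t)"
  using measurable_mono[of borel borel "F s" "F t"] mono_F[of s t] subalgebra_F[of s] subalgebra_F[of t]
  by (auto simp: subalgebra_def)

lemma borel_measurable_F:
  "X \<in> borel_measurable (F s) \<Longrightarrow> a \<le> s \<Longrightarrow> X \<in> borel_measurable M"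
  using measurable_mono[of borel borel "F s" M] subalgebra_F[of s]
  by (auto simp: subalgebra_def)

lemma space_F: "a \<le> s \<Longrightarrow> space (F s) = space M"
  using subalgebra_F[of s] by (auto simp: subalgebra_def)

lemma sets_F_M: "a \<le> s \<Longrightarrow> A \<in> sets (F s) \<Longrightarrow> A \<in> sets M"
  using subalgebra_F[of s] by (auto simp: subalgebra_def)

end

section \<open>Moments, independence and one-step isometry of Wiener increments\<close>

context wiener_process
begin

lemma W_measurable: "a \<le> t \<Longrightarrow> W t \<in> borel_measurable M"
  using adapted borel_measurable_F by blast

lemma W_incr_moments:
  assumes "a \<le> s" "s < t"
  shows W_incr_mean: "expectation (\<lambda>\<omega>. (W t \<omega> - W s \<omega>) $ j) = 0"
    and W_incr_integrable: "integrable M (\<lambda>\<omega>. (W t \<omega> - W s \<omega>) $ j)"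
    and W_incr_square: "expectation (\<lambda>\<omega>. ((W t \<omega> - W s \<omega>) $ j)\<^sup>2) = t - s"
    and W_incr_square_integrable: "integrable M (\<lambda>\<omega>. ((W t \<omega> - W s \<omega>) $ j)\<^sup>2)"
proof -
  let ?\<sigma> = "sqrt (t - s)"
  have pos: "0 < ?\<sigma>" using assms by simp
  note D = normal_increments[OF assms, of j]
  have "expectation (\<lambda>\<omega>. (W t \<omega> - W s \<omega>) $ j) = 0 \<and> variance (\<lambda>\<omega>. (W t \<omega> - W s \<omega>) $ j) = ?\<sigma>\<^sup>2"
    using normal_distributed_expectation[OF pos D] normal_distributed_variance[OF pos D] by simp
  then show m: "expectation (\<lambda>\<omega>. (W t \<omega> - W s \<omega>) $ j) = 0"
    and "expectation (\<lambda>\<omega>. ((W t \<omega> - W s \<omega>) $ j)\<^sup>2) = t - s"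
    using assms by auto
  have "integrable lborel (\<lambda>x. normal_density 0 ?\<sigma> x * x ^ 1)"
    "integrable lborel (\<lambda>x. normal_density 0 ?\<sigma> x * x ^ 2)"
    using integrable_normal_moment[OF pos, of 0 1] integrable_normal_moment[OF pos, of 0 2] by simp_all
  then show "integrable M (\<lambda>\<omega>. (W t \<omega> - W s \<omega>) $ j)" "integrable M (\<lambda>\<omega>. ((W t \<omega> - W s \<omega>) $ j)\<^sup>2)"
    using distributed_integrable[OF D, of "\<lambda>x. x"] distributed_integrable[OF D, of "\<lambda>x. x\<^sup>2"]
    by simp_all
qed

lemma W_incr_mult:
  assumes "a \<le> s" "s < t"
  shows W_incr_mult_integrable: "integrable M (\<lambda>\<omega>. (W t \<omega> - W s \<omega>) $ j * (W t \<omega> - W s \<omega>) $ l)"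
    and W_incr_mult_expectation: "expectation (\<lambda>\<omega>. (W t \<omega> - W s \<omega>) $ j * (W t \<omega> - W s \<omega>) $ l) =
      (if j = l then t - s else 0)"
proof -
  have "integrable M (\<lambda>\<omega>. (W t \<omega> - W s \<omega>) $ j * (W t \<omega> - W s \<omega>) $ l) \<and>
    expectation (\<lambda>\<omega>. (W t \<omega> - W s \<omega>) $ j * (W t \<omega> - W s \<omega>) $ l) = (if j = l then t - s else 0)"
  proof (cases "j = l")
    case True
    then show ?thesis
      using W_incr_square[OF assms] W_incr_square_integrable[OF assms] by (simp add: power2_eq_square)
  next
    case False
    have ind: "indep_vars (\<lambda>_. borel) (\<lambda>j \<omega>. (W t \<omega> - W s \<omega>) $ j) {j, l}"
      by (rule indep_vars_subset[OF indep_components[OF assms]]) auto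
    from indep_vars_lebesgue_integral[OF _ ind W_incr_integrable[OF assms]]
      indep_vars_integrable[OF _ ind W_incr_integrable[OF assms]]
    show ?thesis using False W_incr_mean[OF assms] by simp
  qed
  then show "integrable M (\<lambda>\<omega>. (W t \<omega> - W s \<omega>) $ j * (W t \<omega> - W s \<omega>) $ l)"
    "expectation (\<lambda>\<omega>. (W t \<omega> - W s \<omega>) $ j * (W t \<omega> - W s \<omega>) $ l) = (if j = l then t - s else 0)"
    by auto
qed

text \<open>The Wiener hypothesis is independence of sigma-algebras. Here \<open>X\<close> generates
  a sub-sigma-algebra of \<open>F s\<close>, and a Borel function of the increment generates a
  sub-sigma-algebra of that of the increment, so independence passes to the two random
  variables.\<close>

lemma indep_var_incr:
  fixes X :: "'w \<Rightarrow> real" and V :: "real ^ 'm \<Rightarrow> real"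
  assumes st: "a \<le> s" "s < t" and X: "X \<in> borel_measurable (F s)"
    and V: "V \<in> borel_measurable borel"
  shows "indep_var borel X borel (\<lambda>\<omega>. V (W t \<omega> - W s \<omega>))"
proof -
  let ?d = "\<lambda>\<omega>. W t \<omega> - W s \<omega>"
  have [measurable]: "X \<in> borel_measurable M" "W t \<in> borel_measurable M" "W s \<in> borel_measurable M"
    using X st borel_measurable_F W_measurable by auto
  have ind: "indep_set (sets (F s)) (sets (vimage_algebra (space M) ?d borel))"
    using indep_increments[OF st] .
  have 1: "sigma_sets (space M) {X -` A \<inter> space M |A. A \<in> sets borel} \<subseteq> sets (F s)"
  proof -
    have "{X -` A \<inter> space M |A. A \<in> sets borel} \<subseteq> sets (F s)"
      using X measurable_sets[OF X] space_F[OF st(1)] by auto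
    then show ?thesis
      using sets.sigma_sets_subset[of _ "F s"] space_F[OF st(1)] by simp
  qed
  have 2: "sigma_sets (space M) {(\<lambda>\<omega>. V (?d \<omega>)) -` A \<inter> space M |A. A \<in> sets borel} \<subseteq>
    sets (vimage_algebra (space M) ?d borel)"
  proof -
    have "{(\<lambda>\<omega>. V (?d \<omega>)) -` A \<inter> space M |A. A \<in> sets borel} \<subseteq> sets (vimage_algebra (space M) ?d borel)"
    proof safe
      fix A :: "real set" assume "A \<in> sets borel"
      then have "V -` A \<in> sets borel" using measurable_sets[OF V] by simp
      then have "?d -` (V -` A) \<inter> space M \<in> sets (vimage_algebra (space M) ?d borel)"
        by (rule in_vimage_algebra)
      moreover have "(\<lambda>\<omega>. V (?d \<omega>)) -` A \<inter> space M = ?d -` (V -` A) \<inter> space M" by auto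
      ultimately show "(\<lambda>\<omega>. V (?d \<omega>)) -` A \<inter> space M \<in> sets (vimage_algebra (space M) ?d borel)"
        by simp
    qed
    then show ?thesis
      using sets.sigma_sets_subset[of _ "vimage_algebra (space M) ?d borel"] by simp
  qed
  have [measurable]: "(\<lambda>\<omega>. V (?d \<omega>)) \<in> borel_measurable M"
    using V by measurable
  show ?thesis
    unfolding indep_var_eq indep_sets2_eq
  proof (intro conjI ballI)
    show "random_variable borel X" "random_variable borel (\<lambda>\<omega>. V (?d \<omega>))" by measurable
    show "sigma_sets (space M) {X -` A \<inter> space M |A. A \<in> sets borel} \<subseteq> events"
      using order_trans[OF 1] ind[unfolded indep_sets2_eq] by blast
    show "sigma_sets (space M) {(\<lambda>\<omega>. V (?d \<omega>)) -` A \<inter> space M |A. A \<in> sets borel} \<subseteq> events"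
      using order_trans[OF 2] ind[unfolded indep_sets2_eq] by blast
    show "prob (A \<inter> B) = prob A * prob B"
      if "A \<in> sigma_sets (space M) {X -` A \<inter> space M |A. A \<in> sets borel}"
        "B \<in> sigma_sets (space M) {(\<lambda>\<omega>. V (?d \<omega>)) -` A \<inter> space M |A. A \<in> sets borel}" for A B
      using that 1 2 ind[unfolded indep_sets2_eq] by blast
  qed
qed

lemma expectation_mult_incr:
  fixes X :: "'w \<Rightarrow> real" and V :: "real ^ 'm \<Rightarrow> real"
  assumes st: "a \<le> s" "s < t" and X: "X \<in> borel_measurable (F s)" "integrable M X"
    and V: "V \<in> borel_measurable borel" "integrable M (\<lambda>\<omega>. V (W t \<omega> - W s \<omega>))"
  shows "integrable M (\<lambda>\<omega>. X \<omega> * V (W t \<omega> - W s \<omega>))"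
    "expectation (\<lambda>\<omega>. X \<omega> * V (W t \<omega> - W s \<omega>)) = expectation X * expectation (\<lambda>\<omega>. V (W t \<omega> - W s \<omega>))"
  using indep_var_lebesgue_integral[OF indep_var_incr[OF st X(1) V(1)] X(2) V(2)]
    indep_var_integrable[OF indep_var_incr[OF st X(1) V(1)] X(2) V(2)] by auto

text \<open>Expanding the square by columns gives the Gram entries of \<open>Z\<close>, known at
  time \<open>s\<close>, times products of two increment components. Independence factors each
  expectation, and the covariance \<open>t - s\<close> times the identity leaves only the diagonal,
  which sums to the Frobenius norm.\<close>

lemma matrix_incr_incr:
  fixes Z :: "'w \<Rightarrow> complex ^ 'm ^ 'd"
  assumes st: "a \<le> s" "s < t" and Z: "Z \<in> borel_measurable (F s)" "\<And>\<omega>. \<omega> \<in> space M \<Longrightarrow> norm (Z \<omega>) \<le> K"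
  shows matrix_incr_square_integrable: "integrable M (\<lambda>\<omega>. (norm (matrix_incr (Z \<omega>) (W t \<omega> - W s \<omega>)))\<^sup>2)"
    and matrix_incr_isometry: "expectation (\<lambda>\<omega>. (norm (matrix_incr (Z \<omega>) (W t \<omega> - W s \<omega>)))\<^sup>2) =
      (t - s) * expectation (\<lambda>\<omega>. (norm (Z \<omega>))\<^sup>2)"
proof -
  let ?d = "\<lambda>\<omega>. W t \<omega> - W s \<omega>"
  let ?c = "\<lambda>j l \<omega>. column j (Z \<omega>) \<bullet> column l (Z \<omega>)"
  have [measurable]: "Z \<in> borel_measurable (F s)" by fact
  have ZM [measurable]: "Z \<in> borel_measurable M" by (rule borel_measurable_F[OF Z(1) st(1)])
  have c: "?c j l \<in> borel_measurable (F s)" for j l by measurable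
  have cb: "norm (?c j l \<omega>) \<le> K\<^sup>2" if "\<omega> \<in> space M" for j l \<omega>
  proof -
    have "\<bar>?c j l \<omega>\<bar> \<le> norm (column j (Z \<omega>)) * norm (column l (Z \<omega>))" by (rule Cauchy_Schwarz_ineq2)
    also have "\<dots> \<le> K * K"
      using Z(2)[OF that] norm_column_le[of j "Z \<omega>"] norm_column_le[of l "Z \<omega>"]
      by (intro mult_mono) (auto intro: order_trans order_trans[OF norm_ge_zero])
    finally show ?thesis by (simp add: power2_eq_square)
  qed
  have ci: "integrable M (?c j l)" for j l
    by (rule integrable_const_bound[of _ "K\<^sup>2"]) (use cb in auto)
  have eq: "(norm (matrix_incr (Z \<omega>) (?d \<omega>)))\<^sup>2 = (\<Sum>j\<in>UNIV. \<Sum>l\<in>UNIV. ?c j l \<omega> * (?d \<omega> $ j * ?d \<omega> $ l))" for \<omega>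
    unfolding power2_norm_eq_inner matrix_incr_columns inner_sum_left inner_sum_right inner_scaleR_left
      inner_scaleR_right
    by (intro sum.cong refl) (simp add: sum_distrib_left mult_ac inner_commute)
  have Vm: "(\<lambda>v :: real ^ 'm. v $ j * v $ l) \<in> borel_measurable borel" for j l by measurable
  note e = expectation_mult_incr[OF st c ci Vm W_incr_mult_integrable[OF st]]
  show "integrable M (\<lambda>\<omega>. (norm (matrix_incr (Z \<omega>) (?d \<omega>)))\<^sup>2)"
    unfolding eq by (intro Bochner_Integration.integrable_sum e)
  have "expectation (\<lambda>\<omega>. (norm (matrix_incr (Z \<omega>) (?d \<omega>)))\<^sup>2) =
    (\<Sum>j\<in>UNIV. \<Sum>l\<in>UNIV. expectation (?c j l) * (if j = l then t - s else 0))"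
    unfolding eq using e by (simp add: Bochner_Integration.integral_sum W_incr_mult_expectation[OF st, simplified])
  also have "\<dots> = (\<Sum>j\<in>UNIV. expectation (?c j j) * (t - s))"
    by (rule sum.cong) (simp_all add: if_distrib[of "\<lambda>x. _ * x"] sum.delta cong: if_cong)
  also have "\<dots> = (t - s) * expectation (\<lambda>\<omega>. \<Sum>j\<in>UNIV. ?c j j \<omega>)"
    using ci by (simp add: sum_distrib_left mult.commute)
  also have "\<dots> = (t - s) * expectation (\<lambda>\<omega>. (norm (Z \<omega>))\<^sup>2)"
    by (simp only: norm_matrix_power2 power2_norm_eq_inner)
  finally show "expectation (\<lambda>\<omega>. (norm (matrix_incr (Z \<omega>) (?d \<omega>)))\<^sup>2) = (t - s) * expectation (\<lambda>\<omega>. (norm (Z \<omega>))\<^sup>2)" .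
qed

text \<open>One-step martingale property in tested form: \<open>\<zeta>\<close> paired with the
  columns of \<open>Z\<close> is known at time \<open>s\<close>, and every increment component has
  mean \<open>0\<close>.\<close>

lemma matrix_incr_orthogonal:
  fixes Z :: "'w \<Rightarrow> complex ^ 'm ^ 'd"
  assumes st: "a \<le> s" "s < t" and Z: "Z \<in> borel_measurable (F s)" "\<And>\<omega>. \<omega> \<in> space M \<Longrightarrow> norm (Z \<omega>) \<le> K"
    and \<zeta>: "\<zeta> \<in> borel_measurable (F s)" "integrable M (\<lambda>\<omega>. (norm (\<zeta> \<omega>))\<^sup>2)"
  shows "expectation (\<lambda>\<omega>. \<zeta> \<omega> \<bullet> matrix_incr (Z \<omega>) (W t \<omega> - W s \<omega>)) = 0"
proof -
  let ?d = "\<lambda>\<omega>. W t \<omega> - W s \<omega>"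
  let ?c = "\<lambda>j \<omega>. \<zeta> \<omega> \<bullet> column j (Z \<omega>)"
  have [measurable]: "Z \<in> borel_measurable (F s)" "\<zeta> \<in> borel_measurable (F s)" by fact+
  have [measurable]: "Z \<in> borel_measurable M" "\<zeta> \<in> borel_measurable M"
    by (rule borel_measurable_F[OF Z(1) st(1)], rule borel_measurable_F[OF \<zeta>(1) st(1)])
  have c: "?c j \<in> borel_measurable (F s)" for j by measurable
  have "integrable M (\<lambda>\<omega>. (norm (column j (Z \<omega>)))\<^sup>2)" for j
  proof (rule integrable_const_bound[of _ "K\<^sup>2"])
    have "norm ((norm (column j (Z \<omega>)))\<^sup>2) \<le> K\<^sup>2" if "\<omega> \<in> space M" for \<omega>
      using Z(2)[OF that] norm_column_le[of j "Z \<omega>"] by (auto intro!: power_mono)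
    then show "AE \<omega> in M. norm ((norm (column j (Z \<omega>)))\<^sup>2) \<le> K\<^sup>2" by auto
  qed measurable
  then have ci: "integrable M (?c j)" for j
    by (intro integrable_inner_of_power2 \<zeta>(2)) measurable
  have Vm: "(\<lambda>v :: real ^ 'm. v $ j) \<in> borel_measurable borel" for j by measurable
  note e = expectation_mult_incr[OF st c ci Vm W_incr_integrable[OF st]]
  have eq: "\<zeta> \<omega> \<bullet> matrix_incr (Z \<omega>) (?d \<omega>) = (\<Sum>j\<in>UNIV. ?c j \<omega> * (?d \<omega> $ j))" for \<omega>
    by (simp add: matrix_incr_columns inner_sum_right mult.commute)
  show ?thesis
    unfolding eq using e by (simp add: Bochner_Integration.integral_sum W_incr_mean[OF st, simplified])
qed

end

section \<open>Simple processes\<close>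

lemma increasing_upto:
  fixes q :: "nat \<Rightarrow> real"
  assumes "\<forall>i<n. q i < q (Suc i)"
  shows increasing_upto_less: "i < j \<Longrightarrow> j \<le> n \<Longrightarrow> q i < q j"
    and increasing_upto_le: "i \<le> j \<Longrightarrow> j \<le> n \<Longrightarrow> q i \<le> q j"
    and increasing_upto_less_iff: "i \<le> n \<Longrightarrow> j \<le> n \<Longrightarrow> q i < q j \<longleftrightarrow> i < j"
proof -
  have *: "q i < q j" if "i < j" "j \<le> n" for i j
    using that
  proof (induction j)
    case (Suc j)
    then show ?case using assms by (cases "i = j") (auto simp: less_Suc_eq intro: less_trans)
  qed simp
  show "i < j \<Longrightarrow> j \<le> n \<Longrightarrow> q i < q j" by (rule *)
  show "i \<le> j \<Longrightarrow> j \<le> n \<Longrightarrow> q i \<le> q j" using *[of i j] by (cases "i = j") auto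
  show "i \<le> n \<Longrightarrow> j \<le> n \<Longrightarrow> q i < q j \<longleftrightarrow> i < j"
    using *[of i j] *[of j i] by (cases i j rule: linorder_cases) auto
qed

lemma step_sum_eq:
  fixes c :: "nat \<Rightarrow> 'b :: real_vector" and q :: "nat \<Rightarrow> real"
  assumes q: "\<forall>i<n. q i < q (Suc i)" and i: "i < n" "q i < v" "v \<le> q (Suc i)"
  shows "(\<Sum>j<n. indicator {q j<..q (Suc j)} v *\<^sub>R c j) = c i"
proof -
  have "(\<Sum>j<n. indicator {q j<..q (Suc j)} v *\<^sub>R c j) = (\<Sum>j<n. if j = i then c j else 0)"
  proof (rule sum.cong)
    fix j assume j: "j \<in> {..<n}"
    have "v \<notin> {q j<..q (Suc j)}" if "j \<noteq> i"
    proof (cases "j < i")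
      case True
      then have "q (Suc j) \<le> q i" using increasing_upto_le[OF q, of "Suc j" i] i by simp
      then show ?thesis using i by simp
    next
      case False
      then have "q (Suc i) \<le> q j" using increasing_upto_le[OF q, of "Suc i" j] j that by simp
      then show ?thesis using i by simp
    qed
    then show "indicator {q j<..q (Suc j)} v *\<^sub>R c j = (if j = i then c j else 0)"
      using i by auto
  qed simp
  then show ?thesis using i by simp
qed

lemma step_sum_outside:
  fixes c :: "nat \<Rightarrow> 'b :: real_vector" and q :: "nat \<Rightarrow> real"
  assumes q: "\<forall>i<n. q i < q (Suc i)" and v: "v \<le> q 0 \<or> q n < v"
  shows "(\<Sum>j<n. indicator {q j<..q (Suc j)} v *\<^sub>R c j) = 0"
proof (rule sum.neutral, rule ballI)
  fix j assume j: "j \<in> {..<n}"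
  have "q 0 \<le> q j" "q (Suc j) \<le> q n"
    using increasing_upto_le[OF q, of 0 j] increasing_upto_le[OF q, of "Suc j" n] j by auto
  then show "indicator {q j<..q (Suc j)} v *\<^sub>R c j = 0" using v by auto
qed

lemma step_interval:
  fixes q :: "nat \<Rightarrow> real"
  assumes "q 0 < v" "v \<le> q n"
  obtains i where "i < n" "q i < v" "v \<le> q (Suc i)"
proof -
  define k where "k = (LEAST k. v \<le> q k)"
  have k: "v \<le> q k" "k \<le> n" unfolding k_def using assms by (auto intro: LeastI Least_le)
  then have "k \<noteq> 0" using assms by (metis leD)
  then obtain i where i: "k = Suc i" by (cases k) auto
  then have "\<not> v \<le> q i" unfolding k_def using not_less_Least[of i "\<lambda>k. v \<le> q k"] by simp
  then show ?thesis using that[of i] k i by auto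
qed

lemma simple_value_eq:
  "\<forall>i<n. q i < q (Suc i) \<Longrightarrow> i < n \<Longrightarrow> q i < v \<Longrightarrow> v \<le> q (Suc i) \<Longrightarrow> simple_value n q Z v \<omega> = Z i \<omega>"
  unfolding simple_value_def by (rule step_sum_eq)

lemma simple_value_outside:
  "\<forall>i<n. q i < q (Suc i) \<Longrightarrow> v \<le> q 0 \<or> q n < v \<Longrightarrow> simple_value n q Z v \<omega> = 0"
  unfolding simple_value_def by (rule step_sum_outside)

text \<open>This links the pathwise energy used in \<open>ito_integral\<close> with the finite sum
  that the isometry and the tail bound use. Cells are open on the left, so both sides of the
  pointwise identity vanish at \<open>v = s\<close>.\<close>

lemma nn_integral_simple_value:
  assumes q: "\<forall>i<n. q i < q (Suc i)" "q 0 = s" "q n = t"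
  shows "(\<integral>\<^sup>+v\<in>{s..t}. ennreal ((norm (simple_value n q Z v \<omega>))\<^sup>2) \<partial>lborel) =
    ennreal (\<Sum>i<n. (q (Suc i) - q i) * (norm (Z i \<omega>))\<^sup>2)"
proof -
  have "ennreal ((norm (simple_value n q Z v \<omega>))\<^sup>2) * indicator {s..t} v =
    (\<Sum>i<n. ennreal ((norm (Z i \<omega>))\<^sup>2) * indicator {q i<..q (Suc i)} v)" for v
  proof -
    have "(\<Sum>i<n. ennreal ((norm (Z i \<omega>))\<^sup>2) * indicator {q i<..q (Suc i)} v) =
      ennreal (\<Sum>i<n. indicator {q i<..q (Suc i)} v *\<^sub>R (norm (Z i \<omega>))\<^sup>2)"
      by (subst sum_ennreal[symmetric]) (auto intro!: sum.cong simp: indicator_def)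
    also have "\<dots> = ennreal ((norm (simple_value n q Z v \<omega>))\<^sup>2) * indicator {s..t} v"
    proof (cases "s < v \<and> v \<le> t")
      case True
      then obtain i where i: "i < n" "q i < v" "v \<le> q (Suc i)" using step_interval[of q v n] q by auto
      show ?thesis unfolding simple_value_eq[OF q(1) i] step_sum_eq[OF q(1) i] using True by simp
    next
      case False
      then have v: "v \<le> q 0 \<or> q n < v" using q by auto
      show ?thesis unfolding simple_value_outside[OF q(1) v] step_sum_outside[OF q(1) v] by simp
    qed
    finally show ?thesis ..
  qed
  then have "(\<integral>\<^sup>+v\<in>{s..t}. ennreal ((norm (simple_value n q Z v \<omega>))\<^sup>2) \<partial>lborel) =
    (\<Sum>i<n. \<integral>\<^sup>+v. ennreal ((norm (Z i \<omega>))\<^sup>2) * indicator {q i<..q (Suc i)} v \<partial>lborel)"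
    by (simp only:) (rule nn_integral_sum, simp)
  also have "\<dots> = (\<Sum>i<n. ennreal ((q (Suc i) - q i) * (norm (Z i \<omega>))\<^sup>2))"
  proof (rule sum.cong)
    fix i assume "i \<in> {..<n}"
    then have "q i < q (Suc i)" using q by simp
    then show "(\<integral>\<^sup>+v. ennreal ((norm (Z i \<omega>))\<^sup>2) * indicator {q i<..q (Suc i)} v \<partial>lborel) =
      ennreal ((q (Suc i) - q i) * (norm (Z i \<omega>))\<^sup>2)"
      by (subst nn_integral_cmult_indicator) (simp_all flip: ennreal_mult' add: mult.commute)
  qed simp
  also have "\<dots> = ennreal (\<Sum>i<n. (q (Suc i) - q i) * (norm (Z i \<omega>))\<^sup>2)"
    using q by (intro sum_ennreal) (auto simp: less_imp_le)
  finally show ?thesis .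
qed

section \<open>Refinement of partitions\<close>

lemma refine_index:
  assumes "q ` {..m} \<subseteq> p ` {..n}" "j \<le> m"
  shows "\<exists>l\<le>n. q j = p l"
proof -
  have "q j \<in> p ` {..n}" using assms by blast
  then show ?thesis by blast
qed

text \<open>No point of \<open>q\<close> lies strictly inside a cell of \<open>p\<close>. As cells
  are closed on the right, the right end \<open>p (Suc i)\<close> represents the whole cell, which
  is why refined coefficients are always read off there.\<close>

lemma refine_simple_value:
  assumes p: "\<forall>i<n. p i < p (Suc i)" and sub: "q ` {..m} \<subseteq> p ` {..n}"
    and i: "i < n" "p i < v" "v \<le> p (Suc i)"
  shows "simple_value m q Z v \<omega> = simple_value m q Z (p (Suc i)) \<omega>"
  unfolding simple_value_def
proof (rule sum.cong)
  fix j assume j: "j \<in> {..<m}"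
  have *: "p l < v \<longleftrightarrow> p l < p (Suc i)" if "l \<le> n" for l
  proof -
    have "p l < p (Suc i) \<longleftrightarrow> l < Suc i" using increasing_upto_less_iff[OF p, of l "Suc i"] that i by simp
    moreover have "l < Suc i \<Longrightarrow> p l \<le> p i" using increasing_upto_le[OF p, of l i] i by simp
    ultimately show ?thesis using i by auto
  qed
  have j': "j \<le> m" "Suc j \<le> m" using j by auto
  obtain l l' where l: "q j = p l" "l \<le> n" "q (Suc j) = p l'" "l' \<le> n"
    using refine_index[OF sub j'(1)] refine_index[OF sub j'(2)] by blast
  show "indicator {q j<..q (Suc j)} v *\<^sub>R Z j \<omega> = indicator {q j<..q (Suc j)} (p (Suc i)) *\<^sub>R Z j \<omega>"
    using *[OF l(2)] *[OF l(4)] unfolding l indicator_def by (auto simp: not_less[symmetric])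
qed simp

text \<open>Telescoping: the cells of \<open>p\<close> inside one cell of \<open>q\<close> share its
  coefficient and their increments add up. Cells of \<open>p\<close> outside the range of
  \<open>q\<close> get the coefficient \<open>0\<close>.\<close>

lemma refine_simple_integral:
  assumes p: "\<forall>i<n. p i < p (Suc i)" and q: "\<forall>i<m. q i < q (Suc i)"
    and sub: "q ` {..m} \<subseteq> p ` {..n}"
  shows "simple_integral W n p (\<lambda>i. simple_value m q Z (p (Suc i))) \<omega> = simple_integral W m q Z \<omega>"
proof -
  let ?d = "\<lambda>i. W (p (Suc i)) \<omega> - W (p i) \<omega>"
  have *: "(\<Sum>i<n. indicator {q j<..q (Suc j)} (p (Suc i)) *\<^sub>R matrix_incr (Z j \<omega>) (?d i)) =
    matrix_incr (Z j \<omega>) (W (q (Suc j)) \<omega> - W (q j) \<omega>)" if j: "j < m" for j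
  proof -
    have j': "j \<le> m" "Suc j \<le> m" using j by auto
    obtain l l' where l: "q j = p l" "l \<le> n" "q (Suc j) = p l'" "l' \<le> n"
      using refine_index[OF sub j'(1)] refine_index[OF sub j'(2)] by blast
    have ll: "l < l'" using increasing_upto_less_iff[OF p l(2,4)] q j l by metis
    have "(\<Sum>i<n. indicator {q j<..q (Suc j)} (p (Suc i)) *\<^sub>R matrix_incr (Z j \<omega>) (?d i)) =
      (\<Sum>i<n. if i \<in> {l..<l'} then matrix_incr (Z j \<omega>) (?d i) else 0)"
    proof (rule sum.cong)
      fix i assume i: "i \<in> {..<n}"
      \<comment> \<open>A cell is identified by its right end, so
        \<open>p l < p (Suc i) \<le> p l'\<close> turns into \<open>l \<le> i < l'\<close>.\<close>
      have "p (Suc i) \<in> {p l<..p l'} \<longleftrightarrow> i \<in> {l..<l'}"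
        using increasing_upto_less_iff[OF p l(2), of "Suc i"] increasing_upto_less_iff[OF p l(4), of "Suc i"] i
        by (auto simp: not_less[symmetric])
      then show "indicator {q j<..q (Suc j)} (p (Suc i)) *\<^sub>R matrix_incr (Z j \<omega>) (?d i) =
        (if i \<in> {l..<l'} then matrix_incr (Z j \<omega>) (?d i) else 0)"
        by (simp add: l(1,3) indicator_def)
    qed simp
    also have "\<dots> = (\<Sum>i\<in>{l..<l'}. matrix_incr (Z j \<omega>) (?d i))"
      using l by (subst sum.inter_restrict[symmetric]) (auto intro!: sum.cong)
    also have "\<dots> = (\<Sum>k\<in>UNIV. (\<Sum>i\<in>{l..<l'}. ?d i $ k) *\<^sub>R column k (Z j \<omega>))"
      unfolding matrix_incr_columns by (subst sum.swap) (simp add: scaleR_sum_left)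
    also have "\<dots> = matrix_incr (Z j \<omega>) (W (q (Suc j)) \<omega> - W (q j) \<omega>)"
      unfolding matrix_incr_columns sum_component[symmetric] l(1,3)
      using sum_Suc_diff'[of l l' "\<lambda>i. W (p i) \<omega>"] ll by simp
    finally show ?thesis .
  qed
  have "simple_integral W n p (\<lambda>i. simple_value m q Z (p (Suc i))) \<omega> =
    (\<Sum>i<n. \<Sum>j<m. indicator {q j<..q (Suc j)} (p (Suc i)) *\<^sub>R matrix_incr (Z j \<omega>) (?d i))"
    unfolding simple_integral_def simple_value_def matrix_incr_sum matrix_incr_scaleR ..
  also have "\<dots> = (\<Sum>j<m. matrix_incr (Z j \<omega>) (W (q (Suc j)) \<omega> - W (q j) \<omega>))"
    by (subst sum.swap) (intro sum.cong refl, simp only: * lessThan_iff)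
  finally show ?thesis by (simp add: simple_integral_def)
qed

lemma increasing_enumeration:
  fixes P :: "real set"
  assumes "finite P" "s \<in> P" "t \<in> P" "P \<subseteq> {s..t}"
  obtains n p where "\<forall>i<n. p i < p (Suc i)" "p 0 = s" "p n = t" "p ` {..n} = P"
proof -
  define xs where "xs = sorted_list_of_set P"
  have xs: "set xs = P" "sorted_wrt (<) xs" using assms(1) by (simp_all add: xs_def)
  define n where "n = length xs - 1"
  have len: "length xs = Suc n" using xs(1) assms(2) unfolding n_def by (cases xs) auto
  define p where "p = (\<lambda>i. xs ! i)"
  have inc: "\<forall>i<n. p i < p (Suc i)"
    using xs(2) len by (auto simp: p_def sorted_wrt_iff_nth_less)
  have im: "p ` {..n} = P"
    using xs(1) len by (auto simp: p_def set_conv_nth image_def less_Suc_eq_le)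
  have "p 0 = s" "p n = t"
  proof -
    obtain i j where ij: "i \<le> n" "p i = s" "j \<le> n" "p j = t" using im assms(2,3) by (metis atMost_iff imageE)
    have "p 0 \<in> P" "p n \<in> P" using im by auto
    then have "s \<le> p 0" "p n \<le> t" using assms(4) by auto
    moreover have "p 0 \<le> p i" "p j \<le> p n" using increasing_upto_le[OF inc] ij by auto
    ultimately show "p 0 = s" "p n = t" using ij by auto
  qed
  then show ?thesis using that inc im by blast
qed

section \<open>Simple processes and the filtration\<close>

context filtered_prob_space
begin

lemma simple_processD:
  assumes "simple_process M F a t n q Z"
  shows "\<forall>i<n. q i < q (Suc i)" "q 0 = a" "q n = t" "i < n \<Longrightarrow> Z i \<in> borel_measurable (F (q i))"
    "i < n \<Longrightarrow> Z i \<in> borel_measurable M" "i \<le> n \<Longrightarrow> a \<le> q i" "i \<le> n \<Longrightarrow> q i \<le> t"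
    "i < n \<Longrightarrow> \<exists>K. \<forall>\<omega>\<in>space M. norm (Z i \<omega>) \<le> K"
proof -
  show *: "\<forall>i<n. q i < q (Suc i)" and "q 0 = a" "q n = t"
    "i < n \<Longrightarrow> \<exists>K. \<forall>\<omega>\<in>space M. norm (Z i \<omega>) \<le> K"
    and Z: "i < n \<Longrightarrow> Z i \<in> borel_measurable (F (q i))"
    using assms unfolding simple_process_def by auto
  then show **: "i \<le> n \<Longrightarrow> a \<le> q i" "i \<le> n \<Longrightarrow> q i \<le> t"
    using increasing_upto_le[OF *, of 0 i] increasing_upto_le[OF *, of i n] by auto
  show "i < n \<Longrightarrow> Z i \<in> borel_measurable M"
    by (rule borel_measurable_F[OF Z ** (1)]) auto
qed

lemma simple_process_take:
  "simple_process M F a t n q Z \<Longrightarrow> m \<le> n \<Longrightarrow> simple_process M F a (q m) m q Z"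
  unfolding simple_process_def by auto

lemma simple_value_bounded:
  assumes sp: "simple_process M F a t n q Z"
  obtains K where "\<And>v \<omega>. \<omega> \<in> space M \<Longrightarrow> norm (simple_value n q Z v \<omega>) \<le> K"
proof -
  have "\<forall>i\<in>{..<n}. \<exists>K. \<forall>\<omega>\<in>space M. norm (Z i \<omega>) \<le> K"
    using sp unfolding simple_process_def by auto
  then obtain K where K: "\<And>i \<omega>. i < n \<Longrightarrow> \<omega> \<in> space M \<Longrightarrow> norm (Z i \<omega>) \<le> K i"
    by (auto dest!: bchoice)
  have "norm (simple_value n q Z v \<omega>) \<le> (\<Sum>i<n. K i)" if "\<omega> \<in> space M" for v \<omega>
  proof -
    have "norm (simple_value n q Z v \<omega>) \<le> (\<Sum>i<n. norm (Z i \<omega>))"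
      unfolding simple_value_def
      by (rule order_trans[OF norm_sum], rule sum_mono) (simp split: split_indicator)
    also have "\<dots> \<le> (\<Sum>i<n. K i)" using K that by (intro sum_mono) auto
    finally show ?thesis .
  qed
  then show ?thesis using that by blast
qed

text \<open>The coefficient is read off at the right end of a cell and must nevertheless be known at
  its left end. It is: only those \<open>Z j\<close> with \<open>q j < p (Suc i)\<close> contribute,
  and such a \<open>q j\<close> is a point of \<open>p\<close>, hence at most
  \<open>p i\<close>.\<close>

lemma simple_process_refine:
  assumes sp: "simple_process M F a t m q Z" and p: "\<forall>i<n. p i < p (Suc i)" "p 0 = a" "p n = r"
    and sub: "q ` {..m} \<subseteq> p ` {..n}"
  shows "simple_process M F a r n p (\<lambda>i. simple_value m q Z (p (Suc i)))"
  unfolding simple_process_def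
proof (intro conjI allI impI)
  fix i assume i: "i < n"
  obtain K where K: "\<And>v \<omega>. \<omega> \<in> space M \<Longrightarrow> norm (simple_value m q Z v \<omega>) \<le> K"
    using simple_value_bounded[OF sp] by blast
  then show "\<exists>K. \<forall>\<omega>\<in>space M. norm (simple_value m q Z (p (Suc i)) \<omega>) \<le> K" by auto
  show "simple_value m q Z (p (Suc i)) \<in> borel_measurable (F (p i))"
    unfolding simple_value_def
  proof (rule borel_measurable_sum)
    fix j assume j: "j \<in> {..<m}"
    show "(\<lambda>\<omega>. indicator {q j<..q (Suc j)} (p (Suc i)) *\<^sub>R Z j \<omega>) \<in> borel_measurable (F (p i))"
    proof (cases "q j < p (Suc i)")
      case True
      obtain l where l: "q j = p l" "l \<le> n"
        using refine_index[OF sub, of j] j by (meson lessThan_iff less_imp_le)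
      have "l \<le> i" using True l increasing_upto_less_iff[OF p(1), of l "Suc i"] i by simp
      then have "q j \<le> p i" using increasing_upto_le[OF p(1)] l i by simp
      moreover have "Z j \<in> borel_measurable (F (q j))" "a \<le> q j"
        using simple_processD(4,6)[OF sp, of j] j by auto
      ultimately have [measurable]: "Z j \<in> borel_measurable (F (p i))"
        using borel_measurable_F_mono by blast
      show ?thesis by measurable
    qed simp
  qed
qed (use p in auto)

lemma simple_value_measurable:
  assumes sp: "simple_process M F a t n q Z"
  shows "(\<lambda>(v, \<omega>). simple_value n q Z v \<omega>) \<in> borel_measurable (borel \<Otimes>\<^sub>M M)"
  unfolding simple_value_def case_prod_beta
proof (rule borel_measurable_sum)
  fix j assume "j \<in> {..<n}"
  then have [measurable]: "Z j \<in> borel_measurable M" using simple_processD(5)[OF sp] by auto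
  show "(\<lambda>x. indicator {q j<..q (Suc j)} (fst x) *\<^sub>R Z j (snd x)) \<in> borel_measurable (borel \<Otimes>\<^sub>M M)"
    by measurable
qed

end

section \<open>Isometry, martingale property and tail bound of simple integrals\<close>

context wiener_process
begin

text \<open>Induction over the cells, with \<open>t\<close> arbitrary because removing the last cell
  moves the terminal time. The integral so far is known at \<open>q n\<close>, so the new summand is
  orthogonal to it and second moments add.\<close>

lemma simple_integral_props:
  assumes "simple_process M F a t n q Z"
  shows simple_integral_measurable_F: "simple_integral W n q Z \<in> borel_measurable (F t)"
    and simple_integral_square_integrable: "integrable M (\<lambda>\<omega>. (norm (simple_integral W n q Z \<omega>))\<^sup>2)"
    and simple_integral_isometry: "expectation (\<lambda>\<omega>. (norm (simple_integral W n q Z \<omega>))\<^sup>2) =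
      (\<Sum>i<n. (q (Suc i) - q i) * expectation (\<lambda>\<omega>. (norm (Z i \<omega>))\<^sup>2))"
proof -
  have "simple_integral W n q Z \<in> borel_measurable (F t) \<and>
    integrable M (\<lambda>\<omega>. (norm (simple_integral W n q Z \<omega>))\<^sup>2) \<and>
    expectation (\<lambda>\<omega>. (norm (simple_integral W n q Z \<omega>))\<^sup>2) =
      (\<Sum>i<n. (q (Suc i) - q i) * expectation (\<lambda>\<omega>. (norm (Z i \<omega>))\<^sup>2))"
    using assms
  proof (induction n arbitrary: t)
    case 0
    then show ?case by (simp add: simple_integral_def)
  next
    case (Suc n)
    let ?S = "simple_integral W n q Z" and ?d = "\<lambda>\<omega>. matrix_incr (Z n \<omega>) (W (q (Suc n)) \<omega> - W (q n) \<omega>)"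
    note D = simple_processD[OF Suc.prems]
    have q: "a \<le> q n" "q n < q (Suc n)" "q (Suc n) = t" using D by auto
    have IH: "?S \<in> borel_measurable (F (q n))" "integrable M (\<lambda>\<omega>. (norm (?S \<omega>))\<^sup>2)"
      "expectation (\<lambda>\<omega>. (norm (?S \<omega>))\<^sup>2) = (\<Sum>i<n. (q (Suc i) - q i) * expectation (\<lambda>\<omega>. (norm (Z i \<omega>))\<^sup>2))"
      using Suc.IH[OF simple_process_take[OF Suc.prems, of n]] by auto
    have Z: "Z n \<in> borel_measurable (F (q n))" using D(4)[of n] by simp
    obtain K where K: "\<And>\<omega>. \<omega> \<in> space M \<Longrightarrow> norm (Z n \<omega>) \<le> K" using D(8)[of n] by auto
    have eq: "simple_integral W (Suc n) q Z \<omega> = ?S \<omega> + ?d \<omega>" for \<omega>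
      by (simp add: simple_integral_def)
    have [measurable]: "?S \<in> borel_measurable (F t)" "Z n \<in> borel_measurable (F t)"
      "W (q (Suc n)) \<in> borel_measurable (F t)" "W (q n) \<in> borel_measurable (F t)"
      using borel_measurable_F_mono[OF IH(1)] borel_measurable_F_mono[OF Z]
        borel_measurable_F_mono[OF adapted] q by auto
    have m: "simple_integral W (Suc n) q Z \<in> borel_measurable (F t)" unfolding eq by measurable
    have dF: "?d \<in> borel_measurable (F t)" by measurable
    have mM: "?S \<in> borel_measurable M" "?d \<in> borel_measurable M"
      using borel_measurable_F[OF \<open>?S \<in> borel_measurable (F t)\<close>] borel_measurable_F[OF dF] q by auto
    note di = matrix_incr_square_integrable[OF q(1,2) Z K]
    have i: "integrable M (\<lambda>\<omega>. (norm (simple_integral W (Suc n) q Z \<omega>))\<^sup>2)"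
      unfolding eq by (rule integrable_norm_add_power2[OF mM IH(2) di])
    have "expectation (\<lambda>\<omega>. (norm (simple_integral W (Suc n) q Z \<omega>))\<^sup>2) =
      expectation (\<lambda>\<omega>. (norm (?S \<omega>))\<^sup>2) + 2 * expectation (\<lambda>\<omega>. ?S \<omega> \<bullet> ?d \<omega>) + expectation (\<lambda>\<omega>. (norm (?d \<omega>))\<^sup>2)"
      unfolding eq norm_add_power2
      using IH(2) di integrable_inner_of_power2[OF mM IH(2) di] by simp
    then show ?case
      using m i matrix_incr_orthogonal[OF q(1,2) Z K IH(1,2)] matrix_incr_isometry[OF q(1,2) Z K] IH(3)
      by simp
  qed
  then show "simple_integral W n q Z \<in> borel_measurable (F t)"
    "integrable M (\<lambda>\<omega>. (norm (simple_integral W n q Z \<omega>))\<^sup>2)"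
    "expectation (\<lambda>\<omega>. (norm (simple_integral W n q Z \<omega>))\<^sup>2) =
      (\<Sum>i<n. (q (Suc i) - q i) * expectation (\<lambda>\<omega>. (norm (Z i \<omega>))\<^sup>2))"
    by auto
qed

lemma simple_integral_measurable:
  assumes "simple_process M F a t n q Z"
  shows "simple_integral W n q Z \<in> borel_measurable M"
  using borel_measurable_F[OF simple_integral_measurable_F[OF assms]] simple_processD(3)[OF assms] simple_processD(6)[OF assms, of n]
  by simp

text \<open>Testing against \<open>\<zeta>\<close> replaces conditional expectations: every cell
  after \<open>q l\<close> starts at a time when \<open>\<zeta>\<close> is already known, so its
  contribution is orthogonal to \<open>\<zeta>\<close>.\<close>

lemma simple_integral_martingale:
  assumes sp: "simple_process M F a t n q Z" and l: "l \<le> n"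
    and \<zeta>: "\<zeta> \<in> borel_measurable (F (q l))" "integrable M (\<lambda>\<omega>. (norm (\<zeta> \<omega>))\<^sup>2)"
  shows "expectation (\<lambda>\<omega>. \<zeta> \<omega> \<bullet> simple_integral W n q Z \<omega>) =
    expectation (\<lambda>\<omega>. \<zeta> \<omega> \<bullet> simple_integral W l q Z \<omega>)"
  using l sp
proof (induction n arbitrary: t rule: dec_induct)
  case (step n)
  let ?S = "simple_integral W n q Z" and ?d = "\<lambda>\<omega>. matrix_incr (Z n \<omega>) (W (q (Suc n)) \<omega> - W (q n) \<omega>)"
  note D = simple_processD[OF step.prems]
  have q: "a \<le> q n" "q n < q (Suc n)" "q (Suc n) = t" "q l \<le> q n" "a \<le> q l"
    using D step.hyps increasing_upto_le[OF D(1), of l n] by auto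
  have Z: "Z n \<in> borel_measurable (F (q n))" using D(4)[of n] by simp
  have [measurable]: "Z n \<in> borel_measurable M" "W (q (Suc n)) \<in> borel_measurable M" "W (q n) \<in> borel_measurable M"
    using D(5)[of n] W_measurable q by auto
  obtain K where K: "\<And>\<omega>. \<omega> \<in> space M \<Longrightarrow> norm (Z n \<omega>) \<le> K" using D(8)[of n] by auto
  note sp' = simple_process_take[OF step.prems, of n, simplified]
  have \<zeta>M: "\<zeta> \<in> borel_measurable M" using borel_measurable_F[OF \<zeta>(1) q(5)] .
  have i1: "integrable M (\<lambda>\<omega>. \<zeta> \<omega> \<bullet> ?S \<omega>)"
    by (rule integrable_inner_of_power2[OF \<zeta>M simple_integral_measurable[OF sp'] \<zeta>(2)
          simple_integral_square_integrable[OF sp']])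
  have i2: "integrable M (\<lambda>\<omega>. \<zeta> \<omega> \<bullet> ?d \<omega>)"
    by (rule integrable_inner_of_power2[OF \<zeta>M _ \<zeta>(2) matrix_incr_square_integrable[OF q(1,2) Z K]]) measurable
  have "simple_integral W (Suc n) q Z \<omega> = ?S \<omega> + ?d \<omega>" for \<omega>
    by (simp add: simple_integral_def)
  then have "expectation (\<lambda>\<omega>. \<zeta> \<omega> \<bullet> simple_integral W (Suc n) q Z \<omega>) =
    expectation (\<lambda>\<omega>. \<zeta> \<omega> \<bullet> ?S \<omega>) + expectation (\<lambda>\<omega>. \<zeta> \<omega> \<bullet> ?d \<omega>)"
    using i1 i2 by (simp add: inner_add_right)
  also have "\<dots> = expectation (\<lambda>\<omega>. \<zeta> \<omega> \<bullet> simple_integral W l q Z \<omega>)"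
    using step.IH[OF sp'] matrix_incr_orthogonal[OF q(1,2) Z K borel_measurable_F_mono[OF \<zeta>(1) q(5,4)] \<zeta>(2)]
    by simp
  finally show ?case .
qed simp

text \<open>
  The coefficients are switched off once their accumulated square exceeds \<open>\<delta>\<close>.  The process stays
  simple, because the square accumulated up to the right end of a partition interval is already
  known at its left end.
\<close>

lemma simple_integral_tail_bound:
  assumes sp: "simple_process M F a t n q Z" and C: "C \<in> events" and pos: "0 < \<epsilon>" "0 \<le> \<delta>"
  shows "prob {\<omega>\<in>C. \<epsilon> < norm (simple_integral W n q Z \<omega>)} \<le>
    prob {\<omega>\<in>C. \<delta> < (\<Sum>i<n. (q (Suc i) - q i) * (norm (Z i \<omega>))\<^sup>2)} + \<delta> / \<epsilon>\<^sup>2"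
proof -
  note D = simple_processD[OF sp]
  define V where "V m \<omega> = (\<Sum>i<m. (q (Suc i) - q i) * (norm (Z i \<omega>))\<^sup>2)" for m \<omega>
  define Y where "Y i \<omega> = indicator {\<omega>. V (Suc i) \<omega> \<le> \<delta>} \<omega> *\<^sub>R Z i \<omega>" for i \<omega>
  have VF: "V (Suc i) \<in> borel_measurable (F (q i))" if "i < n" for i
    unfolding V_def
  proof (rule borel_measurable_sum)
    fix j assume j: "j \<in> {..<Suc i}"
    have [measurable]: "Z j \<in> borel_measurable (F (q i))"
      using borel_measurable_F_mono[OF D(4)[of j], of "q i"] D(6)[of j] j that
        increasing_upto_le[OF D(1), of j i] by auto
    show "(\<lambda>\<omega>. (q (Suc j) - q j) * (norm (Z j \<omega>))\<^sup>2) \<in> borel_measurable (F (q i))" by measurable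
  qed
  have sp': "simple_process M F a t n q Y"
    unfolding simple_process_def
  proof (intro conjI allI impI)
    fix i assume i: "i < n"
    have [measurable]: "V (Suc i) \<in> borel_measurable (F (q i))" "Z i \<in> borel_measurable (F (q i))"
      using VF D(4) i by auto
    show "Y i \<in> borel_measurable (F (q i))" unfolding Y_def by measurable
    obtain K where "\<forall>\<omega>\<in>space M. norm (Z i \<omega>) \<le> K" using D(8) i by blast
    then have "\<forall>\<omega>\<in>space M. norm (Y i \<omega>) \<le> \<bar>K\<bar>" by (auto simp: Y_def indicator_def)
    then show "\<exists>K. \<forall>\<omega>\<in>space M. norm (Y i \<omega>) \<le> K" by blast
  qed (use D in auto)
  have V_mono: "V m \<omega> \<le> V m' \<omega>" if "m \<le> m'" "m' \<le> n" for m m' \<omega>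
    unfolding V_def using that D(1) by (intro sum_mono2) (auto simp: less_imp_le)
  have Yb: "m \<le> n \<Longrightarrow> (\<Sum>i<m. (q (Suc i) - q i) * (norm (Y i \<omega>))\<^sup>2) \<le> \<delta>" for m \<omega>
  proof (induction m)
    case (Suc m)
    show ?case
    proof (cases "V (Suc m) \<omega> \<le> \<delta>")
      case True
      have "V (Suc i) \<omega> \<le> \<delta>" if "i \<le> m" for i
        using V_mono[of "Suc i" "Suc m" \<omega>] that True Suc.prems by auto
      then have "(\<Sum>i<Suc m. (q (Suc i) - q i) * (norm (Y i \<omega>))\<^sup>2) = V (Suc m) \<omega>"
        unfolding V_def[of "Suc m"] by (intro sum.cong) (auto simp: Y_def)
      then show ?thesis using True by simp
    next
      \<comment> \<open>Beyond the threshold \<open>Y m\<close> is \<open>0\<close>, so the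
        accumulated sum stays what it was.\<close>
      case False
      then show ?thesis using Suc by (simp add: Y_def)
    qed
  qed (use pos in simp)
  have eq: "simple_integral W n q Z \<omega> = simple_integral W n q Y \<omega>" if "V n \<omega> \<le> \<delta>" for \<omega>
    unfolding simple_integral_def
  proof (rule sum.cong)
    fix i assume "i \<in> {..<n}"
    then have "V (Suc i) \<omega> \<le> \<delta>" using V_mono[of "Suc i" n \<omega>] that by auto
    then show "matrix_incr (Z i \<omega>) (W (q (Suc i)) \<omega> - W (q i) \<omega>) = matrix_incr (Y i \<omega>) (W (q (Suc i)) \<omega> - W (q i) \<omega>)"
      by (simp add: Y_def)
  qed simp
  have [measurable]: "V n \<in> borel_measurable M" unfolding V_def
    using D(5) by (intro borel_measurable_sum borel_measurable_times borel_measurable_power borel_measurable_norm) auto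
  have [measurable]: "simple_integral W n q Z \<in> borel_measurable M" "simple_integral W n q Y \<in> borel_measurable M"
    using simple_integral_measurable sp sp' by auto
  have "expectation (\<lambda>\<omega>. (norm (simple_integral W n q Y \<omega>))\<^sup>2) \<le> \<delta>"
  proof -
    have Yi: "integrable M (\<lambda>\<omega>. (norm (Y i \<omega>))\<^sup>2)" if "i < n" for i
    proof -
      note YD = simple_processD(5)[OF sp' that] simple_processD(8)[OF sp' that]
      have [measurable]: "Y i \<in> borel_measurable M" by (rule YD)
      obtain K where K: "\<forall>\<omega>\<in>space M. norm (Y i \<omega>) \<le> K" using YD(2) by blast
      show ?thesis
        by (rule integrable_const_bound[of _ "K\<^sup>2"]) (use K in \<open>auto intro!: power_mono\<close>)
    qed
    have "expectation (\<lambda>\<omega>. (norm (simple_integral W n q Y \<omega>))\<^sup>2) =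
      expectation (\<lambda>\<omega>. \<Sum>i<n. (q (Suc i) - q i) * (norm (Y i \<omega>))\<^sup>2)"
      unfolding simple_integral_isometry[OF sp'] using Yi by (simp add: Bochner_Integration.integral_sum)
    also have "\<dots> \<le> \<delta>"
      by (rule integral_le_const) (use Yi Yb[of n] in \<open>auto intro!: Bochner_Integration.integrable_sum\<close>)
    finally show ?thesis .
  qed
  then have Ch: "prob {\<omega>\<in>space M. \<epsilon> \<le> norm (simple_integral W n q Y \<omega>)} \<le> \<delta> / \<epsilon>\<^sup>2"
  proof -
    have "prob {\<omega>\<in>space M. \<epsilon>\<^sup>2 \<le> (norm (simple_integral W n q Y \<omega>))\<^sup>2} \<le>
      expectation (\<lambda>\<omega>. (norm (simple_integral W n q Y \<omega>))\<^sup>2) / \<epsilon>\<^sup>2"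
      by (rule integral_Markov_inequality_measure[where A = "space M" and u = "\<lambda>\<omega>. (norm (simple_integral W n q Y \<omega>))\<^sup>2", simplified])
        (use simple_integral_square_integrable[OF sp'] pos in auto)
    also have "\<dots> \<le> \<delta> / \<epsilon>\<^sup>2" 
      using \<open>expectation (\<lambda>\<omega>. (norm (simple_integral W n q Y \<omega>))\<^sup>2) \<le> \<delta>\<close> by (intro divide_right_mono) auto
    moreover have "\<epsilon>\<^sup>2 \<le> (norm (simple_integral W n q Y \<omega>))\<^sup>2 \<longleftrightarrow> \<epsilon> \<le> norm (simple_integral W n q Y \<omega>)" for \<omega>
      using pos by (simp add: power2_le_iff_abs_le abs_le_square_iff[symmetric])
    ultimately show ?thesis by simp
  qed
  \<comment> \<open>Where the energy is at most \<open>\<delta>\<close>, \<open>Z\<close> and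
    \<open>Y\<close> have the same integral and the Chebyshev bound applies; the exceptional paths
    are counted inside \<open>C\<close> only. This localisation matters because the energy will be
    under control only on a survival event.\<close>
  have "prob {\<omega>\<in>C. \<epsilon> < norm (simple_integral W n q Z \<omega>)} \<le>
    prob ({\<omega>\<in>C. \<delta> < V n \<omega>} \<union> {\<omega>\<in>space M. \<epsilon> \<le> norm (simple_integral W n q Y \<omega>)})"
  proof (rule finite_measure_mono)
    show "{\<omega>\<in>C. \<epsilon> < norm (simple_integral W n q Z \<omega>)} \<subseteq>
      {\<omega>\<in>C. \<delta> < V n \<omega>} \<union> {\<omega>\<in>space M. \<epsilon> \<le> norm (simple_integral W n q Y \<omega>)}"
    proof
      fix \<omega> assume "\<omega> \<in> {\<omega>\<in>C. \<epsilon> < norm (simple_integral W n q Z \<omega>)}"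
      moreover have "\<omega> \<in> space M" if "\<omega> \<in> C" using that sets.sets_into_space[OF C] by blast
      ultimately show "\<omega> \<in> {\<omega>\<in>C. \<delta> < V n \<omega>} \<union> {\<omega>\<in>space M. \<epsilon> \<le> norm (simple_integral W n q Y \<omega>)}"
        using eq[of \<omega>] by (cases "V n \<omega> \<le> \<delta>") auto
    qed
    have "{\<omega>\<in>C. \<delta> < V n \<omega>} = C \<inter> {\<omega>\<in>space M. \<delta> < V n \<omega>}" using sets.sets_into_space[OF C] by auto
    then show "{\<omega>\<in>C. \<delta> < V n \<omega>} \<union> {\<omega>\<in>space M. \<epsilon> \<le> norm (simple_integral W n q Y \<omega>)} \<in> events"
      using C by simp
  qed
  also have "\<dots> \<le> prob {\<omega>\<in>C. \<delta> < V n \<omega>} + prob {\<omega>\<in>space M. \<epsilon> \<le> norm (simple_integral W n q Y \<omega>)}"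
  proof (rule measure_Un_le)
    have "{\<omega>\<in>C. \<delta> < V n \<omega>} = C \<inter> {\<omega>\<in>space M. \<delta> < V n \<omega>}" using sets.sets_into_space[OF C] by auto
    then show "{\<omega>\<in>C. \<delta> < V n \<omega>} \<in> events" using C by simp
  qed measurable
  finally show ?thesis using Ch unfolding V_def by linarith
qed

end

section \<open>Convergence in probability\<close>

lemma borel_measurable_extend_by_zero:
  fixes h :: "real \<Rightarrow> 'w \<Rightarrow> 'e :: {real_normed_vector, second_countable_topology}"
  assumes "(\<lambda>(t, \<omega>). h t \<omega>) \<in> borel_measurable (restrict_space borel {a..b} \<Otimes>\<^sub>M M)"
  shows "(\<lambda>(t, \<omega>). indicator {a..b} t *\<^sub>R h t \<omega>) \<in> borel_measurable (borel \<Otimes>\<^sub>M M)"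
proof (cases "a \<le> b")
  case True
  \<comment> \<open>Clamping time to \<open>[a,b]\<close> is a measurable map of the line into the
    strip on which \<open>h\<close> is known to be measurable; the indicator then erases the clamped
    values.\<close>
  define c where "c v = max a (min b v)" for v :: real
  have "c \<in> borel \<rightarrow>\<^sub>M restrict_space borel {a..b}"
    using True by (intro measurable_restrict_space2) (auto simp: c_def[abs_def])
  then have "(\<lambda>(t, \<omega>). (c t, \<omega>)) \<in> borel \<Otimes>\<^sub>M M \<rightarrow>\<^sub>M restrict_space borel {a..b} \<Otimes>\<^sub>M M"
    by measurable
  from measurable_compose[OF this assms]
  have hc: "(\<lambda>x. h (c (fst x)) (snd x)) \<in> borel_measurable (borel \<Otimes>\<^sub>M M)"
    by (simp add: case_prod_beta)
  have "(\<lambda>x. indicator {a..b} (fst x) *\<^sub>R h (c (fst x)) (snd x)) \<in> borel_measurable (borel \<Otimes>\<^sub>M M)"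
    by (rule borel_measurable_scaleR[OF _ hc]) measurable
  moreover have "(\<lambda>(t, \<omega>). indicator {a..b} t *\<^sub>R h t \<omega>) = (\<lambda>x. indicator {a..b} (fst x) *\<^sub>R h (c (fst x)) (snd x))"
    by (auto simp: fun_eq_iff c_def split: split_indicator)
  ultimately show ?thesis by simp
qed simp

lemma measurable_adapted_diff:
  fixes h h' :: "real \<Rightarrow> 'w \<Rightarrow> 'e :: {real_normed_vector, second_countable_topology}"
  assumes h: "measurable_adapted M F a b h" and h': "measurable_adapted M F a b h'"
  shows "measurable_adapted M F a b (\<lambda>v \<omega>. h v \<omega> - h' v \<omega>)"
proof -
  have [measurable]: "(\<lambda>(v, \<omega>). h v \<omega>) \<in> borel_measurable (restrict_space borel {a..b} \<Otimes>\<^sub>M M)"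
    "(\<lambda>(v, \<omega>). h' v \<omega>) \<in> borel_measurable (restrict_space borel {a..b} \<Otimes>\<^sub>M M)"
    using h h' by (simp_all add: measurable_adapted_def)
  have "(\<lambda>(v, \<omega>). h v \<omega> - h' v \<omega>) \<in> borel_measurable (restrict_space borel {a..b} \<Otimes>\<^sub>M M)" by measurable
  then show ?thesis
    unfolding measurable_adapted_def
    using h h' by (intro conjI ballI borel_measurable_diff) (simp_all add: measurable_adapted_def)
qed

lemma measurable_adapted_restrict:
  assumes "measurable_adapted M F a b h" and st: "a \<le> s" "t \<le> b"
  shows "(\<lambda>(v, \<omega>). h v \<omega>) \<in> borel_measurable (restrict_space borel {s..t} \<Otimes>\<^sub>M M)"
proof -
  have h: "(\<lambda>(v, \<omega>). h v \<omega>) \<in> borel_measurable (restrict_space borel {a..b} \<Otimes>\<^sub>M M)"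
    using assms(1) unfolding measurable_adapted_def by (rule conjunct1)
  have "(\<lambda>v. v) \<in> restrict_space borel {s..t} \<rightarrow>\<^sub>M restrict_space borel {a..b}"
    by (rule measurable_restrict_space2)
      (use st in \<open>auto simp: space_restrict_space intro: measurable_restrict_space1\<close>)
  then have [measurable]: "(\<lambda>v. v) \<in> restrict_space borel {s..t} \<rightarrow>\<^sub>M restrict_space borel {a..b}" .
  have "(\<lambda>x. (fst x, snd x)) \<in> restrict_space borel {s..t} \<Otimes>\<^sub>M M \<rightarrow>\<^sub>M restrict_space borel {a..b} \<Otimes>\<^sub>M M"
    by measurable
  then have "(\<lambda>x. x) \<in> restrict_space borel {s..t} \<Otimes>\<^sub>M M \<rightarrow>\<^sub>M restrict_space borel {a..b} \<Otimes>\<^sub>M M" by simp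
  from measurable_compose[OF this h] show ?thesis .
qed

lemma measurable_adapted_subset:
  assumes h: "measurable_adapted M F a b h" and t: "t \<le> b"
  shows "measurable_adapted M F a t h"
  unfolding measurable_adapted_def
proof (intro conjI ballI)
  show "(\<lambda>(v, \<omega>). h v \<omega>) \<in> borel_measurable (restrict_space borel {a..t} \<Otimes>\<^sub>M M)"
    by (rule measurable_adapted_restrict[OF h order_refl t])
  show "h v \<in> borel_measurable (F v)" if "v \<in> {a..t}" for v
    using h that t unfolding measurable_adapted_def by simp
qed

lemma power2_norm_diff_le:
  "(norm (x - z))\<^sup>2 \<le> 2 * ((norm (x - y))\<^sup>2 + (norm (z - y :: 'a :: real_normed_vector))\<^sup>2)"
proof -
  have "norm (x - z) \<le> norm (x - y) + norm (z - y)"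
    using norm_triangle_ineq4[of "x - y" "z - y"] by simp
  then have "(norm (x - z))\<^sup>2 \<le> (norm (x - y) + norm (z - y))\<^sup>2" by (intro power_mono) auto
  also have "\<dots> \<le> 2 * ((norm (x - y))\<^sup>2 + (norm (z - y))\<^sup>2)"
    using sum_squares_bound[of "norm (x - y)" "norm (z - y)"] by (simp add: power2_sum)
  finally show ?thesis .
qed

section \<open>Convergence in probability: domination and expectations\<close>

context prob_space
begin

lemma tends_in_prob_0_bound:
  assumes [measurable]: "\<And>k. X k \<in> borel_measurable M" "\<And>k. Y k \<in> borel_measurable M"
    and X: "tends_in_prob_0 M X" and Y: "tends_in_prob_0 M Y" and C: "0 < C"
    and Z: "\<And>k \<omega>. \<omega> \<in> space M \<Longrightarrow> Z k \<omega> \<le> ennreal C * (X k \<omega> + Y k \<omega>)"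
  shows "tends_in_prob_0 M Z"
  unfolding tends_in_prob_0_def
proof (intro allI impI)
  fix \<epsilon> :: real assume \<epsilon>: "0 < \<epsilon>"
  \<comment> \<open>If \<open>X\<close> and \<open>Y\<close> are both at most
    \<open>\<delta>\<close>, then \<open>Z\<close> is at most
    \<open>2 * C * \<delta> = \<epsilon>\<close>.\<close>
  define \<delta> where "\<delta> = \<epsilon> / (2 * C)"
  have \<delta>: "0 < \<delta>" "ennreal C * (ennreal \<delta> + ennreal \<delta>) = ennreal \<epsilon>"
    using \<epsilon> C by (simp_all add: \<delta>_def flip: ennreal_plus ennreal_mult')
  have "(\<lambda>k. prob {\<omega>\<in>space M. ennreal \<delta> < X k \<omega>} + prob {\<omega>\<in>space M. ennreal \<delta> < Y k \<omega>}) \<longlonglongrightarrow> 0 + 0"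
    using X Y \<delta>(1) unfolding tends_in_prob_0_def by (intro tendsto_add) auto
  then have lim: "(\<lambda>k. prob {\<omega>\<in>space M. ennreal \<delta> < X k \<omega>} + prob {\<omega>\<in>space M. ennreal \<delta> < Y k \<omega>}) \<longlonglongrightarrow> 0"
    by simp
  show "(\<lambda>k. prob {\<omega>\<in>space M. ennreal \<epsilon> < Z k \<omega>}) \<longlonglongrightarrow> 0"
  proof (rule tendsto_sandwich[OF _ _ tendsto_const lim])
    show "\<forall>\<^sub>F k in sequentially. 0 \<le> prob {\<omega>\<in>space M. ennreal \<epsilon> < Z k \<omega>}" by simp
    show "\<forall>\<^sub>F k in sequentially. prob {\<omega>\<in>space M. ennreal \<epsilon> < Z k \<omega>} \<le>
      prob {\<omega>\<in>space M. ennreal \<delta> < X k \<omega>} + prob {\<omega>\<in>space M. ennreal \<delta> < Y k \<omega>}"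
    proof (rule always_eventually, rule allI)
      fix k
      have "prob {\<omega>\<in>space M. ennreal \<epsilon> < Z k \<omega>} \<le>
        prob ({\<omega>\<in>space M. ennreal \<delta> < X k \<omega>} \<union> {\<omega>\<in>space M. ennreal \<delta> < Y k \<omega>})"
      proof (rule finite_measure_mono)
        show "{\<omega>\<in>space M. ennreal \<epsilon> < Z k \<omega>} \<subseteq> {\<omega>\<in>space M. ennreal \<delta> < X k \<omega>} \<union> {\<omega>\<in>space M. ennreal \<delta> < Y k \<omega>}"
        proof (rule subsetI, rule ccontr)
          fix \<omega> assume *: "\<omega> \<in> {\<omega>\<in>space M. ennreal \<epsilon> < Z k \<omega>}"
            "\<omega> \<notin> {\<omega>\<in>space M. ennreal \<delta> < X k \<omega>} \<union> {\<omega>\<in>space M. ennreal \<delta> < Y k \<omega>}"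
          then have "X k \<omega> + Y k \<omega> \<le> ennreal \<delta> + ennreal \<delta>" by (intro add_mono) auto
          then have "ennreal C * (X k \<omega> + Y k \<omega>) \<le> ennreal C * (ennreal \<delta> + ennreal \<delta>)"
            by (rule mult_left_mono) simp
          then have "Z k \<omega> \<le> ennreal C * (ennreal \<delta> + ennreal \<delta>)"
            using Z[of \<omega> k] * by (auto intro: order_trans)
          then show False using * \<delta> by auto
        qed
      qed measurable
      also have "\<dots> \<le> prob {\<omega>\<in>space M. ennreal \<delta> < X k \<omega>} + prob {\<omega>\<in>space M. ennreal \<delta> < Y k \<omega>}"
        by (rule measure_Un_le) measurable
      finally show "prob {\<omega>\<in>space M. ennreal \<epsilon> < Z k \<omega>} \<le>
        prob {\<omega>\<in>space M. ennreal \<delta> < X k \<omega>} + prob {\<omega>\<in>space M. ennreal \<delta> < Y k \<omega>}" .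
    qed
  qed
qed

text \<open>The second moment bound supplies uniform integrability.\<close>

lemma expectation_tendsto_0:
  fixes Y :: "nat \<Rightarrow> 'a \<Rightarrow> real"
  assumes [measurable]: "\<And>k. Y k \<in> borel_measurable M"
    and nonneg: "\<And>k \<omega>. \<omega> \<in> space M \<Longrightarrow> 0 \<le> Y k \<omega>"
    and int: "\<And>k. integrable M (\<lambda>\<omega>. (Y k \<omega>)\<^sup>2)" and Q: "\<And>k. expectation (\<lambda>\<omega>. (Y k \<omega>)\<^sup>2) \<le> Q"
    and lim: "\<And>\<epsilon>. 0 < \<epsilon> \<Longrightarrow> (\<lambda>k. prob {\<omega>\<in>space M. \<epsilon> < Y k \<omega>}) \<longlonglongrightarrow> 0"
  shows "(\<lambda>k. expectation (Y k)) \<longlonglongrightarrow> 0"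
proof (rule LIMSEQ_I)
  fix e :: real assume e: "0 < e"
  have Q0: "0 \<le> Q" using order_trans[OF _ Q[of 0]] by simp
  \<comment> \<open>Off \<open>?A\<close> the variable is at most \<open>e / 4\<close>; on
    \<open>?A\<close> it is at most \<open>\<kappa> * Y^2 + 1 / (4 * \<kappa>)\<close>. With
    \<open>prob ?A < e * \<kappa>\<close> each of the three contributions is at most
    \<open>e / 4\<close>. The \<open>+ 1\<close> avoids a division by zero when
    \<open>Q = 0\<close>.\<close>
  define \<kappa> where "\<kappa> = e / (4 * (Q + 1))"
  have \<kappa>: "0 < \<kappa>" "\<kappa> * Q \<le> e / 4"
    using e Q0 by (simp_all add: \<kappa>_def field_simps)
  have "0 < e * \<kappa>" using e \<kappa> by simp
  from LIMSEQ_D[OF lim[of "e / 4"] this] e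
  obtain k0 where k0: "\<And>k. k0 \<le> k \<Longrightarrow> prob {\<omega>\<in>space M. e / 4 < Y k \<omega>} < e * \<kappa>" by auto
  show "\<exists>k0. \<forall>k\<ge>k0. norm (expectation (Y k) - 0) < e"
  proof (intro exI allI impI)
    fix k assume k: "k0 \<le> k"
    let ?A = "{\<omega>\<in>space M. e / 4 < Y k \<omega>}"
    have Yi: "integrable M (Y k)"
      by (rule square_integrable_imp_integrable[OF _ int]) measurable
    have "expectation (Y k) \<le> expectation (\<lambda>\<omega>. e / 4 + (\<kappa> * (Y k \<omega>)\<^sup>2 + indicator ?A \<omega> / (4 * \<kappa>)))"
    proof (rule integral_mono)
      show "integrable M (\<lambda>\<omega>. e / 4 + (\<kappa> * (Y k \<omega>)\<^sup>2 + indicator ?A \<omega> / (4 * \<kappa>)))"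
        using int by (auto intro!: Bochner_Integration.integrable_add simp: integrable_real_indicator emeasure_eq_measure)
      fix \<omega> assume \<omega>: "\<omega> \<in> space M"
      have "Y k \<omega> \<le> \<kappa> * (Y k \<omega>)\<^sup>2 + 1 / (4 * \<kappa>)"
      proof -
        have "0 \<le> (2 * \<kappa> * Y k \<omega> - 1)\<^sup>2 / (4 * \<kappa>)" using \<kappa> by simp
        also have "\<dots> = \<kappa> * (Y k \<omega>)\<^sup>2 + 1 / (4 * \<kappa>) - Y k \<omega>"
          using \<kappa> by (simp add: power2_eq_square field_simps)
        finally show ?thesis by simp
      qed
      then show "Y k \<omega> \<le> e / 4 + (\<kappa> * (Y k \<omega>)\<^sup>2 + indicator ?A \<omega> / (4 * \<kappa>))"
      proof (cases "\<omega> \<in> ?A")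
        case False
        then have "Y k \<omega> \<le> e / 4" using \<omega> by auto
        moreover have "0 \<le> \<kappa> * (Y k \<omega>)\<^sup>2" using \<kappa> by simp
        ultimately show ?thesis using False by simp
      qed (use e in simp)
    qed (rule Yi)
    also have "\<dots> = e / 4 + (\<kappa> * expectation (\<lambda>\<omega>. (Y k \<omega>)\<^sup>2) + prob ?A / (4 * \<kappa>))"
      using int by (simp add: prob_space integrable_real_indicator emeasure_eq_measure)
    also have "\<dots> \<le> e / 4 + (\<kappa> * Q + (e * \<kappa>) / (4 * \<kappa>))"
      using k0[OF k] \<kappa> Q[of k] by (intro add_left_mono add_mono mult_left_mono divide_right_mono) auto
    also have "\<dots> < e" using \<kappa> e by (simp add: field_simps)
    finally show "norm (expectation (Y k) - 0) < e"
      using nonneg Bochner_Integration.integral_nonneg[of M "Y k"] by (simp add: nonneg)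
  qed
qed

end

section \<open>Changing the partition or the horizon of a simple process\<close>

context filtered_prob_space
begin

lemma simple_error_measurable:
  assumes sp: "simple_process M F a t n q Z" and h: "measurable_adapted M F a t h"
  shows "(\<lambda>\<omega>. \<integral>\<^sup>+v\<in>{a..t}. ennreal ((norm (simple_value n q Z v \<omega> - h v \<omega>))\<^sup>2) \<partial>lborel) \<in> borel_measurable M"
proof -
  define g where "g v \<omega> = indicator {a..t} v *\<^sub>R h v \<omega>" for v \<omega>
  have [measurable]: "(\<lambda>(v, \<omega>). g v \<omega>) \<in> borel_measurable (borel \<Otimes>\<^sub>M M)"
    unfolding g_def using h by (intro borel_measurable_extend_by_zero) (simp add: measurable_adapted_def)
  note simple_value_measurable[OF sp, measurable]
  have "(\<lambda>\<omega>. \<integral>\<^sup>+v. ennreal ((norm (simple_value n q Z v \<omega> - g v \<omega>))\<^sup>2) * indicator {a..t} v \<partial>lborel) \<in> borel_measurable M"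
    by measurable
  then show ?thesis
    by (rule measurable_cong[THEN iffD1, rotated])
      (auto intro!: nn_integral_cong simp: g_def split: split_indicator)
qed

text \<open>Simple processes with different partitions are subtracted on the union of their
  partition points, again with coefficients read off at the right ends.\<close>

lemma simple_process_common:
  fixes Z Z' :: "nat \<Rightarrow> 'w \<Rightarrow> complex ^ 'm ^ 'd"
  assumes sp: "simple_process M F a t n q Z" and sp': "simple_process M F a t n' q' Z'"
  obtains m p Y where "simple_process M F a t m p Y"
    "\<And>v \<omega>. simple_value m p Y v \<omega> = simple_value n q Z v \<omega> - simple_value n' q' Z' v \<omega>"
    "\<And>W \<omega>. simple_integral W m p Y \<omega> = simple_integral W n q Z \<omega> - simple_integral W n' q' Z' \<omega>"
proof -
  note D = simple_processD[OF sp] and D' = simple_processD[OF sp']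
  have "a \<in> q ` {..n} \<union> q' ` {..n'}" "t \<in> q ` {..n} \<union> q' ` {..n'}" "q ` {..n} \<union> q' ` {..n'} \<subseteq> {a..t}"
    using D(2,3,6,7) D'(2,3,6,7) by (auto simp: image_iff)
  then obtain m p where p: "\<forall>i<m. p i < p (Suc i)" "p 0 = a" "p m = t" "p ` {..m} = q ` {..n} \<union> q' ` {..n'}"
    by (rule increasing_enumeration[rotated]) auto
  define Y where "Y i \<omega> = simple_value n q Z (p (Suc i)) \<omega> - simple_value n' q' Z' (p (Suc i)) \<omega>" for i \<omega>
  have sub: "q ` {..n} \<subseteq> p ` {..m}" "q' ` {..n'} \<subseteq> p ` {..m}" using p(4) by auto
  note r = simple_process_refine[OF sp p(1-3) sub(1)] and r' = simple_process_refine[OF sp' p(1-3) sub(2)]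
  have 1: "simple_process M F a t m p Y"
    unfolding simple_process_def
  proof (intro conjI allI impI)
    fix i assume i: "i < m"
    show "Y i \<in> borel_measurable (F (p i))"
      unfolding Y_def using simple_processD(4)[OF r i] simple_processD(4)[OF r' i] by (rule borel_measurable_diff)
    obtain K K' where "\<And>v \<omega>. \<omega> \<in> space M \<Longrightarrow> norm (simple_value n q Z v \<omega>) \<le> K"
      "\<And>v \<omega>. \<omega> \<in> space M \<Longrightarrow> norm (simple_value n' q' Z' v \<omega>) \<le> K'"
      using simple_value_bounded[OF sp] simple_value_bounded[OF sp'] by metis
    then have "\<forall>\<omega>\<in>space M. norm (Y i \<omega>) \<le> K + K'"
      unfolding Y_def by (blast intro: order_trans[OF norm_triangle_ineq4] add_mono)
    then show "\<exists>K. \<forall>\<omega>\<in>space M. norm (Y i \<omega>) \<le> K" by blast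
  qed (use p in auto)
  have 2: "simple_value m p Y v \<omega> = simple_value n q Z v \<omega> - simple_value n' q' Z' v \<omega>" for v \<omega>
  proof (cases "a < v \<and> v \<le> t")
    case True
    then obtain i where i: "i < m" "p i < v" "v \<le> p (Suc i)" using step_interval[of p v m] p by auto
    show ?thesis
      unfolding simple_value_eq[OF p(1) i] Y_def refine_simple_value[OF p(1) sub(1) i]
        refine_simple_value[OF p(1) sub(2) i] ..
  next
    case False
    then show ?thesis
      using simple_value_outside[OF p(1), of v Y \<omega>] simple_value_outside[OF D(1), of v Z \<omega>]
        simple_value_outside[OF D'(1), of v Z' \<omega>] p D(2,3) D'(2,3) by auto
  qed
  have 3: "simple_integral W m p Y \<omega> = simple_integral W n q Z \<omega> - simple_integral W n' q' Z' \<omega>"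
    for W :: "real \<Rightarrow> 'w \<Rightarrow> real ^ 'm" and \<omega>
    unfolding refine_simple_integral[OF p(1) D(1) sub(1), of W Z \<omega>, symmetric]
      refine_simple_integral[OF p(1) D'(1) sub(2), of W Z' \<omega>, symmetric]
    by (simp add: simple_integral_def Y_def matrix_incr_diff sum_subtractf)
  show ?thesis by (rule that[OF 1 2 3])
qed

text \<open>Prolongation by \<open>0\<close> after \<open>s\<close>. It brings approximations of the
  integral up to \<open>s\<close> to the same horizon as those up to a later time, so that the two
  can be subtracted.\<close>

lemma simple_process_extend:
  fixes Z :: "nat \<Rightarrow> 'w \<Rightarrow> complex ^ 'm ^ 'd"
  assumes sp: "simple_process M F a s n q Z" and st: "s \<le> t"
  obtains m p Y where "simple_process M F a t m p Y"
    "\<And>v \<omega>. simple_value m p Y v \<omega> = simple_value n q Z v \<omega>"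
    "\<And>W \<omega>. simple_integral W m p Y \<omega> = simple_integral W n q Z \<omega>"
proof -
  note D = simple_processD[OF sp]
  have "a \<le> s" using D(6)[of n] D(3) by simp
  then have "a \<in> insert t (q ` {..n})" "t \<in> insert t (q ` {..n})" "insert t (q ` {..n}) \<subseteq> {a..t}"
    using D(2,3,6) order_trans[OF D(7) st] st by (auto simp: image_iff)
  then obtain m p where p: "\<forall>i<m. p i < p (Suc i)" "p 0 = a" "p m = t" "p ` {..m} = insert t (q ` {..n})"
    by (rule increasing_enumeration[rotated]) auto
  have sub: "q ` {..n} \<subseteq> p ` {..m}" using p(4) by auto
  let ?Y = "\<lambda>i. simple_value n q Z (p (Suc i))"
  have 2: "simple_value m p ?Y v \<omega> = simple_value n q Z v \<omega>" for v \<omega>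
  proof (cases "a < v \<and> v \<le> t")
    case True
    then obtain i where i: "i < m" "p i < v" "v \<le> p (Suc i)" using step_interval[of p v m] p by auto
    show ?thesis unfolding simple_value_eq[OF p(1) i] refine_simple_value[OF p(1) sub i] ..
  next
    case False
    then show ?thesis
      using simple_value_outside[OF p(1), of v ?Y \<omega>] simple_value_outside[OF D(1), of v Z \<omega>] p D(2,3) st by auto
  qed
  show ?thesis
    by (rule that[OF simple_process_refine[OF sp p(1-3) sub] 2 refine_simple_integral[OF p(1) D(1) sub]])
qed

end

context wiener_process
begin

text \<open>Inserting \<open>r\<close> as a partition point allows cutting there. The part after
  \<open>r\<close> is a sum of increments orthogonal to everything known at \<open>r\<close>, so
  test vectors do not see it.\<close>

lemma simple_process_restrict:
  fixes Z :: "nat \<Rightarrow> 'w \<Rightarrow> complex ^ 'm ^ 'd"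
  assumes sp: "simple_process M F a t n q Z" and r: "a \<le> r" "r \<le> t"
  obtains m p Y where "simple_process M F a r m p Y"
    "\<And>v \<omega>. a < v \<Longrightarrow> v \<le> r \<Longrightarrow> simple_value m p Y v \<omega> = simple_value n q Z v \<omega>"
    "\<And>\<zeta>. \<zeta> \<in> borel_measurable (F r) \<Longrightarrow> integrable M (\<lambda>\<omega>. (norm (\<zeta> \<omega>))\<^sup>2) \<Longrightarrow>
      expectation (\<lambda>\<omega>. \<zeta> \<omega> \<bullet> simple_integral W n q Z \<omega>) =
      expectation (\<lambda>\<omega>. \<zeta> \<omega> \<bullet> simple_integral W m p Y \<omega>)"
proof -
  note D = simple_processD[OF sp]
  have "a \<in> insert r (q ` {..n})" "t \<in> insert r (q ` {..n})" "insert r (q ` {..n}) \<subseteq> {a..t}"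
    using D(2,3,6,7) r by (auto simp: image_iff)
  then obtain m p where p: "\<forall>i<m. p i < p (Suc i)" "p 0 = a" "p m = t" "p ` {..m} = insert r (q ` {..n})"
    by (rule increasing_enumeration[rotated]) auto
  have sub: "q ` {..n} \<subseteq> p ` {..m}" using p(4) by auto
  have "r \<in> p ` {..m}" using p(4) by auto
  then obtain l where l: "l \<le> m" "r = p l" by auto
  let ?Y = "\<lambda>i. simple_value n q Z (p (Suc i))"
  note sp' = simple_process_refine[OF sp p(1-3) sub]
  have 1: "simple_process M F a r l p ?Y" using simple_process_take[OF sp' l(1)] l by simp
  have 2: "simple_value l p ?Y v \<omega> = simple_value n q Z v \<omega>" if v: "a < v" "v \<le> r" for v \<omega>
  proof -
    obtain i where i: "i < l" "p i < v" "v \<le> p (Suc i)"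
      by (rule step_interval[of p v l]) (use p l v in auto)
    have i': "i < m" using i l by simp
    show ?thesis
      unfolding simple_value_eq[OF simple_processD(1)[OF 1] i] refine_simple_value[OF p(1) sub i' i(2,3)] ..
  qed
  have 3: "expectation (\<lambda>\<omega>. \<zeta> \<omega> \<bullet> simple_integral W n q Z \<omega>) =
    expectation (\<lambda>\<omega>. \<zeta> \<omega> \<bullet> simple_integral W l p ?Y \<omega>)"
    if "\<zeta> \<in> borel_measurable (F r)" "integrable M (\<lambda>\<omega>. (norm (\<zeta> \<omega>))\<^sup>2)" for \<zeta> :: "'w \<Rightarrow> complex ^ 'd"
    using simple_integral_martingale[OF sp' l(1) that(1)[unfolded l(2)] that(2)]
    unfolding refine_simple_integral[OF p(1) D(1) sub, of W Z] .
  show ?thesis by (rule that[OF 1 2 3])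
qed

text \<open>The bound is assumed for the values; it passes to the coefficients because
  \<open>Z i\<close> is the value at the right end of its cell. The isometry then telescopes to the
  total length.\<close>

lemma simple_integral_bounded_second_moment:
  assumes sp: "simple_process M F a t n q Z"
    and K: "\<And>v \<omega>. a < v \<Longrightarrow> v \<le> t \<Longrightarrow> \<omega> \<in> space M \<Longrightarrow> norm (simple_value n q Z v \<omega>) \<le> K"
  shows "expectation (\<lambda>\<omega>. (norm (simple_integral W n q Z \<omega>))\<^sup>2) \<le> (t - a) * K\<^sup>2"
proof -
  note D = simple_processD[OF sp]
  have "expectation (\<lambda>\<omega>. (norm (simple_integral W n q Z \<omega>))\<^sup>2) \<le> (\<Sum>i<n. (q (Suc i) - q i) * K\<^sup>2)"
    unfolding simple_integral_isometry[OF sp]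
  proof (intro sum_mono mult_left_mono)
    fix i assume "i \<in> {..<n}"
    then have i: "i < n" by simp
    show "0 \<le> q (Suc i) - q i" using D(1) i by (simp add: less_imp_le)
    have [measurable]: "Z i \<in> borel_measurable M" by (rule D(5)[OF i])
    have b: "norm (Z i \<omega>) \<le> K" if "\<omega> \<in> space M" for \<omega>
      using K[OF _ _ that, of "q (Suc i)"] simple_value_eq[OF D(1) i, of "q (Suc i)" Z \<omega>] D(1) i
        D(6)[of i] D(7)[of "Suc i"] by (auto simp: order.strict_trans1)
    show "expectation (\<lambda>\<omega>. (norm (Z i \<omega>))\<^sup>2) \<le> K\<^sup>2"
      by (rule integral_le_const, rule integrable_const_bound[of _ "K\<^sup>2"])
        (use b in \<open>auto intro!: power_mono\<close>)
  qed
  also have "\<dots> = (t - a) * K\<^sup>2"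
    using D(2,3) by (simp add: sum_distrib_right[symmetric] sum_lessThan_telescope)
  finally show ?thesis .
qed

text \<open>The two integrals come with unrelated partitions, so the \<open>k\<close>-th
  approximations are first moved to a common one. Errors then add up, with a factor \<open>2\<close>
  from squaring a difference.\<close>

lemma ito_integral_diff:
  fixes h h' :: "real \<Rightarrow> 'w \<Rightarrow> complex ^ 'm ^ 'd"
  assumes J: "ito_integral M F W a t h J" and J': "ito_integral M F W a t h' J'"
  shows "ito_integral M F W a t (\<lambda>v \<omega>. h v \<omega> - h' v \<omega>) (\<lambda>\<omega>. J \<omega> - J' \<omega>)"
proof -
  have h: "measurable_adapted M F a t h" and h': "measurable_adapted M F a t h'"
    and JM [measurable]: "J \<in> borel_measurable M" "J' \<in> borel_measurable M"
    using J J' by (auto simp: ito_integral_def)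
  obtain n q Z where sp: "\<And>k. simple_process M F a t (n k) (q k) (Z k)"
    and E: "tends_in_prob_0 M (\<lambda>k \<omega>. \<integral>\<^sup>+s\<in>{a..t}. ennreal ((norm (simple_value (n k) (q k) (Z k) s \<omega> - h s \<omega>))\<^sup>2) \<partial>lborel)"
    and I: "tends_in_prob_0 M (\<lambda>k \<omega>. ennreal (norm (simple_integral W (n k) (q k) (Z k) \<omega> - J \<omega>)))"
    using J by (auto simp: ito_integral_def)
  obtain n' q' Z' where sp': "\<And>k. simple_process M F a t (n' k) (q' k) (Z' k)"
    and E': "tends_in_prob_0 M (\<lambda>k \<omega>. \<integral>\<^sup>+s\<in>{a..t}. ennreal ((norm (simple_value (n' k) (q' k) (Z' k) s \<omega> - h' s \<omega>))\<^sup>2) \<partial>lborel)"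
    and I': "tends_in_prob_0 M (\<lambda>k \<omega>. ennreal (norm (simple_integral W (n' k) (q' k) (Z' k) \<omega> - J' \<omega>)))"
    using J' by (auto simp: ito_integral_def)
  \<comment> \<open>One predicate for all three properties, so that size, partition and coefficients
    are chosen together for each \<open>k\<close>.\<close>
  define R where "R k m p Y \<longleftrightarrow> simple_process M F a t m p Y \<and>
    (\<forall>v \<omega>. simple_value m p Y v \<omega> = simple_value (n k) (q k) (Z k) v \<omega> - simple_value (n' k) (q' k) (Z' k) v \<omega>) \<and>
    (\<forall>\<omega>. simple_integral W m p Y \<omega> = simple_integral W (n k) (q k) (Z k) \<omega> - simple_integral W (n' k) (q' k) (Z' k) \<omega>)"
    for k m p Y
  have "\<exists>m p Y. R k m p Y" for k
    unfolding R_def by (rule simple_process_common[OF sp[of k] sp'[of k]]) blast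
  then obtain m p Y where "\<And>k. R k (m k) (p k) (Y k)" by metis
  then have spY: "simple_process M F a t (m k) (p k) (Y k)"
    and vY: "simple_value (m k) (p k) (Y k) v \<omega> = simple_value (n k) (q k) (Z k) v \<omega> - simple_value (n' k) (q' k) (Z' k) v \<omega>"
    and iY: "simple_integral W (m k) (p k) (Y k) \<omega> = simple_integral W (n k) (q k) (Z k) \<omega> - simple_integral W (n' k) (q' k) (Z' k) \<omega>"
    for k v \<omega>
    unfolding R_def by blast+
  \<comment> \<open>Measurability is asked only after multiplication by the indicator, because an
    integrand is controlled on \<open>[a,t]\<close> alone.\<close>
  have e: "(\<integral>\<^sup>+v\<in>{a..t}. ennreal ((norm (f v - f' v))\<^sup>2) \<partial>lborel) \<le>
      ennreal 2 * ((\<integral>\<^sup>+v\<in>{a..t}. ennreal ((norm (f v))\<^sup>2) \<partial>lborel) + (\<integral>\<^sup>+v\<in>{a..t}. ennreal ((norm (f' v))\<^sup>2) \<partial>lborel))"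
    if [measurable]: "(\<lambda>v. indicator {a..t} v *\<^sub>R f v) \<in> borel_measurable borel" "(\<lambda>v. indicator {a..t} v *\<^sub>R f' v) \<in> borel_measurable borel"
    for f f' :: "real \<Rightarrow> complex ^ 'm ^ 'd"
  proof -
    define g g' where "g v = indicator {a..t} v *\<^sub>R f v" and "g' v = indicator {a..t} v *\<^sub>R f' v" for v
    have [measurable]: "g \<in> borel_measurable borel" "g' \<in> borel_measurable borel"
      unfolding g_def g'_def by measurable
    have "ennreal ((norm (f v - f' v))\<^sup>2) * indicator {a..t} v \<le>
      ennreal 2 * (ennreal ((norm (g v))\<^sup>2) + ennreal ((norm (g' v))\<^sup>2))" for v
    proof -
      have "ennreal ((norm (f v - f' v))\<^sup>2) \<le> ennreal (2 * ((norm (f v))\<^sup>2 + (norm (f' v))\<^sup>2))"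
        using power2_norm_diff_le[of "f v" "f' v" 0] by (intro ennreal_leI) simp
      also have "\<dots> = ennreal 2 * (ennreal ((norm (f v))\<^sup>2) + ennreal ((norm (f' v))\<^sup>2))"
        by (simp add: ennreal_mult' ennreal_plus)
      finally show ?thesis by (auto simp: g_def g'_def split: split_indicator)
    qed
    then have "(\<integral>\<^sup>+v\<in>{a..t}. ennreal ((norm (f v - f' v))\<^sup>2) \<partial>lborel) \<le>
      (\<integral>\<^sup>+v. ennreal 2 * (ennreal ((norm (g v))\<^sup>2) + ennreal ((norm (g' v))\<^sup>2)) \<partial>lborel)"
      by (intro nn_integral_mono) auto
    also have "\<dots> = ennreal 2 * ((\<integral>\<^sup>+v. ennreal ((norm (g v))\<^sup>2) \<partial>lborel) + (\<integral>\<^sup>+v. ennreal ((norm (g' v))\<^sup>2) \<partial>lborel))"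
      by (subst nn_integral_cmult) (auto simp: nn_integral_add)
    also have "(\<integral>\<^sup>+v. ennreal ((norm (g v))\<^sup>2) \<partial>lborel) = (\<integral>\<^sup>+v\<in>{a..t}. ennreal ((norm (f v))\<^sup>2) \<partial>lborel)"
      by (intro nn_integral_cong) (auto simp: g_def split: split_indicator)
    also have "(\<integral>\<^sup>+v. ennreal ((norm (g' v))\<^sup>2) \<partial>lborel) = (\<integral>\<^sup>+v\<in>{a..t}. ennreal ((norm (f' v))\<^sup>2) \<partial>lborel)"
      by (intro nn_integral_cong) (auto simp: g'_def split: split_indicator)
    finally show ?thesis .
  qed
  have mh: "(\<lambda>v. indicator {a..t} v *\<^sub>R g v \<omega>) \<in> borel_measurable borel"
    if g: "measurable_adapted M F a t g" and \<omega>: "\<omega> \<in> space M" for g :: "real \<Rightarrow> 'w \<Rightarrow> complex ^ 'm ^ 'd" and \<omega>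
  proof -
    have "(\<lambda>(v, \<omega>). indicator {a..t} v *\<^sub>R g v \<omega>) \<in> borel_measurable (borel \<Otimes>\<^sub>M M)"
      using g by (intro borel_measurable_extend_by_zero) (simp add: measurable_adapted_def)
    from measurable_compose[OF measurable_Pair2'[OF \<omega>] this] show ?thesis by simp
  qed
  show ?thesis
    unfolding ito_integral_def
  proof (intro conjI exI[of _ m] exI[of _ p] exI[of _ Y] allI)
    show "measurable_adapted M F a t (\<lambda>v \<omega>. h v \<omega> - h' v \<omega>)" by (rule measurable_adapted_diff[OF h h'])
    show "AE \<omega> in M. (\<integral>\<^sup>+v\<in>{a..t}. ennreal ((norm (h v \<omega> - h' v \<omega>))\<^sup>2) \<partial>lborel) < \<infinity>"
    proof -
      have "AE \<omega> in M. (\<integral>\<^sup>+s\<in>{a..t}. ennreal ((norm (h s \<omega>))\<^sup>2) \<partial>lborel) < \<infinity>"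
        "AE \<omega> in M. (\<integral>\<^sup>+s\<in>{a..t}. ennreal ((norm (h' s \<omega>))\<^sup>2) \<partial>lborel) < \<infinity>"
        using J J' by (auto simp: ito_integral_def)
      then show ?thesis
        using AE_space
      proof eventually_elim
        case (elim \<omega>)
        show ?case
          by (rule le_less_trans[OF e[OF mh[OF h elim(3)] mh[OF h' elim(3)]]])
            (use elim in \<open>simp add: ennreal_mult_less_top\<close>)
      qed
    qed
    show "simple_process M F a t (m k) (p k) (Y k)" for k by (rule spY)
    show "tends_in_prob_0 M (\<lambda>k \<omega>. \<integral>\<^sup>+s\<in>{a..t}.
      ennreal ((norm (simple_value (m k) (p k) (Y k) s \<omega> - (h s \<omega> - h' s \<omega>)))\<^sup>2) \<partial>lborel)"
    proof (rule tends_in_prob_0_bound[OF _ _ E E', of 2])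
      fix k \<omega> assume \<omega>: "\<omega> \<in> space M"
      have "(\<integral>\<^sup>+s\<in>{a..t}. ennreal ((norm (simple_value (m k) (p k) (Y k) s \<omega> - (h s \<omega> - h' s \<omega>)))\<^sup>2) \<partial>lborel) =
        (\<integral>\<^sup>+s\<in>{a..t}. ennreal ((norm ((simple_value (n k) (q k) (Z k) s \<omega> - h s \<omega>) - (simple_value (n' k) (q' k) (Z' k) s \<omega> - h' s \<omega>)))\<^sup>2) \<partial>lborel)"
        unfolding vY by (simp add: algebra_simps)
      also have "\<dots> \<le> ennreal 2 * ((\<integral>\<^sup>+s\<in>{a..t}. ennreal ((norm (simple_value (n k) (q k) (Z k) s \<omega> - h s \<omega>))\<^sup>2) \<partial>lborel) +
        (\<integral>\<^sup>+s\<in>{a..t}. ennreal ((norm (simple_value (n' k) (q' k) (Z' k) s \<omega> - h' s \<omega>))\<^sup>2) \<partial>lborel))"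
      proof (rule e)
        show "(\<lambda>v. indicator {a..t} v *\<^sub>R (simple_value (n k) (q k) (Z k) v \<omega> - h v \<omega>)) \<in> borel_measurable borel"
          unfolding scaleR_diff_right simple_value_def by (rule borel_measurable_diff[OF _ mh[OF h \<omega>]]) measurable
        show "(\<lambda>v. indicator {a..t} v *\<^sub>R (simple_value (n' k) (q' k) (Z' k) v \<omega> - h' v \<omega>)) \<in> borel_measurable borel"
          unfolding scaleR_diff_right simple_value_def by (rule borel_measurable_diff[OF _ mh[OF h' \<omega>]]) measurable
      qed
      finally show "(\<integral>\<^sup>+s\<in>{a..t}. ennreal ((norm (simple_value (m k) (p k) (Y k) s \<omega> - (h s \<omega> - h' s \<omega>)))\<^sup>2) \<partial>lborel) \<le>
        ennreal 2 * ((\<integral>\<^sup>+s\<in>{a..t}. ennreal ((norm (simple_value (n k) (q k) (Z k) s \<omega> - h s \<omega>))\<^sup>2) \<partial>lborel) +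
        (\<integral>\<^sup>+s\<in>{a..t}. ennreal ((norm (simple_value (n' k) (q' k) (Z' k) s \<omega> - h' s \<omega>))\<^sup>2) \<partial>lborel))" .
    qed (auto intro: simple_error_measurable[OF sp h] simple_error_measurable[OF sp' h'])
    show "tends_in_prob_0 M (\<lambda>k \<omega>. ennreal (norm (simple_integral W (m k) (p k) (Y k) \<omega> - (J \<omega> - J' \<omega>))))"
    proof (rule tends_in_prob_0_bound[OF _ _ I I', of 1])
      have [measurable]: "simple_integral W (n k) (q k) (Z k) \<in> borel_measurable M"
        "simple_integral W (n' k) (q' k) (Z' k) \<in> borel_measurable M" for k
        by (rule simple_integral_measurable[OF sp] simple_integral_measurable[OF sp'])+
      show "(\<lambda>\<omega>. ennreal (norm (simple_integral W (n k) (q k) (Z k) \<omega> - J \<omega>))) \<in> borel_measurable M"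
        "(\<lambda>\<omega>. ennreal (norm (simple_integral W (n' k) (q' k) (Z' k) \<omega> - J' \<omega>))) \<in> borel_measurable M" for k
        by measurable
      show "ennreal (norm (simple_integral W (m k) (p k) (Y k) \<omega> - (J \<omega> - J' \<omega>))) \<le> ennreal 1 *
        (ennreal (norm (simple_integral W (n k) (q k) (Z k) \<omega> - J \<omega>)) +
         ennreal (norm (simple_integral W (n' k) (q' k) (Z' k) \<omega> - J' \<omega>)))" for k \<omega>
        unfolding iY
        using norm_triangle_ineq4[of "simple_integral W (n k) (q k) (Z k) \<omega> - J \<omega>" "simple_integral W (n' k) (q' k) (Z' k) \<omega> - J' \<omega>"]
        by (simp add: algebra_simps ennreal_leI flip: ennreal_plus)
    qed simp
    show "(\<lambda>\<omega>. J \<omega> - J' \<omega>) \<in> borel_measurable M" by measurable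
  qed
qed

end

section \<open>Killed integrands\<close>

text \<open>Metric projection onto the closed ball. It is nonexpansive and fixes the ball, so
  clipping an approximation never increases its distance to a value of \<open>h\<close> that is
  bounded by \<open>K\<close>.\<close>

definition clip :: "real \<Rightarrow> 'b :: euclidean_space \<Rightarrow> 'b" where
  "clip K = closest_point (cball 0 K)"

lemma clip_props:
  fixes x :: "'b :: euclidean_space"
  assumes "0 < K"
  shows norm_clip_le: "norm (clip K x) \<le> K"
    and norm_clip_diff_le: "norm x \<le> K \<Longrightarrow> norm (clip K y - x) \<le> norm (y - x)"
    and borel_measurable_clip: "clip K \<in> borel_measurable (borel :: 'b measure)"
proof -
  have ne: "cball (0 :: 'b) K \<noteq> {}" using assms by simp
  show "norm (clip K x) \<le> K"
    using closest_point_in_set[of "cball 0 K" x] ne by (simp add: clip_def)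
  show "norm (clip K y - x) \<le> norm (y - x)" if "norm x \<le> K"
    using closest_point_lipschitz[of "cball 0 K" y x] closest_point_self[of x "cball 0 K"] ne that
    by (simp add: clip_def dist_norm)
  show "clip K \<in> borel_measurable (borel :: 'b measure)"
    unfolding clip_def
    by (intro borel_measurable_continuous_onI continuous_on_closest_point) (use ne in auto)
qed

text \<open>The decreasing adapted family \<open>D\<close> takes the place of a stopping time:
  \<open>D r\<close> is the event of survival up to \<open>r\<close>. One constant \<open>K\<close>
  bounds all quantities on survival, and nothing is required of \<open>h\<close> after exit beyond
  being an integrand.\<close>

locale killed_integrand = wiener_process M F a W
  for M :: "'w measure" and F :: "real \<Rightarrow> 'w measure" and a :: real
    and W :: "real \<Rightarrow> 'w \<Rightarrow> real ^ 'm" +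
  fixes s t K :: real and D :: "real \<Rightarrow> 'w set" and h :: "real \<Rightarrow> 'w \<Rightarrow> complex ^ 'm ^ 'd"
  assumes ast: "a \<le> s" "s < t" and K: "0 < K"
    and h: "measurable_adapted M F a t h"
    and D: "\<And>r. s \<le> r \<Longrightarrow> r \<le> t \<Longrightarrow> D r \<in> sets (F r)"
    and D_mono: "\<And>r r'. s \<le> r \<Longrightarrow> r \<le> r' \<Longrightarrow> r' \<le> t \<Longrightarrow> D r' \<subseteq> D r"
    and D_joint: "(\<lambda>(r, \<omega>). indicator (D r) \<omega> :: real) \<in> borel_measurable (restrict_space borel {s..t} \<Otimes>\<^sub>M M)"
    and h_bound: "\<And>r \<omega>. s \<le> r \<Longrightarrow> r \<le> t \<Longrightarrow> \<omega> \<in> D r \<Longrightarrow> norm (h r \<omega>) \<le> K"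
begin

text \<open>
  The simple process is killed at the left end points of a grid.  This differs from exact killing
  only in the grid interval in which the path leaves \<open>D\<close>, which costs at most the mesh width.
\<close>

lemma killed_step:
  assumes sp: "simple_process M F a t n q Z" and m: "0 < m"
  obtains N p G where "simple_process M F a t N p G"
    "\<And>v \<omega>. norm (simple_value N p G v \<omega>) \<le> K"
    "\<And>v \<omega>. v \<le> s \<Longrightarrow> simple_value N p G v \<omega> = 0"
    "\<And>v \<omega>. s < v \<Longrightarrow> v \<le> t \<Longrightarrow> \<omega> \<in> D v \<Longrightarrow> simple_value N p G v \<omega> = clip K (simple_value n q Z v \<omega>)"
    "\<And>\<omega>. ennreal (\<Sum>i<N. (p (Suc i) - p i) * (norm (G i \<omega>))\<^sup>2) \<le>
      (\<integral>\<^sup>+v\<in>{s..t}. ennreal (indicator (D v) \<omega> * (norm (clip K (simple_value n q Z v \<omega>)))\<^sup>2) \<partial>lborel) +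
      ennreal ((t - a) / real m * K\<^sup>2)"
proof -
  note Dq = simple_processD[OF sp]
  define \<delta> where "\<delta> = (t - a) / real m"
  have \<delta>: "0 < \<delta>" "\<delta> * real m = t - a" using ast m by (simp_all add: \<delta>_def)
  \<comment> \<open>The points of \<open>q\<close> make this a refinement, \<open>s\<close> makes
    the killing start at a cell boundary, and the uniform grid bounds the mesh by
    \<open>\<delta>\<close>.\<close>
  define P where "P = q ` {..n} \<union> {s} \<union> (\<lambda>j. a + \<delta> * real j) ` {..m}"
  have "a + \<delta> * real j \<le> t" if "j \<le> m" for j
  proof -
    have "\<delta> * real j \<le> \<delta> * real m" using that \<delta>(1) by (intro mult_left_mono) auto
    then show ?thesis using \<delta>(2) by simp
  qed
  then have "finite P" "a \<in> P" "t \<in> P" "P \<subseteq> {a..t}"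
    using Dq(2,3,6,7) ast \<delta>(1) by (auto simp: P_def image_iff)
  then obtain N p where p: "\<forall>i<N. p i < p (Suc i)" "p 0 = a" "p N = t" "p ` {..N} = P"
    by (rule increasing_enumeration)
  have sub: "q ` {..n} \<subseteq> p ` {..N}" using p(4) by (auto simp: P_def)
  obtain l where l: "l \<le> N" "s = p l" using p(4) by (auto simp: P_def)
  have mesh: "p (Suc i) - p i \<le> \<delta>" if i: "i < N" for i
  proof (rule ccontr)
    assume "\<not> p (Suc i) - p i \<le> \<delta>"
    then have gt: "p i + \<delta> < p (Suc i)" by simp
    have pa: "a \<le> p i" "p (Suc i) \<le> t"
      using increasing_upto_le[OF p(1), of 0 i] increasing_upto_le[OF p(1), of "Suc i" N] i p by auto
    \<comment> \<open>Index of the first uniform grid point strictly after \<open>p i\<close>. A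
      cell longer than \<open>\<delta>\<close> would contain that point in its interior.\<close>
    define j where "j = nat \<lfloor>(p i - a) / \<delta>\<rfloor> + 1"
    have "real j = of_int \<lfloor>(p i - a) / \<delta>\<rfloor> + 1" using pa \<delta>(1) by (simp add: j_def)
    then have "(p i - a) / \<delta> < real j" "real j \<le> (p i - a) / \<delta> + 1" by linarith+
    then have j: "p i < a + \<delta> * real j" "a + \<delta> * real j \<le> p i + \<delta>"
      using \<delta>(1) by (simp_all add: field_simps)
    then have "\<delta> * real j < \<delta> * real m" using gt pa \<delta>(2) by linarith
    then have "j \<le> m" using \<delta>(1) by simp
    then have "a + \<delta> * real j \<in> p ` {..N}" using p(4) by (auto simp: P_def)
    then obtain l' where l': "l' \<le> N" "a + \<delta> * real j = p l'" by auto
    have "i < l'" "l' < Suc i"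
      using increasing_upto_less_iff[OF p(1), of i l'] increasing_upto_less_iff[OF p(1), of l' "Suc i"]
        j gt l' i by auto
    then show False by simp
  qed
  \<comment> \<open>Survival is tested at the left end \<open>p i\<close>, where it is known; before
    \<open>s\<close> the coefficient is \<open>0\<close>.\<close>
  define G where "G i \<omega> = (if s \<le> p i then indicator (D (p i)) \<omega> *\<^sub>R clip K (simple_value n q Z (p (Suc i)) \<omega>) else 0)" for i \<omega>
  have Gb: "norm (G i \<omega>) \<le> K" for i \<omega>
    using norm_clip_le[OF K] K by (auto simp: G_def split: split_indicator)
  have 1: "simple_process M F a t N p G"
    unfolding simple_process_def
  proof (intro conjI allI impI)
    fix i assume i: "i < N"
    show "\<exists>K. \<forall>\<omega>\<in>space M. norm (G i \<omega>) \<le> K" using Gb by auto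
    show "G i \<in> borel_measurable (F (p i))"
    proof (cases "s \<le> p i")
      case True
      have [measurable]: "simple_value n q Z (p (Suc i)) \<in> borel_measurable (F (p i))"
        by (rule simple_processD(4)[OF simple_process_refine[OF sp p(1-3) sub] i])
      have "p i \<le> t" using increasing_upto_le[OF p(1), of i N] i p by auto
      then have [measurable]: "D (p i) \<in> sets (F (p i))" using D True by simp
      have [measurable]: "clip K \<in> borel_measurable borel" by (rule borel_measurable_clip[OF K])
      have "(\<lambda>\<omega>. indicator (D (p i)) \<omega> *\<^sub>R clip K (simple_value n q Z (p (Suc i)) \<omega>)) \<in> borel_measurable (F (p i))"
        by measurable
      moreover have "G i = (\<lambda>\<omega>. indicator (D (p i)) \<omega> *\<^sub>R clip K (simple_value n q Z (p (Suc i)) \<omega>))"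
        using True by (simp add: G_def fun_eq_iff)
      ultimately show ?thesis by simp
    next
      case False
      then have "G i = (\<lambda>\<omega>. 0)" by (simp add: G_def fun_eq_iff)
      then show ?thesis by simp
    qed
  qed (use p in auto)
  have split: thesis' if "v \<le> a \<or> t < v \<Longrightarrow> thesis'" "\<And>i. i < N \<Longrightarrow> p i < v \<Longrightarrow> v \<le> p (Suc i) \<Longrightarrow> thesis'" for v thesis'
  proof (cases "a < v \<and> v \<le> t")
    case True
    then show ?thesis using that(2) step_interval[of p v N] p by auto
  qed (use that(1) in auto)
  have s_le: "s \<le> p i" if "i < N" "s < v" "v \<le> p (Suc i)" for i v
  proof -
    have "l < Suc i" using increasing_upto_less_iff[OF p(1), of l "Suc i"] l that by auto
    then show ?thesis using increasing_upto_le[OF p(1), of l i] l that by auto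
  qed
  have 2: "norm (simple_value N p G v \<omega>) \<le> K" for v \<omega>
  proof (rule split[of v])
    assume "v \<le> a \<or> t < v"
    then have "v \<le> p 0 \<or> p N < v" using p by simp
    then show ?thesis using simple_value_outside[OF p(1), of v G \<omega>] K by simp
  next
    fix i assume i: "i < N" "p i < v" "v \<le> p (Suc i)"
    show ?thesis unfolding simple_value_eq[OF p(1) i] by (rule Gb)
  qed
  have 3: "simple_value N p G v \<omega> = 0" if v: "v \<le> s" for v \<omega>
  proof (rule split[of v])
    assume "v \<le> a \<or> t < v"
    then show ?thesis using simple_value_outside[OF p(1), of v] p by auto
  next
    fix i assume i: "i < N" "p i < v" "v \<le> p (Suc i)"
    then show ?thesis unfolding simple_value_eq[OF p(1) i] using v by (simp add: G_def)
  qed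
  have 4: "simple_value N p G v \<omega> = clip K (simple_value n q Z v \<omega>)" if v: "s < v" "v \<le> t" "\<omega> \<in> D v" for v \<omega>
  proof -
    obtain i where i: "i < N" "p i < v" "v \<le> p (Suc i)"
      by (rule step_interval[of p v N]) (use v p ast in auto)
    have si: "s \<le> p i" using s_le[OF i(1) v(1) i(3)] .
    have "D v \<subseteq> D (p i)" using D_mono[OF si] i v by simp
    then show ?thesis
      unfolding simple_value_eq[OF p(1) i] refine_simple_value[OF p(1) sub i] using si v by (auto simp: G_def)
  qed
  have 5: "ennreal (\<Sum>i<N. (p (Suc i) - p i) * (norm (G i \<omega>))\<^sup>2) \<le>
      (\<integral>\<^sup>+v\<in>{s..t}. ennreal (indicator (D v) \<omega> * (norm (clip K (simple_value n q Z v \<omega>)))\<^sup>2) \<partial>lborel) +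
      ennreal (\<delta> * K\<^sup>2)" for \<omega>
  proof -
    \<comment> \<open>Companion of \<open>G\<close> with survival tested at the right end. It lies
      below exact killing, since survival up to \<open>p (Suc i)\<close> implies survival throughout
      the cell.\<close>
    define Y where "Y i \<omega> = (if s \<le> p i then indicator (D (p (Suc i))) \<omega> *\<^sub>R clip K (simple_value n q Z (p (Suc i)) \<omega>) else 0)" for i \<omega>
    \<comment> \<open>Survival along the partition, set to \<open>1\<close> before \<open>s\<close>
      so that it is nonincreasing throughout. The energies of \<open>G\<close> and \<open>Y\<close>
      differ only where \<open>d\<close> drops; the drops telescope to at most \<open>1\<close>,
      which leaves one mesh width times \<open>K^2\<close>.\<close>
    define d where "d i = (if s \<le> p i then indicator (D (p i)) \<omega> else 1 :: real)" for i
    have pt: "p (Suc i) \<le> t" "p i < p (Suc i)" if "i < N" for i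
      using increasing_upto_le[OF p(1), of "Suc i" N] that p by auto
    have dd: "d (Suc i) \<le> d i" if i: "i < N" for i
    proof (cases "s \<le> p i")
      case True
      then have "D (p (Suc i)) \<subseteq> D (p i)" using D_mono[of "p i" "p (Suc i)"] pt[OF i] by simp
      then show ?thesis using True pt[OF i] by (auto simp: d_def split: split_indicator)
    qed (auto simp: d_def split: split_indicator)
    have GY: "(norm (G i \<omega>))\<^sup>2 \<le> (norm (Y i \<omega>))\<^sup>2 + K\<^sup>2 * (d i - d (Suc i))" if i: "i < N" for i
    proof (cases "s \<le> p i")
      case True
      have c: "(norm (clip K (simple_value n q Z (p (Suc i)) \<omega>)))\<^sup>2 \<le> K\<^sup>2"
        using norm_clip_le[OF K] by (intro power_mono) auto
      have "D (p (Suc i)) \<subseteq> D (p i)" using D_mono[of "p i" "p (Suc i)"] True pt[OF i] by simp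
      then show ?thesis using True pt[OF i] c by (auto simp: G_def Y_def d_def split: split_indicator)
    next
      case False
      then show ?thesis using dd[OF i] by (simp add: G_def Y_def)
    qed
    have "(\<Sum>i<N. (p (Suc i) - p i) * (norm (G i \<omega>))\<^sup>2) \<le>
      (\<Sum>i<N. (p (Suc i) - p i) * (norm (Y i \<omega>))\<^sup>2 + \<delta> * K\<^sup>2 * (d i - d (Suc i)))"
    proof (rule sum_mono)
      fix i assume "i \<in> {..<N}"
      then have i: "i < N" by simp
      have "(p (Suc i) - p i) * (norm (G i \<omega>))\<^sup>2 \<le> (p (Suc i) - p i) * ((norm (Y i \<omega>))\<^sup>2 + K\<^sup>2 * (d i - d (Suc i)))"
        using GY[OF i] pt[OF i] by (intro mult_left_mono) auto
      moreover have "(p (Suc i) - p i) * (K\<^sup>2 * (d i - d (Suc i))) \<le> \<delta> * (K\<^sup>2 * (d i - d (Suc i)))"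
        using mesh[OF i] dd[OF i] by (intro mult_right_mono) auto
      ultimately show "(p (Suc i) - p i) * (norm (G i \<omega>))\<^sup>2 \<le>
        (p (Suc i) - p i) * (norm (Y i \<omega>))\<^sup>2 + \<delta> * K\<^sup>2 * (d i - d (Suc i))"
        by (simp add: algebra_simps)
    qed
    also have "\<dots> = (\<Sum>i<N. (p (Suc i) - p i) * (norm (Y i \<omega>))\<^sup>2) + \<delta> * K\<^sup>2 * (d 0 - d N)"
    proof -
      have "(\<Sum>i<N. d i - d (Suc i)) = d 0 - d N" by (rule sum_lessThan_telescope')
      then show ?thesis by (simp add: sum.distrib flip: sum_distrib_left)
    qed
    also have "\<dots> \<le> (\<Sum>i<N. (p (Suc i) - p i) * (norm (Y i \<omega>))\<^sup>2) + \<delta> * K\<^sup>2"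
    proof -
      have "d 0 - d N \<le> 1" by (auto simp: d_def split: split_indicator)
      from mult_left_mono[OF this, of "\<delta> * K\<^sup>2"] show ?thesis using \<delta>(1) by simp
    qed
    finally have "ennreal (\<Sum>i<N. (p (Suc i) - p i) * (norm (G i \<omega>))\<^sup>2) \<le>
      ennreal (\<Sum>i<N. (p (Suc i) - p i) * (norm (Y i \<omega>))\<^sup>2) + ennreal (\<delta> * K\<^sup>2)"
      using \<delta>(1) pt(2) by (subst ennreal_plus[symmetric]) (auto intro!: ennreal_leI sum_nonneg simp: less_imp_le)
    moreover have "ennreal (\<Sum>i<N. (p (Suc i) - p i) * (norm (Y i \<omega>))\<^sup>2) =
      (\<integral>\<^sup>+v\<in>{a..t}. ennreal ((norm (simple_value N p Y v \<omega>))\<^sup>2) \<partial>lborel)"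
      by (rule nn_integral_simple_value[OF p(1-3), symmetric])
    moreover have "\<dots> \<le> (\<integral>\<^sup>+v\<in>{s..t}. ennreal (indicator (D v) \<omega> * (norm (clip K (simple_value n q Z v \<omega>)))\<^sup>2) \<partial>lborel)"
    proof (rule nn_integral_mono)
      fix v
      show "ennreal ((norm (simple_value N p Y v \<omega>))\<^sup>2) * indicator {a..t} v \<le>
        ennreal (indicator (D v) \<omega> * (norm (clip K (simple_value n q Z v \<omega>)))\<^sup>2) * indicator {s..t} v"
      proof (rule split[of v])
        assume "v \<le> a \<or> t < v"
        then show ?thesis using simple_value_outside[OF p(1), of v Y \<omega>] p by auto
      next
        fix i assume i: "i < N" "p i < v" "v \<le> p (Suc i)"
        show ?thesis
        proof (cases "s \<le> p i \<and> \<omega> \<in> D (p (Suc i))")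
          case True
          then have "D (p (Suc i)) \<subseteq> D v" using D_mono[of v "p (Suc i)"] pt[OF i(1)] i by simp
          then show ?thesis
            unfolding simple_value_eq[OF p(1) i] refine_simple_value[OF p(1) sub i] using True pt[OF i(1)] i
            by (auto simp: Y_def split: split_indicator)
        next
          case False
          then show ?thesis unfolding simple_value_eq[OF p(1) i] by (auto simp: Y_def)
        qed
      qed
    qed
    ultimately show ?thesis by (auto intro: order_trans add_right_mono)
  qed
  show ?thesis by (rule that[OF 1 2 3 4 5[unfolded \<delta>_def]])
qed

lemma hD_measurable:
  "(\<lambda>(v, \<omega>). indicator {s..t} v *\<^sub>R indicator (D v) \<omega> *\<^sub>R h v \<omega>) \<in> borel_measurable (borel \<Otimes>\<^sub>M M)"
proof -
  have [measurable]: "(\<lambda>(v, \<omega>). indicator {s..t} v *\<^sub>R indicator (D v) \<omega> :: real) \<in> borel_measurable (borel \<Otimes>\<^sub>M M)"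
    using borel_measurable_extend_by_zero[OF D_joint] .
  have [measurable]: "(\<lambda>(v, \<omega>). indicator {a..t} v *\<^sub>R h v \<omega>) \<in> borel_measurable (borel \<Otimes>\<^sub>M M)"
    using h by (intro borel_measurable_extend_by_zero) (simp add: measurable_adapted_def)
  have "(\<lambda>x. case_prod (\<lambda>v \<omega>. indicator {s..t} v *\<^sub>R indicator (D v) \<omega> :: real) x *\<^sub>R
    case_prod (\<lambda>v \<omega>. indicator {a..t} v *\<^sub>R h v \<omega>) x) \<in> borel_measurable (borel \<Otimes>\<^sub>M M)"
    by (rule borel_measurable_scaleR) fact+
  then show ?thesis
    by (rule measurable_cong[THEN iffD1, rotated]) (use ast in \<open>auto split: split_indicator\<close>)
qed

text \<open>By the isometry this is a comparison of the energies of the clipped approximation and of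
  \<open>h\<close> on \<open>D\<close>. Where the approximation error is at most \<open>e^2\<close>,
  the comparison costs \<open>2 * K * e * (t - s + 1)\<close>; on the remaining event, whose
  probability tends to \<open>0\<close>, both quantities are bounded by \<open>K\<close> and the
  crude cost \<open>4 * K^2 * (t - s)\<close> is enough.\<close>

lemma killed_second_moment:
  assumes sp: "simple_process M F a t n q Z" and sp': "simple_process M F a t N p G" and e: "0 < e"
    and G: "\<And>\<omega>. ennreal (\<Sum>i<N. (p (Suc i) - p i) * (norm (G i \<omega>))\<^sup>2) \<le>
      (\<integral>\<^sup>+v\<in>{s..t}. ennreal (indicator (D v) \<omega> * (norm (clip K (simple_value n q Z v \<omega>)))\<^sup>2) \<partial>lborel) + ennreal \<delta>"
  defines "Err \<equiv> (\<lambda>\<omega>. \<integral>\<^sup>+v\<in>{a..t}. ennreal ((norm (simple_value n q Z v \<omega> - h v \<omega>))\<^sup>2) \<partial>lborel)"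
  shows "ennreal (expectation (\<lambda>\<omega>. (norm (simple_integral W N p G \<omega>))\<^sup>2)) \<le>
    (\<integral>\<^sup>+\<omega>. (\<integral>\<^sup>+v\<in>{s..t}. ennreal (indicator (D v) \<omega> * (norm (h v \<omega>))\<^sup>2) \<partial>lborel) \<partial>M) +
    (ennreal (2 * K * e * (t - s + 1)) + ennreal (4 * K\<^sup>2 * (t - s)) * ennreal (prob {\<omega>\<in>space M. ennreal (e\<^sup>2) < Err \<omega>}) + ennreal \<delta>)"
proof -
  define H where "H v \<omega> = simple_value n q Z v \<omega>" for v \<omega>
  define g where "g v \<omega> = indicator {s..t} v *\<^sub>R indicator (D v) \<omega> *\<^sub>R h v \<omega>" for v \<omega>
  have g [measurable]: "(\<lambda>(v, \<omega>). g v \<omega>) \<in> borel_measurable (borel \<Otimes>\<^sub>M M)"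
    unfolding g_def by (rule hD_measurable)
  define k where "k v \<omega> = indicator {a..t} v *\<^sub>R h v \<omega>" for v \<omega>
  have k [measurable]: "(\<lambda>(v, \<omega>). k v \<omega>) \<in> borel_measurable (borel \<Otimes>\<^sub>M M)"
    unfolding k_def using h by (intro borel_measurable_extend_by_zero) (simp add: measurable_adapted_def)
  have H [measurable]: "(\<lambda>(v, \<omega>). H v \<omega>) \<in> borel_measurable (borel \<Otimes>\<^sub>M M)"
    unfolding H_def by (rule simple_value_measurable[OF sp])
  have Errm [measurable]: "Err \<in> borel_measurable M" unfolding Err_def by (rule simple_error_measurable[OF sp h])
  define A where "A = {\<omega>\<in>space M. ennreal (e\<^sup>2) < Err \<omega>}"
  have [measurable]: "A \<in> events" unfolding A_def by measurable
  have hg: "(\<integral>\<^sup>+v\<in>{s..t}. ennreal (indicator (D v) \<omega> * (norm (h v \<omega>))\<^sup>2) \<partial>lborel) =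
    (\<integral>\<^sup>+v. ennreal ((norm (g v \<omega>))\<^sup>2) \<partial>lborel)" for \<omega>
    by (intro nn_integral_cong) (auto simp: g_def split: split_indicator)
  have key: "(\<integral>\<^sup>+v\<in>{s..t}. ennreal (indicator (D v) \<omega> * (norm (clip K (H v \<omega>)))\<^sup>2) \<partial>lborel) \<le>
    (\<integral>\<^sup>+v. ennreal ((norm (g v \<omega>))\<^sup>2) \<partial>lborel) +
    (ennreal (2 * K * e * (t - s + 1)) + ennreal (4 * K\<^sup>2 * (t - s)) * indicator A \<omega>)" if \<omega>: "\<omega> \<in> space M" for \<omega>
  proof -
    have gm [measurable]: "(\<lambda>v. g v \<omega>) \<in> borel_measurable borel" "(\<lambda>v. k v \<omega>) \<in> borel_measurable borel"
        "(\<lambda>v. H v \<omega>) \<in> borel_measurable borel"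
      using measurable_compose[OF measurable_Pair2'[OF \<omega>] g] measurable_compose[OF measurable_Pair2'[OF \<omega>] k]
        measurable_compose[OF measurable_Pair2'[OF \<omega>] H] by simp_all
    have b: "(norm (clip K (H v \<omega>)))\<^sup>2 \<le> (norm (h v \<omega>))\<^sup>2 + 2 * K * norm (clip K (H v \<omega>) - h v \<omega>)"
      and b1: "norm (clip K (H v \<omega>) - h v \<omega>) \<le> norm (H v \<omega> - h v \<omega>)"
      and b2: "norm (clip K (H v \<omega>) - h v \<omega>) \<le> 2 * K"
      if v: "s \<le> v" "v \<le> t" "\<omega> \<in> D v" for v
    proof -
      let ?x = "norm (clip K (H v \<omega>))" and ?y = "norm (h v \<omega>)" and ?z = "norm (clip K (H v \<omega>) - h v \<omega>)"
      have xy: "?x \<le> K" "?y \<le> K" using norm_clip_le[OF K] h_bound[OF v] by auto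
      show "?z \<le> norm (H v \<omega> - h v \<omega>)" by (rule norm_clip_diff_le[OF K xy(2)])
      show "?z \<le> 2 * K" using norm_triangle_ineq4[of "clip K (H v \<omega>)" "h v \<omega>"] xy by simp
      have "?x - ?y \<le> ?z" by (rule norm_triangle_ineq2)
      then have "(?x - ?y) * (?x + ?y) \<le> ?z * (2 * K)" using xy by (intro mult_mono) auto
      then show "?x\<^sup>2 \<le> ?y\<^sup>2 + 2 * K * ?z" by (simp add: power2_eq_square algebra_simps)
    qed
    show ?thesis
    proof (cases "\<omega> \<in> A")
      case True
      have "(\<integral>\<^sup>+v\<in>{s..t}. ennreal (indicator (D v) \<omega> * (norm (clip K (H v \<omega>)))\<^sup>2) \<partial>lborel) \<le>
        (\<integral>\<^sup>+v. ennreal ((norm (g v \<omega>))\<^sup>2) + ennreal (4 * K\<^sup>2) * indicator {s..t} v \<partial>lborel)"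
      proof (rule nn_integral_mono)
        fix v
        have "(norm (clip K (H v \<omega>)))\<^sup>2 \<le> (norm (h v \<omega>))\<^sup>2 + 4 * K\<^sup>2" if v: "s \<le> v" "v \<le> t" "\<omega> \<in> D v"
        proof -
          have "2 * K * norm (clip K (H v \<omega>) - h v \<omega>) \<le> 2 * K * (2 * K)"
            using b2[OF v] K by (intro mult_left_mono) auto
          then show ?thesis using b[OF v] by (simp add: power2_eq_square)
        qed
        then show "ennreal (indicator (D v) \<omega> * (norm (clip K (H v \<omega>)))\<^sup>2) * indicator {s..t} v \<le>
          ennreal ((norm (g v \<omega>))\<^sup>2) + ennreal (4 * K\<^sup>2) * indicator {s..t} v"
          by (auto simp: g_def simp flip: ennreal_plus split: split_indicator intro!: ennreal_leI)
      qed
      also have "\<dots> = (\<integral>\<^sup>+v. ennreal ((norm (g v \<omega>))\<^sup>2) \<partial>lborel) + ennreal (4 * K\<^sup>2 * (t - s))"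
        using ast K by (subst nn_integral_add) (auto simp: nn_integral_cmult_indicator ennreal_mult')
      also have "\<dots> \<le> (\<integral>\<^sup>+v. ennreal ((norm (g v \<omega>))\<^sup>2) \<partial>lborel) +
        (ennreal (2 * K * e * (t - s + 1)) + ennreal (4 * K\<^sup>2 * (t - s)) * indicator A \<omega>)"
        using True by (intro add_left_mono) auto
      finally show ?thesis .
    next
      case False
      then have Er: "Err \<omega> \<le> ennreal (e\<^sup>2)" using \<omega> by (auto simp: A_def)
      have "(\<integral>\<^sup>+v\<in>{s..t}. ennreal (indicator (D v) \<omega> * (norm (clip K (H v \<omega>)))\<^sup>2) \<partial>lborel) \<le>
        (\<integral>\<^sup>+v. ennreal ((norm (g v \<omega>))\<^sup>2) + (ennreal (2 * K * e) * indicator {s..t} v +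
          ennreal (2 * K / e) * (ennreal ((norm (H v \<omega> - k v \<omega>))\<^sup>2) * indicator {a..t} v)) \<partial>lborel)"
      proof (rule nn_integral_mono)
        fix v
        have "(norm (clip K (H v \<omega>)))\<^sup>2 \<le> (norm (h v \<omega>))\<^sup>2 + (2 * K * e + 2 * K / e * (norm (H v \<omega> - h v \<omega>))\<^sup>2)"
          if v: "s \<le> v" "v \<le> t" "\<omega> \<in> D v"
        proof -
          let ?z = "norm (H v \<omega> - h v \<omega>)"
          \<comment> \<open>Only the integrated square of the error is small, so the first power is
            traded for it by \<open>z \<le> e + z^2 / e\<close>. Integration gives
            \<open>e * (t - s)\<close> and \<open>e^2 / e\<close>, hence the factor
            \<open>t - s + 1\<close>.\<close>
          have "2 * e * ?z \<le> e\<^sup>2 + ?z\<^sup>2" by (rule sum_squares_bound)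
          moreover have "0 \<le> e * ?z" "2 * e * ?z = e * ?z + e * ?z" using e by simp_all
          ultimately have "e * ?z \<le> e\<^sup>2 + ?z\<^sup>2" by linarith
          then have "?z \<le> e + ?z\<^sup>2 / e" using e by (simp add: field_simps power2_eq_square)
          then have "2 * K * norm (clip K (H v \<omega>) - h v \<omega>) \<le> 2 * K * (e + ?z\<^sup>2 / e)"
            using b1[OF v] K by (intro mult_left_mono) auto
          then show ?thesis using b[OF v] by (simp add: algebra_simps)
        qed
        then show "ennreal (indicator (D v) \<omega> * (norm (clip K (H v \<omega>)))\<^sup>2) * indicator {s..t} v \<le>
          ennreal ((norm (g v \<omega>))\<^sup>2) + (ennreal (2 * K * e) * indicator {s..t} v +
          ennreal (2 * K / e) * (ennreal ((norm (H v \<omega> - k v \<omega>))\<^sup>2) * indicator {a..t} v))"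
          using K e ast by (auto simp: g_def k_def simp flip: ennreal_plus ennreal_mult' split: split_indicator intro!: ennreal_leI)
      qed
      also have "\<dots> = (\<integral>\<^sup>+v. ennreal ((norm (g v \<omega>))\<^sup>2) \<partial>lborel) + (ennreal (2 * K * e) * ennreal (t - s) +
          ennreal (2 * K / e) * (\<integral>\<^sup>+v\<in>{a..t}. ennreal ((norm (H v \<omega> - k v \<omega>))\<^sup>2) \<partial>lborel))"
        using ast by (simp add: nn_integral_add nn_integral_cmult nn_integral_cmult_indicator)
      also have "(\<integral>\<^sup>+v\<in>{a..t}. ennreal ((norm (H v \<omega> - k v \<omega>))\<^sup>2) \<partial>lborel) = Err \<omega>"
        unfolding Err_def by (intro nn_integral_cong) (auto simp: H_def k_def split: split_indicator)
      also have "ennreal (2 * K * e) * ennreal (t - s) + ennreal (2 * K / e) * Err \<omega> \<le> ennreal (2 * K * e * (t - s + 1))"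
      proof -
        have "ennreal (2 * K / e) * Err \<omega> \<le> ennreal (2 * K / e) * ennreal (e\<^sup>2)" using Er by (rule mult_left_mono) simp
        also have "\<dots> = ennreal (2 * K * e)" using K e by (simp add: power2_eq_square flip: ennreal_mult')
        finally have "ennreal (2 * K * e) * ennreal (t - s) + ennreal (2 * K / e) * Err \<omega> \<le>
          ennreal (2 * K * e) * ennreal (t - s) + ennreal (2 * K * e)" by (rule add_left_mono)
        also have "\<dots> = ennreal (2 * K * e * (t - s + 1))"
          using K e ast by (simp add: algebra_simps flip: ennreal_plus ennreal_mult')
        finally show ?thesis .
      qed
      finally show ?thesis using False by (simp add: add_left_mono)
    qed
  qed
  have Gi: "integrable M (\<lambda>\<omega>. (norm (G i \<omega>))\<^sup>2)" if i: "i < N" for i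
  proof -
    note GD = simple_processD(5)[OF sp' i] simple_processD(8)[OF sp' i]
    have [measurable]: "G i \<in> borel_measurable M" by (rule GD)
    obtain C where C: "\<forall>\<omega>\<in>space M. norm (G i \<omega>) \<le> C" using GD(2) by blast
    show ?thesis
      by (rule integrable_const_bound[of _ "C\<^sup>2"]) (use C in \<open>auto intro!: power_mono\<close>)
  qed
  have pinc: "0 \<le> p (Suc i) - p i" if "i < N" for i
    using simple_processD(1)[OF sp'] that by (simp add: less_imp_le)
  have "ennreal (expectation (\<lambda>\<omega>. (norm (simple_integral W N p G \<omega>))\<^sup>2)) =
    ennreal (expectation (\<lambda>\<omega>. \<Sum>i<N. (p (Suc i) - p i) * (norm (G i \<omega>))\<^sup>2))"
    unfolding simple_integral_isometry[OF sp'] using Gi by (simp add: Bochner_Integration.integral_sum)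
  also have "\<dots> = (\<integral>\<^sup>+\<omega>. ennreal (\<Sum>i<N. (p (Suc i) - p i) * (norm (G i \<omega>))\<^sup>2) \<partial>M)"
    using Gi pinc by (intro nn_integral_eq_integral[symmetric]) (auto intro!: Bochner_Integration.integrable_sum sum_nonneg)
  also have "\<dots> \<le> (\<integral>\<^sup>+\<omega>. (\<integral>\<^sup>+v. ennreal ((norm (g v \<omega>))\<^sup>2) \<partial>lborel) +
    ((ennreal (2 * K * e * (t - s + 1)) + ennreal (4 * K\<^sup>2 * (t - s)) * indicator A \<omega>) + ennreal \<delta>) \<partial>M)"
    using order_trans[OF G add_right_mono[OF key[unfolded H_def]]]
    by (intro nn_integral_mono) (simp add: add.assoc)
  also have "\<dots> = (\<integral>\<^sup>+\<omega>. (\<integral>\<^sup>+v. ennreal ((norm (g v \<omega>))\<^sup>2) \<partial>lborel) \<partial>M) +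
    ((ennreal (2 * K * e * (t - s + 1)) + ennreal (4 * K\<^sup>2 * (t - s)) * emeasure M A) + ennreal \<delta>)"
    by (simp add: nn_integral_add nn_integral_cmult_indicator emeasure_space_1)
  finally show ?thesis unfolding hg A_def by (simp add: emeasure_eq_measure)
qed

end

context filtered_prob_space
begin

lemma simple_error_section_measurable:
  assumes h: "measurable_adapted M F a t h" and rt: "r \<le> t" and \<omega>: "\<omega> \<in> space M"
  shows "(\<lambda>v. ennreal ((norm (simple_value n q Z v \<omega> - h v \<omega>))\<^sup>2) * indicator {a..r} v) \<in> borel_measurable borel"
proof -
  define k where "k v = indicator {a..t} v *\<^sub>R h v \<omega>" for v
  have "(\<lambda>(v, \<omega>). indicator {a..t} v *\<^sub>R h v \<omega>) \<in> borel_measurable (borel \<Otimes>\<^sub>M M)"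
    using h by (intro borel_measurable_extend_by_zero) (simp add: measurable_adapted_def)
  from measurable_compose[OF measurable_Pair2'[OF \<omega>] this]
  have [measurable]: "k \<in> borel_measurable borel" by (simp add: k_def[abs_def])
  have "(\<lambda>v. ennreal ((norm (simple_value n q Z v \<omega> - k v))\<^sup>2) * indicator {a..r} v) \<in> borel_measurable borel"
    unfolding simple_value_def by measurable
  then show ?thesis
    by (rule measurable_cong[THEN iffD1, rotated]) (use rt in \<open>auto simp: k_def split: split_indicator\<close>)
qed

end

section \<open>Weak limit of the killed integrals\<close>

context killed_integrand
begin

text \<open>Since \<open>\<zeta>\<close> is known at \<open>r\<close>, the killed integral may be
  cut at \<open>r\<close>. On \<open>D r\<close> its integrand is compared with that of an
  approximation of \<open>Jr - Js\<close>: up to \<open>s\<close> the killed process vanishes and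
  the approximations of \<open>Jr\<close> and \<open>Js\<close> both follow \<open>h\<close>;
  between \<open>s\<close> and \<open>r\<close> the clipped process and the approximation of
  \<open>Jr\<close> both follow \<open>h\<close>, and the one for \<open>Js\<close> vanishes. The
  localised tail bound turns this into convergence in probability on \<open>D r\<close>, and the
  uniform second moment bound into convergence of expectations.\<close>

lemma killed_weak_limit:
  fixes T \<zeta> :: "'w \<Rightarrow> complex ^ 'd"
  assumes sp: "\<And>k. simple_process M F a t (n k) (q k) (Z k)"
    and conv: "tends_in_prob_0 M (\<lambda>k \<omega>. \<integral>\<^sup>+v\<in>{a..t}. ennreal ((norm (simple_value (n k) (q k) (Z k) v \<omega> - h v \<omega>))\<^sup>2) \<partial>lborel)"
    and spG: "\<And>k. simple_process M F a t (N k) (p k) (G k)"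
    and G1: "\<And>k v \<omega>. norm (simple_value (N k) (p k) (G k) v \<omega>) \<le> K"
    and G2: "\<And>k v \<omega>. v \<le> s \<Longrightarrow> simple_value (N k) (p k) (G k) v \<omega> = 0"
    and G3: "\<And>k v \<omega>. s < v \<Longrightarrow> v \<le> t \<Longrightarrow> \<omega> \<in> D v \<Longrightarrow>
      simple_value (N k) (p k) (G k) v \<omega> = clip K (simple_value (n k) (q k) (Z k) v \<omega>)"
    and r: "s \<le> r" "r \<le> t"
    and Jr: "ito_integral M F W a r h Jr" and Js: "ito_integral M F W a s h Js"
    and T: "T \<in> borel_measurable M" "AE \<omega> in M. \<omega> \<in> D r \<longrightarrow> T \<omega> = Jr \<omega> - Js \<omega>"
      "\<And>\<omega>. \<omega> \<in> D r \<Longrightarrow> norm (T \<omega>) \<le> C"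
    and \<zeta>: "\<zeta> \<in> borel_measurable (F r)" "\<And>\<omega>. norm (\<zeta> \<omega>) \<le> C'" "\<And>\<omega>. \<omega> \<notin> D r \<Longrightarrow> \<zeta> \<omega> = 0"
  shows "(\<lambda>k. expectation (\<lambda>\<omega>. \<zeta> \<omega> \<bullet> simple_integral W (N k) (p k) (G k) \<omega>)) \<longlonglongrightarrow> expectation (\<lambda>\<omega>. \<zeta> \<omega> \<bullet> T \<omega>)"
proof -
  have ar: "a \<le> r" using ast r by simp
  have hr: "measurable_adapted M F a r h" and hs: "measurable_adapted M F a s h"
    and JM [measurable]: "Jr \<in> borel_measurable M" "Js \<in> borel_measurable M"
    using Jr Js by (simp_all add: ito_integral_def)
  have Dr [measurable]: "D r \<in> events" using sets_F_M[OF ar D[OF r]] .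
  have Drs: "\<omega> \<in> space M" if "\<omega> \<in> D r" for \<omega> using sets.sets_into_space[OF Dr] that by blast
  have [measurable]: "T \<in> borel_measurable M" "\<zeta> \<in> borel_measurable M"
    using T(1) borel_measurable_F[OF \<zeta>(1) ar] by auto
  obtain nr qr Zr where spr: "\<And>k. simple_process M F a r (nr k) (qr k) (Zr k)"
    and convr: "tends_in_prob_0 M (\<lambda>k \<omega>. \<integral>\<^sup>+v\<in>{a..r}. ennreal ((norm (simple_value (nr k) (qr k) (Zr k) v \<omega> - h v \<omega>))\<^sup>2) \<partial>lborel)"
    and Ir: "tends_in_prob_0 M (\<lambda>k \<omega>. ennreal (norm (simple_integral W (nr k) (qr k) (Zr k) \<omega> - Jr \<omega>)))"
    using Jr by (auto simp: ito_integral_def)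
  obtain ns qs Zs where sps: "\<And>k. simple_process M F a s (ns k) (qs k) (Zs k)"
    and convs: "tends_in_prob_0 M (\<lambda>k \<omega>. \<integral>\<^sup>+v\<in>{a..s}. ennreal ((norm (simple_value (ns k) (qs k) (Zs k) v \<omega> - h v \<omega>))\<^sup>2) \<partial>lborel)"
    and Is: "tends_in_prob_0 M (\<lambda>k \<omega>. ennreal (norm (simple_integral W (ns k) (qs k) (Zs k) \<omega> - Js \<omega>)))"
    using Js by (auto simp: ito_integral_def)
  define Et where "Et k \<omega> = (\<integral>\<^sup>+v\<in>{a..t}. ennreal ((norm (simple_value (n k) (q k) (Z k) v \<omega> - h v \<omega>))\<^sup>2) \<partial>lborel)" for k \<omega>
  define Er where "Er k \<omega> = (\<integral>\<^sup>+v\<in>{a..r}. ennreal ((norm (simple_value (nr k) (qr k) (Zr k) v \<omega> - h v \<omega>))\<^sup>2) \<partial>lborel)" for k \<omega>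
  define Es where "Es k \<omega> = (\<integral>\<^sup>+v\<in>{a..s}. ennreal ((norm (simple_value (ns k) (qs k) (Zs k) v \<omega> - h v \<omega>))\<^sup>2) \<partial>lborel)" for k \<omega>
  \<comment> \<open>Dominates the energy of the difference on \<open>D r\<close> in both time
    ranges. The factor \<open>2\<close> comes from passing through \<open>h\<close> in a squared
    difference.\<close>
  define V where "V k \<omega> = ennreal 2 * ((Et k \<omega> + Er k \<omega>) + Es k \<omega>)" for k \<omega>
  have [measurable]: "Et k \<in> borel_measurable M" "Er k \<in> borel_measurable M" "Es k \<in> borel_measurable M" for k
    unfolding Et_def Er_def Es_def
    by (rule simple_error_measurable[OF sp h] simple_error_measurable[OF spr hr] simple_error_measurable[OF sps hs])+
  have [measurable]: "V k \<in> borel_measurable M" for k unfolding V_def by measurable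
  have convV: "tends_in_prob_0 M V"
  proof (rule tends_in_prob_0_bound[of "\<lambda>k \<omega>. Et k \<omega> + Er k \<omega>" Es 2])
    show "tends_in_prob_0 M (\<lambda>k \<omega>. Et k \<omega> + Er k \<omega>)"
    proof (rule tends_in_prob_0_bound[of Et Er 1])
      show "tends_in_prob_0 M Et" "tends_in_prob_0 M Er"
        using conv convr by (simp_all add: Et_def[abs_def] Er_def[abs_def])
    qed auto
    show "tends_in_prob_0 M Es" using convs by (simp add: Es_def[abs_def])
  qed (auto simp: V_def)
  define Ik where "Ik k \<omega> = simple_integral W (nr k) (qr k) (Zr k) \<omega> - simple_integral W (ns k) (qs k) (Zs k) \<omega>" for k \<omega>
  define B where "B k = simple_integral W (N k) (p k) (G k)" for k
  have sIm [measurable]: "simple_integral W (nr k) (qr k) (Zr k) \<in> borel_measurable M"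
      "simple_integral W (ns k) (qs k) (Zs k) \<in> borel_measurable M" for k
    by (rule simple_integral_measurable[OF spr] simple_integral_measurable[OF sps])+
  have [measurable]: "Ik k \<in> borel_measurable M" for k unfolding Ik_def by measurable
  have \<zeta>i: "integrable M (\<lambda>\<omega>. (norm (\<zeta> \<omega>))\<^sup>2)"
    by (rule integrable_const_bound[of _ "C'\<^sup>2"]) (use \<zeta>(2) in \<open>auto intro!: power_mono\<close>)
  \<comment> \<open>\<open>S\<close> stands for the killed integral cut at \<open>r\<close>;
    \<open>Ik k\<close> approximates \<open>Jr - Js\<close>. Only these properties of
    \<open>S\<close> are used afterwards, so its partition can be forgotten.\<close>
  define R where "R k S \<longleftrightarrow> S \<in> borel_measurable M \<and> integrable M (\<lambda>\<omega>. (norm (S \<omega>))\<^sup>2) \<and>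
    expectation (\<lambda>\<omega>. (norm (S \<omega>))\<^sup>2) \<le> (r - a) * K\<^sup>2 \<and>
    expectation (\<lambda>\<omega>. \<zeta> \<omega> \<bullet> B k \<omega>) = expectation (\<lambda>\<omega>. \<zeta> \<omega> \<bullet> S \<omega>) \<and>
    (\<forall>\<epsilon>>0. \<forall>\<delta>\<ge>0. prob {\<omega>\<in>D r. \<epsilon> < norm (S \<omega> - Ik k \<omega>)} \<le> prob {\<omega>\<in>space M. ennreal \<delta> < V k \<omega>} + \<delta> / \<epsilon>\<^sup>2)" for k and S :: "'w \<Rightarrow> complex ^ 'd"
  have "\<exists>S. R k S" for k
  proof -
    obtain m1 p1 Y where Y: "simple_process M F a r m1 p1 Y"
      "\<And>v \<omega>. a < v \<Longrightarrow> v \<le> r \<Longrightarrow> simple_value m1 p1 Y v \<omega> = simple_value (N k) (p k) (G k) v \<omega>"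
      and YE: "\<And>\<zeta>. \<zeta> \<in> borel_measurable (F r) \<Longrightarrow> integrable M (\<lambda>\<omega>. (norm (\<zeta> \<omega>))\<^sup>2) \<Longrightarrow>
        expectation (\<lambda>\<omega>. \<zeta> \<omega> \<bullet> simple_integral W (N k) (p k) (G k) \<omega>) =
        expectation (\<lambda>\<omega>. \<zeta> \<omega> \<bullet> simple_integral W m1 p1 Y \<omega>)"
      by (rule simple_process_restrict[OF spG[of k] ar r(2)]) blast
    obtain m2 p2 Y2 where Y2: "simple_process M F a r m2 p2 Y2"
      "\<And>v \<omega>. simple_value m2 p2 Y2 v \<omega> = simple_value (ns k) (qs k) (Zs k) v \<omega>"
      "\<And>\<omega>. simple_integral W m2 p2 Y2 \<omega> = simple_integral W (ns k) (qs k) (Zs k) \<omega>"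
      by (rule simple_process_extend[OF sps[of k] r(1)]) blast
    obtain m3 p3 Y3 where Y3: "simple_process M F a r m3 p3 Y3"
      "\<And>v \<omega>. simple_value m3 p3 Y3 v \<omega> = simple_value (nr k) (qr k) (Zr k) v \<omega> - simple_value m2 p2 Y2 v \<omega>"
      "\<And>\<omega>. simple_integral W m3 p3 Y3 \<omega> = simple_integral W (nr k) (qr k) (Zr k) \<omega> - simple_integral W m2 p2 Y2 \<omega>"
      by (rule simple_process_common[OF spr[of k] Y2(1)]) blast
    \<comment> \<open>\<open>X\<close> is a simple process whose integral is
      \<open>S - Ik k\<close>, so the tail bound can be applied to the difference in one
      piece.\<close>
    obtain m4 p4 X where X: "simple_process M F a r m4 p4 X"
      "\<And>v \<omega>. simple_value m4 p4 X v \<omega> = simple_value m1 p1 Y v \<omega> - simple_value m3 p3 Y3 v \<omega>"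
      "\<And>\<omega>. simple_integral W m4 p4 X \<omega> = simple_integral W m1 p1 Y \<omega> - simple_integral W m3 p3 Y3 \<omega>"
      by (rule simple_process_common[OF Y(1) Y3(1)]) blast
    let ?S = "simple_integral W m1 p1 Y"
    have XI: "simple_integral W m4 p4 X \<omega> = ?S \<omega> - Ik k \<omega>" for \<omega>
      unfolding X(3) Y3(3) Y2(3) Ik_def ..
    note XD = simple_processD[OF X(1)]
    have XV: "ennreal (\<Sum>i<m4. (p4 (Suc i) - p4 i) * (norm (X i \<omega>))\<^sup>2) \<le> V k \<omega>" if \<omega>: "\<omega> \<in> D r" for \<omega>
    proof -
      let ?ht = "\<lambda>v. ennreal ((norm (simple_value (n k) (q k) (Z k) v \<omega> - h v \<omega>))\<^sup>2) * indicator {a..t} v"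
      let ?hr = "\<lambda>v. ennreal ((norm (simple_value (nr k) (qr k) (Zr k) v \<omega> - h v \<omega>))\<^sup>2) * indicator {a..r} v"
      let ?hs = "\<lambda>v. ennreal ((norm (simple_value (ns k) (qs k) (Zs k) v \<omega> - h v \<omega>))\<^sup>2) * indicator {a..s} v"
      have [measurable]: "?ht \<in> borel_measurable borel" "?hr \<in> borel_measurable borel" "?hs \<in> borel_measurable borel"
        by (rule simple_error_section_measurable[OF h _ Drs[OF \<omega>]] simple_error_section_measurable[OF hr _ Drs[OF \<omega>]]
          simple_error_section_measurable[OF hs _ Drs[OF \<omega>]]; simp)+
      have "ennreal (\<Sum>i<m4. (p4 (Suc i) - p4 i) * (norm (X i \<omega>))\<^sup>2) =
        (\<integral>\<^sup>+v\<in>{a..r}. ennreal ((norm (simple_value m4 p4 X v \<omega>))\<^sup>2) \<partial>lborel)"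
        by (rule nn_integral_simple_value[OF XD(1-3), symmetric])
      also have "\<dots> \<le> (\<integral>\<^sup>+v. ennreal 2 * ((?ht v + ?hr v) + ?hs v) \<partial>lborel)"
      proof (rule nn_integral_mono)
        fix v
        consider "v \<le> a \<or> r < v" | "a < v" "v \<le> s" | "s < v" "v \<le> r" by linarith
        then show "ennreal ((norm (simple_value m4 p4 X v \<omega>))\<^sup>2) * indicator {a..r} v \<le>
          ennreal 2 * ((?ht v + ?hr v) + ?hs v)"
        proof cases
          case 1
          then have "simple_value m4 p4 X v \<omega> = 0 \<or> r < v"
            using simple_value_outside[OF XD(1), of v X \<omega>] XD(2) by auto
          then show ?thesis by auto
        next
          case 2
          let ?hr' = "simple_value (nr k) (qr k) (Zr k) v \<omega>" and ?hs' = "simple_value (ns k) (qs k) (Zs k) v \<omega>"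
          have "simple_value m4 p4 X v \<omega> = ?hs' - ?hr'"
            unfolding X(2) Y3(2) Y2(2) using Y(2)[of v \<omega>] G2[of v k \<omega>] 2 r by simp
          then have "ennreal ((norm (simple_value m4 p4 X v \<omega>))\<^sup>2) \<le>
            ennreal (2 * ((norm (?hs' - h v \<omega>))\<^sup>2 + (norm (?hr' - h v \<omega>))\<^sup>2))"
            using power2_norm_diff_le[of ?hs' ?hr' "h v \<omega>"] by (intro ennreal_leI) simp
          also have "\<dots> = ennreal 2 * (?hr v + ?hs v)"
            using 2 r by (simp add: ennreal_mult' ennreal_plus add.commute)
          also have "\<dots> \<le> ennreal 2 * ((?ht v + ?hr v) + ?hs v)"
            by (intro mult_left_mono add_right_mono) (auto simp: add_increasing)
          finally show ?thesis using 2 r by simp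
        next
          case 3
          let ?ht' = "simple_value (n k) (q k) (Z k) v \<omega>" and ?hr' = "simple_value (nr k) (qr k) (Zr k) v \<omega>"
          have \<omega>v: "\<omega> \<in> D v" using D_mono[of v r] 3 r \<omega> by auto
          have "simple_value (ns k) (qs k) (Zs k) v \<omega> = 0"
            using simple_value_outside[OF simple_processD(1)[OF sps[of k]], of v "Zs k" \<omega>] simple_processD(3)[OF sps[of k]] 3 by simp
          then have Xv: "simple_value m4 p4 X v \<omega> = clip K ?ht' - ?hr'"
            unfolding X(2) Y3(2) Y2(2) using Y(2)[of v \<omega>] G3[of v \<omega> k] 3 r ast \<omega>v by simp
          have hb: "norm (h v \<omega>) \<le> K" using h_bound[OF _ _ \<omega>v] 3 r by simp
          have sq: "(norm (clip K ?ht' - h v \<omega>))\<^sup>2 \<le> (norm (?ht' - h v \<omega>))\<^sup>2"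
            using norm_clip_diff_le[OF K hb] by (intro power_mono) auto
          have "ennreal ((norm (simple_value m4 p4 X v \<omega>))\<^sup>2) \<le>
            ennreal (2 * ((norm (?ht' - h v \<omega>))\<^sup>2 + (norm (?hr' - h v \<omega>))\<^sup>2))"
            unfolding Xv
            by (rule ennreal_leI[OF order_trans[OF power2_norm_diff_le mult_left_mono[OF add_right_mono[OF sq]]]]) simp
          also have "\<dots> = ennreal 2 * (?ht v + ?hr v)"
            using 3 r ast by (simp add: ennreal_mult' ennreal_plus)
          also have "\<dots> \<le> ennreal 2 * ((?ht v + ?hr v) + ?hs v)"
            by (intro mult_left_mono) (auto simp: add_increasing2)
          finally show ?thesis using 3 r ast by simp
        qed
      qed
      also have "\<dots> = V k \<omega>"
        unfolding V_def Et_def Er_def Es_def by (simp add: nn_integral_cmult nn_integral_add)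
      finally show ?thesis .
    qed
    have "prob {\<omega>\<in>D r. \<epsilon> < norm (?S \<omega> - Ik k \<omega>)} \<le> prob {\<omega>\<in>space M. ennreal \<delta> < V k \<omega>} + \<delta> / \<epsilon>\<^sup>2"
      if \<epsilon>: "0 < \<epsilon>" and \<delta>: "0 \<le> \<delta>" for \<epsilon> \<delta>
    proof -
      have "prob {\<omega>\<in>D r. \<epsilon> < norm (?S \<omega> - Ik k \<omega>)} \<le>
        prob {\<omega>\<in>D r. \<delta> < (\<Sum>i<m4. (p4 (Suc i) - p4 i) * (norm (X i \<omega>))\<^sup>2)} + \<delta> / \<epsilon>\<^sup>2"
        using simple_integral_tail_bound[OF X(1) Dr \<epsilon> \<delta>] unfolding XI .
      also have "prob {\<omega>\<in>D r. \<delta> < (\<Sum>i<m4. (p4 (Suc i) - p4 i) * (norm (X i \<omega>))\<^sup>2)} \<le>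
        prob {\<omega>\<in>space M. ennreal \<delta> < V k \<omega>}"
      proof (rule finite_measure_mono)
        show "{\<omega>\<in>D r. \<delta> < (\<Sum>i<m4. (p4 (Suc i) - p4 i) * (norm (X i \<omega>))\<^sup>2)} \<subseteq> {\<omega>\<in>space M. ennreal \<delta> < V k \<omega>}"
        proof safe
          fix \<omega> assume \<omega>: "\<omega> \<in> D r" "\<delta> < (\<Sum>i<m4. (p4 (Suc i) - p4 i) * (norm (X i \<omega>))\<^sup>2)"
          show "\<omega> \<in> space M" by (rule Drs[OF \<omega>(1)])
          have "ennreal \<delta> < ennreal (\<Sum>i<m4. (p4 (Suc i) - p4 i) * (norm (X i \<omega>))\<^sup>2)"
            using \<omega>(2) \<delta> by (simp add: ennreal_less_iff)
          then show "ennreal \<delta> < V k \<omega>" using XV[OF \<omega>(1)] by (rule less_le_trans)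
        qed
      qed measurable
      finally show ?thesis by simp
    qed
    moreover have "expectation (\<lambda>\<omega>. (norm (?S \<omega>))\<^sup>2) \<le> (r - a) * K\<^sup>2"
      by (rule simple_integral_bounded_second_moment[OF Y(1)]) (simp add: Y(2) G1)
    moreover have "expectation (\<lambda>\<omega>. \<zeta> \<omega> \<bullet> B k \<omega>) = expectation (\<lambda>\<omega>. \<zeta> \<omega> \<bullet> ?S \<omega>)"
      unfolding B_def by (rule YE[OF \<zeta>(1) \<zeta>i])
    ultimately have "R k ?S"
      using simple_integral_measurable[OF Y(1)] simple_integral_square_integrable[OF Y(1)] unfolding R_def by blast
    then show ?thesis by (rule exI[of "R k"])
  qed
  then obtain S where "\<And>k. R k (S k)" by metis
  then have S [measurable]: "S k \<in> borel_measurable M"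
    and Si: "integrable M (\<lambda>\<omega>. (norm (S k \<omega>))\<^sup>2)"
    and SE: "expectation (\<lambda>\<omega>. (norm (S k \<omega>))\<^sup>2) \<le> (r - a) * K\<^sup>2"
    and SB: "expectation (\<lambda>\<omega>. \<zeta> \<omega> \<bullet> B k \<omega>) = expectation (\<lambda>\<omega>. \<zeta> \<omega> \<bullet> S k \<omega>)"
    and ST: "0 < \<epsilon> \<Longrightarrow> 0 \<le> \<delta> \<Longrightarrow>
      prob {\<omega>\<in>D r. \<epsilon> < norm (S k \<omega> - Ik k \<omega>)} \<le> prob {\<omega>\<in>space M. ennreal \<delta> < V k \<omega>} + \<delta> / \<epsilon>\<^sup>2"
    for k \<epsilon> \<delta>
    unfolding R_def by blast+
  define U where "U k \<omega> = ennreal (indicator (D r) \<omega> * norm (S k \<omega> - Ik k \<omega>))" for k \<omega>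
  have [measurable]: "U k \<in> borel_measurable M" for k unfolding U_def by measurable
  have convU: "tends_in_prob_0 M U"
    unfolding tends_in_prob_0_def
  proof (intro allI impI LIMSEQ_I)
    fix \<epsilon> e :: real assume pos: "0 < \<epsilon>" "0 < e"
    \<comment> \<open>Chosen so that the Chebyshev term \<open>\<delta> / \<epsilon>^2\<close> takes
      half of \<open>e\<close>; the other half is left for the probability of a large
      \<open>V k\<close>.\<close>
    define \<delta> where "\<delta> = e * \<epsilon>\<^sup>2 / 2"
    have \<delta>: "0 < \<delta>" "\<delta> / \<epsilon>\<^sup>2 = e / 2" using pos by (simp_all add: \<delta>_def)
    have "(\<lambda>k. prob {\<omega>\<in>space M. ennreal \<delta> < V k \<omega>}) \<longlonglongrightarrow> 0" using convV \<delta> by (simp add: tends_in_prob_0_def)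
    from LIMSEQ_D[OF this, of "e / 2"] pos obtain k0 where
      k0: "\<And>k. k0 \<le> k \<Longrightarrow> prob {\<omega>\<in>space M. ennreal \<delta> < V k \<omega>} < e / 2" by auto
    have eq: "{\<omega>\<in>space M. ennreal \<epsilon> < U k \<omega>} = {\<omega>\<in>D r. \<epsilon> < norm (S k \<omega> - Ik k \<omega>)}" for k
      using Drs pos by (auto simp: U_def ennreal_less_iff split: split_indicator split_indicator_asm)
    have "norm (prob {\<omega>\<in>space M. ennreal \<epsilon> < U k \<omega>} - 0) < e" if "k0 \<le> k" for k
      using ST[OF pos(1), of \<delta> k] k0[OF that] \<delta> unfolding eq by simp
    then show "\<exists>k0. \<forall>k\<ge>k0. norm (prob {\<omega>\<in>space M. ennreal \<epsilon> < U k \<omega>} - 0) < e" by blast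
  qed
  have convY: "tends_in_prob_0 M (\<lambda>k \<omega>. ennreal (indicator (D r) \<omega> * norm (S k \<omega> - (Jr \<omega> - Js \<omega>))))"
  proof (rule tends_in_prob_0_bound[of U "\<lambda>k \<omega>. ennreal (norm (simple_integral W (nr k) (qr k) (Zr k) \<omega> - Jr \<omega>)) +
      ennreal (norm (simple_integral W (ns k) (qs k) (Zs k) \<omega> - Js \<omega>))" 1])
    show "tends_in_prob_0 M (\<lambda>k \<omega>. ennreal (norm (simple_integral W (nr k) (qr k) (Zr k) \<omega> - Jr \<omega>)) +
      ennreal (norm (simple_integral W (ns k) (qs k) (Zs k) \<omega> - Js \<omega>)))"
      by (rule tends_in_prob_0_bound[OF _ _ Ir Is, of 1]) simp_all
    fix k \<omega>
    have "norm (S k \<omega> - (Jr \<omega> - Js \<omega>)) \<le> norm (S k \<omega> - Ik k \<omega>) +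
      (norm (simple_integral W (nr k) (qr k) (Zr k) \<omega> - Jr \<omega>) + norm (simple_integral W (ns k) (qs k) (Zs k) \<omega> - Js \<omega>))"
      (is "_ \<le> norm ?A + (norm ?B + norm ?C)")
    proof -
      have eq: "S k \<omega> - (Jr \<omega> - Js \<omega>) = ?A + (?B - ?C)" by (simp add: Ik_def)
      show ?thesis
        unfolding eq using norm_triangle_ineq[of ?A "?B - ?C"] norm_triangle_ineq4[of ?B ?C] by linarith
    qed
    then show "ennreal (indicator (D r) \<omega> * norm (S k \<omega> - (Jr \<omega> - Js \<omega>))) \<le> ennreal 1 * (U k \<omega> +
      (ennreal (norm (simple_integral W (nr k) (qr k) (Zr k) \<omega> - Jr \<omega>)) +
       ennreal (norm (simple_integral W (ns k) (qs k) (Zs k) \<omega> - Js \<omega>))))"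
      by (auto simp: U_def simp flip: ennreal_plus intro!: ennreal_leI split: split_indicator)
  qed (use convU in simp_all)
  define Y where "Y k \<omega> = indicator (D r) \<omega> * norm (S k \<omega> - T \<omega>)" for k \<omega>
  \<comment> \<open>Second moment bound for \<open>Y k\<close>: the isometry controls
    \<open>S k\<close> for every \<open>k\<close>, and \<open>T\<close> is bounded by
    \<open>C\<close> on \<open>D r\<close>.\<close>
  define Q where "Q = 2 * ((r - a) * K\<^sup>2 + C\<^sup>2)"
  have [measurable]: "Y k \<in> borel_measurable M" for k unfolding Y_def by measurable
  have Yb: "(Y k \<omega>)\<^sup>2 \<le> 2 * ((norm (S k \<omega>))\<^sup>2 + C\<^sup>2)" for k \<omega>
  proof (cases "\<omega> \<in> D r")
    case True
    have "(norm (T \<omega>))\<^sup>2 \<le> C\<^sup>2" using T(3)[OF True] by (intro power_mono) auto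
    then show ?thesis using power2_norm_diff_le[of "S k \<omega>" "T \<omega>" 0] True by (simp add: Y_def)
  qed (simp add: Y_def)
  have Yi: "integrable M (\<lambda>\<omega>. (Y k \<omega>)\<^sup>2)" for k
    by (rule Bochner_Integration.integrable_bound[of _ "\<lambda>\<omega>. 2 * ((norm (S k \<omega>))\<^sup>2 + C\<^sup>2)"])
      (use Si[of k] Yb in auto)
  have "(\<lambda>k. expectation (Y k)) \<longlonglongrightarrow> 0"
  proof (rule expectation_tendsto_0[where Y = Y and Q = Q, OF _ _ Yi])
    fix k
    have "expectation (\<lambda>\<omega>. (Y k \<omega>)\<^sup>2) \<le> expectation (\<lambda>\<omega>. 2 * ((norm (S k \<omega>))\<^sup>2 + C\<^sup>2))"
      by (rule integral_mono[OF Yi]) (use Si[of k] Yb in auto)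
    also have "\<dots> \<le> Q" using SE[of k] Si[of k] by (simp add: Q_def prob_space)
    finally show "expectation (\<lambda>\<omega>. (Y k \<omega>)\<^sup>2) \<le> Q" .
  next
    fix \<epsilon> :: real assume \<epsilon>: "0 < \<epsilon>"
    have "prob {\<omega>\<in>space M. \<epsilon> < Y k \<omega>} =
      prob {\<omega>\<in>space M. ennreal \<epsilon> < ennreal (indicator (D r) \<omega> * norm (S k \<omega> - (Jr \<omega> - Js \<omega>)))}" for k
    proof (rule finite_measure_eq_AE)
      show "AE \<omega> in M. \<omega> \<in> {\<omega>\<in>space M. \<epsilon> < Y k \<omega>} \<longleftrightarrow>
        \<omega> \<in> {\<omega>\<in>space M. ennreal \<epsilon> < ennreal (indicator (D r) \<omega> * norm (S k \<omega> - (Jr \<omega> - Js \<omega>)))}"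
        using T(2)
        by eventually_elim (use \<epsilon> in \<open>auto simp: Y_def ennreal_less_iff split: split_indicator\<close>)
    qed measurable
    then show "(\<lambda>k. prob {\<omega>\<in>space M. \<epsilon> < Y k \<omega>}) \<longlonglongrightarrow> 0"
      using convY \<epsilon> by (simp add: tends_in_prob_0_def)
  qed (auto simp: Y_def)
  then have lim: "(\<lambda>k. C' * expectation (Y k)) \<longlonglongrightarrow> 0" by (rule tendsto_mult_right_zero)
  have "norm (expectation (\<lambda>\<omega>. \<zeta> \<omega> \<bullet> B k \<omega>) - expectation (\<lambda>\<omega>. \<zeta> \<omega> \<bullet> T \<omega>)) \<le> C' * expectation (Y k)" for k
  proof -
    have i1: "integrable M (\<lambda>\<omega>. \<zeta> \<omega> \<bullet> S k \<omega>)"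
      by (rule integrable_inner_of_power2[OF _ _ \<zeta>i Si]) measurable
    have i2: "integrable M (\<lambda>\<omega>. \<zeta> \<omega> \<bullet> T \<omega>)"
    proof (rule integrable_const_bound[of _ "\<bar>C'\<bar> * \<bar>C\<bar>"])
      have "norm (\<zeta> \<omega> \<bullet> T \<omega>) \<le> \<bar>C'\<bar> * \<bar>C\<bar>" for \<omega>
      proof (cases "\<omega> \<in> D r")
        case True
        have "norm (\<zeta> \<omega> \<bullet> T \<omega>) \<le> norm (\<zeta> \<omega>) * norm (T \<omega>)" by (simp add: Cauchy_Schwarz_ineq2)
        also have "\<dots> \<le> \<bar>C'\<bar> * \<bar>C\<bar>" using \<zeta>(2)[of \<omega>] T(3)[OF True] by (intro mult_mono) auto
        finally show ?thesis .
      qed (simp add: \<zeta>(3))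
      then show "AE \<omega> in M. norm (\<zeta> \<omega> \<bullet> T \<omega>) \<le> \<bar>C'\<bar> * \<bar>C\<bar>" by simp
    qed measurable
    have Y1: "integrable M (Y k)" by (rule square_integrable_imp_integrable[OF _ Yi]) measurable
    have "norm (expectation (\<lambda>\<omega>. \<zeta> \<omega> \<bullet> B k \<omega>) - expectation (\<lambda>\<omega>. \<zeta> \<omega> \<bullet> T \<omega>)) =
      norm (expectation (\<lambda>\<omega>. \<zeta> \<omega> \<bullet> S k \<omega> - \<zeta> \<omega> \<bullet> T \<omega>))"
      unfolding SB using i1 i2 by simp
    also have "\<dots> \<le> expectation (\<lambda>\<omega>. norm (\<zeta> \<omega> \<bullet> S k \<omega> - \<zeta> \<omega> \<bullet> T \<omega>))"
      by (rule integral_norm_bound)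
    also have "\<dots> \<le> expectation (\<lambda>\<omega>. C' * Y k \<omega>)"
    proof (rule integral_mono)
      show "integrable M (\<lambda>\<omega>. norm (\<zeta> \<omega> \<bullet> S k \<omega> - \<zeta> \<omega> \<bullet> T \<omega>))" using i1 i2 by auto
      show "integrable M (\<lambda>\<omega>. C' * Y k \<omega>)" using Y1 by simp
      fix \<omega>
      show "norm (\<zeta> \<omega> \<bullet> S k \<omega> - \<zeta> \<omega> \<bullet> T \<omega>) \<le> C' * Y k \<omega>"
      proof (cases "\<omega> \<in> D r")
        case True
        have "norm (\<zeta> \<omega> \<bullet> S k \<omega> - \<zeta> \<omega> \<bullet> T \<omega>) \<le> norm (\<zeta> \<omega>) * norm (S k \<omega> - T \<omega>)"
          by (simp add: Cauchy_Schwarz_ineq2 flip: inner_diff_right)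
        also have "\<dots> \<le> C' * norm (S k \<omega> - T \<omega>)" using \<zeta>(2) by (intro mult_right_mono) auto
        finally show ?thesis using True by (simp add: Y_def)
      qed (simp add: \<zeta>(3) Y_def)
    qed
    finally show ?thesis by simp
  qed
  then have "(\<lambda>k. expectation (\<lambda>\<omega>. \<zeta> \<omega> \<bullet> B k \<omega>) - expectation (\<lambda>\<omega>. \<zeta> \<omega> \<bullet> T \<omega>)) \<longlonglongrightarrow> 0"
    by (intro Lim_null_comparison[OF always_eventually lim]) blast
  then show ?thesis unfolding B_def by (rule LIM_zero_cancel)
qed

end

section \<open>The energy inequality\<close>

text \<open>The chain rule for the squared norm of a primitive, proved by Fubini since
  \<open>\<phi>\<close> is merely bounded and measurable. The square of the integral is an integral
  over a square, which splits into two triangles of equal weight; the diagonal is null.\<close>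

lemma integral_primitive_inner:
  fixes \<phi> :: "real \<Rightarrow> 'b :: euclidean_space" and s t :: real
  defines "N \<equiv> restrict_space lborel {s..t}"
  assumes \<phi> [measurable]: "\<phi> \<in> borel_measurable N" and b: "\<And>v. norm (\<phi> v) \<le> K"
  shows "2 * (\<integral>v. (\<integral>w. indicator {..v} w *\<^sub>R \<phi> w \<partial>N) \<bullet> \<phi> v \<partial>N) = (norm (\<integral>v. \<phi> v \<partial>N))\<^sup>2"
proof -
  interpret N: finite_measure N
    by (rule finite_measureI) (simp add: N_def space_restrict_space emeasure_restrict_space emeasure_lborel_Icc_eq)
  interpret P: pair_sigma_finite N N ..
  interpret NN: finite_measure "N \<Otimes>\<^sub>M N" by (rule finite_measure_pair_measure) unfold_locales
  have K: "0 \<le> K" using order_trans[OF norm_ge_zero b[of 0]] .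
  have idN [measurable]: "(\<lambda>v. v) \<in> borel_measurable N" unfolding N_def by (simp add: measurable_restrict_space1)
  have \<phi>i: "integrable N \<phi>" by (rule N.integrable_const_bound[of _ K]) (use b in auto)
  have \<phi>c: "integrable N (\<lambda>w. indicator {..v} w *\<^sub>R \<phi> w)" "integrable N (\<lambda>w. indicator {v<..} w *\<^sub>R \<phi> w)"
    "integrable N (\<lambda>w. indicator {..<v} w *\<^sub>R \<phi> w)" for v
    by (rule N.integrable_const_bound[of _ K]; use b K in \<open>auto split: split_indicator\<close>)+
  have pb: "norm (\<phi> w \<bullet> \<phi> v) \<le> K * K" for v w
    using Cauchy_Schwarz_ineq2[of "\<phi> w" "\<phi> v"] mult_mono[OF b[of w] b[of v] K] by simp
  define \<Phi> where "\<Phi> v = (\<integral>w. indicator {..v} w *\<^sub>R \<phi> w \<partial>N)" for v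
  define I where "I = (\<integral>v. \<phi> v \<partial>N)"
  \<comment> \<open>The integrand over one open triangle; the other triangle, with the diagonal, is
    carried by \<open>\<Phi>\<close>.\<close>
  define c where "c v w = (indicator {v<..} w *\<^sub>R \<phi> w) \<bullet> \<phi> v" for v w
  have ind: "(indicator {v<..} w :: real) = (if v < w then 1 else 0)" for v w :: real by simp
  have cm [measurable]: "(\<lambda>(v, w). c v w) \<in> borel_measurable (N \<Otimes>\<^sub>M N)"
    unfolding c_def ind by measurable
  have cb: "norm (c v w) \<le> K * K" for v w
    using pb K by (auto simp: c_def split: split_indicator)
  have ci: "integrable (N \<Otimes>\<^sub>M N) (\<lambda>(v, w). c v w)"
    by (rule NN.integrable_const_bound[of _ "K * K"]) (use cb cm in auto)
  have le: "(\<integral>w. indicator {..<v} w *\<^sub>R \<phi> w \<partial>N) = \<Phi> v" for v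
    unfolding \<Phi>_def
  proof (rule integral_cong_AE)
    have "AE w in lborel. w \<noteq> v" by (rule AE_lborel_singleton)
    then have "AE w in N. w \<noteq> v" unfolding N_def by (subst AE_restrict_space_iff) auto
    then show "AE w in N. indicator {..<v} w *\<^sub>R \<phi> w = indicator {..v} w *\<^sub>R \<phi> w"
      by eventually_elim (auto split: split_indicator)
  qed (use \<phi>c in auto)
  have split: "I \<bullet> \<phi> v = \<Phi> v \<bullet> \<phi> v + (\<integral>w. c v w \<partial>N)" for v
  proof -
    have "I = (\<integral>w. indicator {..v} w *\<^sub>R \<phi> w + indicator {v<..} w *\<^sub>R \<phi> w \<partial>N)"
      unfolding I_def by (rule Bochner_Integration.integral_cong) (auto split: split_indicator)
    also have "\<dots> = \<Phi> v + (\<integral>w. indicator {v<..} w *\<^sub>R \<phi> w \<partial>N)"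
      using \<phi>c by (simp add: \<Phi>_def)
    finally have "I \<bullet> \<phi> v = \<Phi> v \<bullet> \<phi> v + (\<integral>w. indicator {v<..} w *\<^sub>R \<phi> w \<partial>N) \<bullet> \<phi> v"
      by (simp add: inner_add_left)
    also have "(\<integral>w. indicator {v<..} w *\<^sub>R \<phi> w \<partial>N) \<bullet> \<phi> v = (\<integral>w. c v w \<partial>N)"
      unfolding c_def by (rule integral_inner_left[symmetric]) (rule \<phi>c)
    finally show ?thesis .
  qed
  have inner_c: "(\<integral>v. c v w \<partial>N) = \<Phi> w \<bullet> \<phi> w" for w
  proof -
    have "(\<integral>v. c v w \<partial>N) = (\<integral>v. (indicator {..<w} v *\<^sub>R \<phi> v) \<bullet> \<phi> w \<partial>N)"
      by (rule Bochner_Integration.integral_cong) (auto simp: c_def inner_commute split: split_indicator)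
    also have "\<dots> = (\<integral>v. indicator {..<w} v *\<^sub>R \<phi> v \<partial>N) \<bullet> \<phi> w"
      by (rule integral_inner_left) (rule \<phi>c)
    also have "\<dots> = \<Phi> w \<bullet> \<phi> w" by (simp only: le)
    finally show ?thesis .
  qed
  have c1: "integrable N (\<lambda>v. \<integral>w. c v w \<partial>N)" using P.integrable_fst[OF ci] by simp
  have c2: "(\<integral>v. (\<integral>w. c v w \<partial>N) \<partial>N) = (\<integral>w. \<Phi> w \<bullet> \<phi> w \<partial>N)"
    using P.Fubini_integral[OF ci] by (simp add: inner_c)
  have c3: "integrable N (\<lambda>w. \<Phi> w \<bullet> \<phi> w)" using P.integrable_snd[OF ci] by (simp add: inner_c)
  have "(norm I)\<^sup>2 = (\<integral>v. I \<bullet> \<phi> v \<partial>N)" using \<phi>i by (simp add: power2_norm_eq_inner I_def)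
  also have "\<dots> = (\<integral>v. \<Phi> v \<bullet> \<phi> v \<partial>N) + (\<integral>v. (\<integral>w. c v w \<partial>N) \<partial>N)"
    unfolding split using c1 c3 by simp
  finally show ?thesis unfolding c2 I_def \<Phi>_def by simp
qed

context killed_integrand
begin

text \<open>On \<open>D t\<close> the vector \<open>u t\<close> is \<open>A t\<close> plus the weak
  limit of \<open>B k\<close>; what the approximations carry off \<open>D t\<close> is discarded,
  which gives the inequality. \<open>A0\<close> is cut off by \<open>D s\<close>, so the start
  contributes the killed second moment at \<open>s\<close>. A constant \<open>e0\<close> is enough,
  because the comparison argument works on arbitrarily short intervals.\<close>

lemma killed_energy:
  fixes \<phi> u :: "real \<Rightarrow> 'w \<Rightarrow> complex ^ 'd"
  assumes \<phi>: "measurable_adapted M F a t \<phi>"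
    and \<phi>_bound: "\<And>r \<omega>. s \<le> r \<Longrightarrow> r \<le> t \<Longrightarrow> \<omega> \<in> D r \<Longrightarrow> norm (\<phi> r \<omega>) \<le> K"
    and u: "\<And>r. s \<le> r \<Longrightarrow> r \<le> t \<Longrightarrow> u r \<in> borel_measurable (F r)"
    and u_bound: "\<And>r \<omega>. s \<le> r \<Longrightarrow> r \<le> t \<Longrightarrow> \<omega> \<in> D r \<Longrightarrow> norm (u r \<omega>) \<le> K"
    and J: "\<And>r. s \<le> r \<Longrightarrow> r \<le> t \<Longrightarrow> ito_integral M F W a r h (J r)"
    and sol: "\<And>r. s \<le> r \<Longrightarrow> r \<le> t \<Longrightarrow>
      AE \<omega> in M. u r \<omega> = u s \<omega> + (LINT v:{s..r}|lborel. \<phi> v \<omega>) + (J r \<omega> - J s \<omega>)"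
    and e0: "\<And>r. s \<le> r \<Longrightarrow> r \<le> t \<Longrightarrow>
      expectation (\<lambda>\<omega>. indicator (D r) \<omega> * (2 * (\<phi> r \<omega> \<bullet> u r \<omega>) + (norm (h r \<omega>))\<^sup>2)) \<le> e0"
  shows "expectation (\<lambda>\<omega>. indicator (D t) \<omega> * (norm (u t \<omega>))\<^sup>2) \<le>
    expectation (\<lambda>\<omega>. indicator (D s) \<omega> * (norm (u s \<omega>))\<^sup>2) + e0 * (t - s)"
proof -
  \<comment> \<open>Lebesgue measure on \<open>[s,t]\<close> as a finite measure: bounded measurable
    functions become integrable, and Fubini with \<open>M\<close> is available.\<close>
  define N where "N = restrict_space lborel {s..t}"
  have spN: "space N = {s..t}" by (simp add: N_def space_restrict_space)
  have setsN: "sets N = sets (restrict_space borel {s..t})"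
    unfolding N_def by (rule sets_restrict_space_cong) simp
  interpret N: finite_measure N
    by (rule finite_measureI) (simp add: N_def space_restrict_space emeasure_restrict_space emeasure_lborel_Icc_eq)
  interpret P: pair_sigma_finite N M ..
  interpret NM: finite_measure "N \<Otimes>\<^sub>M M" by (rule finite_measure_pair_measure) unfold_locales
  have st: "s \<le> t" using ast by simp
  have DM: "D r \<in> events" if "s \<le> r" "r \<le> t" for r using sets_F_M[OF _ D[OF that]] that ast by simp
  have uM: "u r \<in> borel_measurable M" if "s \<le> r" "r \<le> t" for r
    using borel_measurable_F[OF u[OF that]] that ast by simp
  have idN [measurable]: "(\<lambda>v. v) \<in> borel_measurable N"
    unfolding N_def by (simp add: measurable_restrict_space1)
  have DN [measurable]: "(\<lambda>(v, \<omega>). indicator (D v) \<omega> :: real) \<in> borel_measurable (N \<Otimes>\<^sub>M M)"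
    using D_joint measurable_cong_sets[OF sets_pair_measure_cong[OF setsN refl] refl] by blast
  have to_N: "(\<lambda>(v, \<omega>). k v \<omega>) \<in> borel_measurable (N \<Otimes>\<^sub>M M)"
    if k: "measurable_adapted M F a t k" for k :: "real \<Rightarrow> 'w \<Rightarrow> 'e :: {real_normed_vector, second_countable_topology}"
  proof -
    show ?thesis
      using measurable_adapted_restrict[OF k ast(1) order_refl]
        measurable_cong_sets[OF sets_pair_measure_cong[OF setsN refl] refl] by blast
  qed
  note \<phi>N [measurable] = to_N[OF \<phi>] and hN [measurable] = to_N[OF h]
  \<comment> \<open>The killed drift is bounded by \<open>K\<close> everywhere, not only on
    survival, so it may serve both as an integrand and as a test vector.\<close>
  define \<phi>D where "\<phi>D v \<omega> = (indicator {s..t} v * indicator (D v) \<omega>) *\<^sub>R \<phi> v \<omega>" for v \<omega>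
  have \<phi>DN [measurable]: "(\<lambda>(v, \<omega>). \<phi>D v \<omega>) \<in> borel_measurable (N \<Otimes>\<^sub>M M)"
    unfolding \<phi>D_def by measurable
  have \<phi>Db: "norm (\<phi>D v \<omega>) \<le> K" for v \<omega>
    using \<phi>_bound[of v \<omega>] K by (auto simp: \<phi>D_def split: split_indicator)
  have \<phi>DF: "\<phi>D r \<in> borel_measurable (F r)" if r: "s \<le> r" "r \<le> t" for r
  proof -
    have [measurable]: "D r \<in> sets (F r)" by (rule D[OF r])
    have [measurable]: "\<phi> r \<in> borel_measurable (F r)" using \<phi> r ast by (simp add: measurable_adapted_def)
    show ?thesis unfolding \<phi>D_def by measurable
  qed
  have \<phi>DM: "\<phi>D r \<in> borel_measurable M" if "s \<le> r" "r \<le> t" for r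
    using borel_measurable_F[OF \<phi>DF[OF that]] that ast by simp
  have \<phi>DNs [measurable]: "(\<lambda>v. \<phi>D v \<omega>) \<in> borel_measurable N" if "\<omega> \<in> space M" for \<omega>
    using measurable_compose[OF measurable_Pair2'[OF that] \<phi>DN] by simp
  define A0 where "A0 \<omega> = indicator (D s) \<omega> *\<^sub>R u s \<omega>" for \<omega>
  have A0F: "A0 \<in> borel_measurable (F s)"
  proof -
    have [measurable]: "D s \<in> sets (F s)" "u s \<in> borel_measurable (F s)" using D u st by auto
    show ?thesis unfolding A0_def by measurable
  qed
  have A0M [measurable]: "A0 \<in> borel_measurable M" by (rule borel_measurable_F[OF A0F ast(1)])
  have A0b: "norm (A0 \<omega>) \<le> K" for \<omega> using u_bound[of s \<omega>] K st by (auto simp: A0_def split: split_indicator)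
  \<comment> \<open>Defined and bounded for all paths. On \<open>D r\<close> nothing has been killed
    up to \<open>r\<close>, because \<open>D\<close> decreases, so there \<open>A r\<close> is the
    true drift part of \<open>u r\<close>.\<close>
  define A where "A r \<omega> = A0 \<omega> + (\<integral>v. indicator {..r} v *\<^sub>R \<phi>D v \<omega> \<partial>N)" for r \<omega>
  define C where "C = K + K * measure N (space N)"
  have C: "0 \<le> C" "K \<le> C" using K by (auto simp: C_def)
  have Ab: "norm (A r \<omega>) \<le> C" for r \<omega>
  proof -
    have "norm (\<integral>v. indicator {..r} v *\<^sub>R \<phi>D v \<omega> \<partial>N) \<le> (\<integral>v. norm (indicator {..r} v *\<^sub>R \<phi>D v \<omega>) \<partial>N)"
      by (rule integral_norm_bound)
    also have "\<dots> \<le> (\<integral>v. K \<partial>N)"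
      by (rule integral_mono') (use \<phi>Db K in \<open>auto split: split_indicator\<close>)
    finally show ?thesis
      unfolding A_def C_def using A0b[of \<omega>] by (intro order_trans[OF norm_triangle_ineq] add_mono) (auto simp: mult.commute)
  qed
  have ind: "(indicator {..r} v :: real) = (if v \<le> r then 1 else 0)" for v r :: real by simp
  have Ajoint: "(\<lambda>(r, \<omega>). A r \<omega>) \<in> borel_measurable (N \<Otimes>\<^sub>M M)"
    unfolding A_def ind by measurable
  note [measurable] = Ajoint
  have AM: "A r \<in> borel_measurable M" for r
    unfolding A_def by measurable
  have A_on_D: "A r \<omega> = u s \<omega> + (LINT v:{s..r}|lborel. \<phi> v \<omega>)" if r: "s \<le> r" "r \<le> t" and \<omega>: "\<omega> \<in> D r" for r \<omega>
  proof -
    have "\<omega> \<in> D s" using D_mono[of s r] r \<omega> by auto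
    moreover have "(\<integral>v. indicator {..r} v *\<^sub>R \<phi>D v \<omega> \<partial>N) = (LINT v:{s..r}|lborel. \<phi> v \<omega>)"
      unfolding N_def set_lebesgue_integral_def
    proof (subst integral_restrict_space)
      show "(\<integral>v. indicator {s..t} v *\<^sub>R indicator {..r} v *\<^sub>R \<phi>D v \<omega> \<partial>lborel) = (\<integral>v. indicator {s..r} v *\<^sub>R \<phi> v \<omega> \<partial>lborel)"
      proof (rule Bochner_Integration.integral_cong)
        fix v
        have "v \<in> {s..r} \<Longrightarrow> \<omega> \<in> D v" using D_mono[of v r] r \<omega> by auto
        then show "indicator {s..t} v *\<^sub>R indicator {..r} v *\<^sub>R \<phi>D v \<omega> = indicator {s..r} v *\<^sub>R \<phi> v \<omega>"
          using r by (auto simp: \<phi>D_def split: split_indicator)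
      qed simp
    qed simp
    ultimately show ?thesis by (simp add: A_def A0_def)
  qed
  obtain n q Z where sp: "\<And>k. simple_process M F a t (n k) (q k) (Z k)"
    and conv: "tends_in_prob_0 M (\<lambda>k \<omega>. \<integral>\<^sup>+v\<in>{a..t}. ennreal ((norm (simple_value (n k) (q k) (Z k) v \<omega> - h v \<omega>))\<^sup>2) \<partial>lborel)"
    using J[OF st] by (auto simp: ito_integral_def)
  define R where "R k Nk p G \<longleftrightarrow> simple_process M F a t Nk p G \<and> (\<forall>v \<omega>. norm (simple_value Nk p G v \<omega>) \<le> K) \<and>
    (\<forall>v \<omega>. v \<le> s \<longrightarrow> simple_value Nk p G v \<omega> = 0) \<and>
    (\<forall>v \<omega>. s < v \<longrightarrow> v \<le> t \<longrightarrow> \<omega> \<in> D v \<longrightarrow> simple_value Nk p G v \<omega> = clip K (simple_value (n k) (q k) (Z k) v \<omega>)) \<and>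
    (\<forall>\<omega>. ennreal (\<Sum>i<Nk. (p (Suc i) - p i) * (norm (G i \<omega>))\<^sup>2) \<le>
      (\<integral>\<^sup>+v\<in>{s..t}. ennreal (indicator (D v) \<omega> * (norm (clip K (simple_value (n k) (q k) (Z k) v \<omega>)))\<^sup>2) \<partial>lborel) +
      ennreal ((t - a) / real (Suc k) * K\<^sup>2))" for k Nk p G
  have "\<exists>Nk p G. R k Nk p G" for k
    unfolding R_def by (rule killed_step[OF sp[of k], of "Suc k"]) (simp, blast)
  then obtain Nk p G where "\<And>k. R k (Nk k) (p k) (G k)" by metis
  then have spG: "simple_process M F a t (Nk k) (p k) (G k)"
    and G1: "norm (simple_value (Nk k) (p k) (G k) v \<omega>) \<le> K"
    and G2: "v \<le> s \<Longrightarrow> simple_value (Nk k) (p k) (G k) v \<omega> = 0"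
    and G3: "s < v \<Longrightarrow> v \<le> t \<Longrightarrow> \<omega> \<in> D v \<Longrightarrow>
      simple_value (Nk k) (p k) (G k) v \<omega> = clip K (simple_value (n k) (q k) (Z k) v \<omega>)"
    and G4: "ennreal (\<Sum>i<Nk k. (p k (Suc i) - p k i) * (norm (G k i \<omega>))\<^sup>2) \<le>
      (\<integral>\<^sup>+v\<in>{s..t}. ennreal (indicator (D v) \<omega> * (norm (clip K (simple_value (n k) (q k) (Z k) v \<omega>)))\<^sup>2) \<partial>lborel) +
      ennreal ((t - a) / real (Suc k) * K\<^sup>2)" for k v \<omega>
    unfolding R_def by blast+
  define B where "B k = simple_integral W (Nk k) (p k) (G k)" for k
  have BM [measurable]: "B k \<in> borel_measurable M" for k unfolding B_def by (rule simple_integral_measurable[OF spG])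
  have B2i: "integrable M (\<lambda>\<omega>. (norm (B k \<omega>))\<^sup>2)" for k
    unfolding B_def by (rule simple_integral_square_integrable[OF spG])
  have B2: "expectation (\<lambda>\<omega>. (norm (B k \<omega>))\<^sup>2) \<le> (t - a) * K\<^sup>2" for k
    unfolding B_def by (rule simple_integral_bounded_second_moment[OF spG G1])
  have B1i: "integrable M (\<lambda>\<omega>. norm (B k \<omega>))" for k
    by (rule square_integrable_imp_integrable[OF _ B2i]) measurable
  have B1: "expectation (\<lambda>\<omega>. norm (B k \<omega>)) \<le> 1 + (t - a) * K\<^sup>2" for k
  proof -
    have "expectation (\<lambda>\<omega>. norm (B k \<omega>)) \<le> expectation (\<lambda>\<omega>. 1 + (norm (B k \<omega>))\<^sup>2)"
    proof (rule integral_mono[OF B1i])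
      show "integrable M (\<lambda>\<omega>. 1 + (norm (B k \<omega>))\<^sup>2)" using B2i by simp
      show "norm (B k \<omega>) \<le> 1 + (norm (B k \<omega>))\<^sup>2" for \<omega>
        using sum_squares_bound[of "norm (B k \<omega>)" 1] by (simp, smt (verit) norm_ge_zero zero_le_power2)
    qed
    also have "\<dots> \<le> 1 + (t - a) * K\<^sup>2" using B2[of k] B2i[of k] by (simp add: prob_space)
    finally show ?thesis .
  qed
  \<comment> \<open>On \<open>D r\<close> the difference \<open>u r - A r\<close> is almost surely
    \<open>J r - J s\<close>. Although \<open>B k\<close> is an integral up to \<open>t\<close>, the
    limit is the one for time \<open>r\<close>, since \<open>\<zeta>\<close> is known at
    \<open>r\<close>.\<close>
  have weak: "(\<lambda>k. expectation (\<lambda>\<omega>. \<zeta> \<omega> \<bullet> B k \<omega>)) \<longlonglongrightarrow> expectation (\<lambda>\<omega>. \<zeta> \<omega> \<bullet> (u r \<omega> - A r \<omega>))"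
    if r: "s \<le> r" "r \<le> t" and \<zeta>: "\<zeta> \<in> borel_measurable (F r)" "\<And>\<omega>. norm (\<zeta> \<omega>) \<le> K" "\<And>\<omega>. \<omega> \<notin> D r \<Longrightarrow> \<zeta> \<omega> = 0" for r \<zeta>
  proof -
    define T where "T \<omega> = indicator (D r) \<omega> *\<^sub>R (u r \<omega> - A r \<omega>)" for \<omega>
    have "(\<lambda>k. expectation (\<lambda>\<omega>. \<zeta> \<omega> \<bullet> simple_integral W (Nk k) (p k) (G k) \<omega>)) \<longlonglongrightarrow> expectation (\<lambda>\<omega>. \<zeta> \<omega> \<bullet> T \<omega>)"
    proof (rule killed_weak_limit[OF sp conv spG G1 G2 G3 r J[OF r] J[OF order_refl st] _ _ _ \<zeta>])
      have [measurable]: "D r \<in> events" "u r \<in> borel_measurable M" "A r \<in> borel_measurable M"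
        using DM[OF r] uM[OF r] AM by auto
      show "T \<in> borel_measurable M" unfolding T_def by measurable
      show "AE \<omega> in M. \<omega> \<in> D r \<longrightarrow> T \<omega> = J r \<omega> - J s \<omega>"
        using sol[OF r] by eventually_elim (auto simp: T_def A_on_D[OF r])
      show "norm (T \<omega>) \<le> K + C" if "\<omega> \<in> D r" for \<omega>
        using order_trans[OF norm_triangle_ineq4 add_mono[OF u_bound[OF r that] Ab]] that by (simp add: T_def)
    qed
    moreover have "\<zeta> \<omega> \<bullet> T \<omega> = \<zeta> \<omega> \<bullet> (u r \<omega> - A r \<omega>)" for \<omega>
      using \<zeta>(3)[of \<omega>] by (cases "\<omega> \<in> D r") (auto simp: T_def)
    ultimately show ?thesis by (simp add: B_def)
  qed
  have bi: "integrable M X" if "X \<in> borel_measurable M" "\<And>\<omega>. \<omega> \<in> space M \<Longrightarrow> norm (X \<omega>) \<le> c" for X :: "'w \<Rightarrow> real" and c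
    by (rule integrable_const_bound[of _ c]) (use that in auto)
  have inner_b: "norm (x \<bullet> y) \<le> c * c'" if "norm x \<le> c" "norm y \<le> c'" for x y :: "complex ^ 'd" and c c'
    using Cauchy_Schwarz_ineq2[of x y] mult_mono[OF that(1) that(2)] order_trans[OF norm_ge_zero that(1)] by simp
  \<comment> \<open>Drift contribution with the true \<open>u v\<close>; \<open>ek k v\<close> is
    the same with \<open>A v + B k\<close>. The two are linked by \<open>weak\<close>, tested with
    \<open>\<phi>D v\<close> at time \<open>v\<close>.\<close>
  define e1 where "e1 v = 2 * expectation (\<lambda>\<omega>. \<phi>D v \<omega> \<bullet> u v \<omega>)" for v
  define ek where "ek k v = 2 * expectation (\<lambda>\<omega>. \<phi>D v \<omega> \<bullet> (A v \<omega> + B k \<omega>))" for k v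
  have \<phi>A_i: "integrable M (\<lambda>\<omega>. \<phi>D v \<omega> \<bullet> A v \<omega>)" if v: "v \<in> {s..t}" for v
  proof -
    have [measurable]: "\<phi>D v \<in> borel_measurable M" "A v \<in> borel_measurable M" using \<phi>DM v AM by auto
    show ?thesis by (rule bi[of _ "K * C"]) (measurable, rule inner_b[OF \<phi>Db Ab])
  qed
  have \<phi>B_i: "integrable M (\<lambda>\<omega>. \<phi>D v \<omega> \<bullet> B k \<omega>)" if v: "v \<in> {s..t}" for v k
  proof -
    have [measurable]: "\<phi>D v \<in> borel_measurable M" using \<phi>DM v by auto
    show ?thesis
      by (rule Bochner_Integration.integrable_bound[of _ "\<lambda>\<omega>. K * norm (B k \<omega>)"])
        (use B1i K inner_b[OF \<phi>Db order_refl] in auto)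
  qed
  have ek_lim: "(\<lambda>k. ek k v) \<longlonglongrightarrow> e1 v" if v: "v \<in> {s..t}" for v
  proof -
    have v': "s \<le> v" "v \<le> t" using v by auto
    have [measurable]: "\<phi>D v \<in> borel_measurable M" "A v \<in> borel_measurable M" "u v \<in> borel_measurable M"
      "D v \<in> events" using \<phi>DM v AM uM DM by auto
    have ui: "integrable M (\<lambda>\<omega>. \<phi>D v \<omega> \<bullet> u v \<omega>)"
    proof (rule bi[of _ "K * K"])
      show "norm (\<phi>D v \<omega> \<bullet> u v \<omega>) \<le> K * K" for \<omega>
        using inner_b[OF \<phi>Db[of v \<omega>] u_bound[OF v', of \<omega>]] K by (cases "\<omega> \<in> D v") (auto simp: \<phi>D_def)
    qed measurable
    have "(\<lambda>k. expectation (\<lambda>\<omega>. \<phi>D v \<omega> \<bullet> B k \<omega>)) \<longlonglongrightarrow> expectation (\<lambda>\<omega>. \<phi>D v \<omega> \<bullet> (u v \<omega> - A v \<omega>))"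
      by (rule weak[OF v' \<phi>DF[OF v'] \<phi>Db]) (simp add: \<phi>D_def)
    also have "expectation (\<lambda>\<omega>. \<phi>D v \<omega> \<bullet> (u v \<omega> - A v \<omega>)) = expectation (\<lambda>\<omega>. \<phi>D v \<omega> \<bullet> u v \<omega>) - expectation (\<lambda>\<omega>. \<phi>D v \<omega> \<bullet> A v \<omega>)"
      using ui \<phi>A_i[OF v] by (simp add: inner_diff_right)
    finally have "(\<lambda>k. 2 * (expectation (\<lambda>\<omega>. \<phi>D v \<omega> \<bullet> A v \<omega>) + expectation (\<lambda>\<omega>. \<phi>D v \<omega> \<bullet> B k \<omega>))) \<longlonglongrightarrow>
      2 * (expectation (\<lambda>\<omega>. \<phi>D v \<omega> \<bullet> A v \<omega>) + (expectation (\<lambda>\<omega>. \<phi>D v \<omega> \<bullet> u v \<omega>) - expectation (\<lambda>\<omega>. \<phi>D v \<omega> \<bullet> A v \<omega>)))"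
      by (intro tendsto_intros)
    then show ?thesis
      using \<phi>A_i[OF v] \<phi>B_i[OF v] by (simp add: ek_def e1_def inner_add_right)
  qed
  have ekm: "ek k \<in> borel_measurable N" for k unfolding ek_def by measurable
  \<comment> \<open>\<open>u\<close> is known to be measurable only time by time, so
    \<open>e1\<close> obtains its measurability in \<open>v\<close> as a pointwise limit of the
    \<open>ek k\<close>.\<close>
  have e1m: "e1 \<in> borel_measurable N"
    by (rule borel_measurable_LIMSEQ_metric[OF ekm ek_lim]) (simp add: spN)
  define c1 where "c1 = 2 * (K * C + K * (1 + (t - a) * K\<^sup>2))"
  have ek_b: "norm (ek k v) \<le> c1" if v: "v \<in> {s..t}" for k v
  proof -
    have "norm (expectation (\<lambda>\<omega>. \<phi>D v \<omega> \<bullet> A v \<omega>)) \<le> K * C"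
    proof -
      have "norm (expectation (\<lambda>\<omega>. \<phi>D v \<omega> \<bullet> A v \<omega>)) \<le> expectation (\<lambda>\<omega>. norm (\<phi>D v \<omega> \<bullet> A v \<omega>))"
        by (rule integral_norm_bound)
      also have "\<dots> \<le> K * C"
        by (rule integral_le_const) (use \<phi>A_i[OF v] inner_b[OF \<phi>Db Ab] in auto)
      finally show ?thesis .
    qed
    moreover have "norm (expectation (\<lambda>\<omega>. \<phi>D v \<omega> \<bullet> B k \<omega>)) \<le> K * (1 + (t - a) * K\<^sup>2)"
    proof -
      have "norm (expectation (\<lambda>\<omega>. \<phi>D v \<omega> \<bullet> B k \<omega>)) \<le> expectation (\<lambda>\<omega>. norm (\<phi>D v \<omega> \<bullet> B k \<omega>))"
        by (rule integral_norm_bound)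
      also have "\<dots> \<le> expectation (\<lambda>\<omega>. K * norm (B k \<omega>))"
        by (rule integral_mono) (use \<phi>B_i[OF v] B1i inner_b[OF \<phi>Db order_refl] in auto)
      also have "\<dots> \<le> K * (1 + (t - a) * K\<^sup>2)" using B1[of k] K by simp
      finally show ?thesis .
    qed
    ultimately have "norm (expectation (\<lambda>\<omega>. \<phi>D v \<omega> \<bullet> A v \<omega>) + expectation (\<lambda>\<omega>. \<phi>D v \<omega> \<bullet> B k \<omega>)) \<le>
      K * C + K * (1 + (t - a) * K\<^sup>2)"
      by (intro order_trans[OF norm_triangle_ineq] add_mono)
    then show ?thesis using \<phi>A_i[OF v] \<phi>B_i[OF v] by (simp add: ek_def c1_def inner_add_right)
  qed
  have ek_int: "integrable N (ek k)" for k
    by (rule N.integrable_const_bound[OF AE_I2[OF ek_b] ekm]) (simp add: spN)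
  have e1_int: "integrable N e1" and ek_conv: "(\<lambda>k. \<integral>v. ek k v \<partial>N) \<longlonglongrightarrow> (\<integral>v. e1 v \<partial>N)"
  proof -
    have ae1: "AE v in N. (\<lambda>k. ek k v) \<longlonglongrightarrow> e1 v" by (rule AE_I2) (simp add: ek_lim spN)
    have ae2: "AE v in N. norm (ek k v) \<le> c1" for k by (rule AE_I2, rule ek_b) (simp add: spN)
    show "integrable N e1" by (rule integrable_dominated_convergence[OF e1m ekm _ ae1 ae2]) simp
    show "(\<lambda>k. \<integral>v. ek k v \<partial>N) \<longlonglongrightarrow> (\<integral>v. e1 v \<partial>N)"
      by (rule integral_dominated_convergence[OF e1m ekm _ ae1 ae2]) simp
  qed
  define hh where "hh v \<omega> = indicator {s..t} v * (indicator (D v) \<omega> * (norm (h v \<omega>))\<^sup>2)" for v \<omega>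
  have hhm [measurable]: "(\<lambda>(v, \<omega>). hh v \<omega>) \<in> borel_measurable (N \<Otimes>\<^sub>M M)" unfolding hh_def by measurable
  have hhb: "norm (hh v \<omega>) \<le> K\<^sup>2" and hh0: "0 \<le> hh v \<omega>" for v \<omega>
    using h_bound[of v \<omega>] K by (auto simp: hh_def power_mono split: split_indicator)
  have hhi: "integrable (N \<Otimes>\<^sub>M M) (\<lambda>(v, \<omega>). hh v \<omega>)"
    by (rule NM.integrable_const_bound[of _ "K\<^sup>2"]) (use hhb in auto)
  define e2 where "e2 v = expectation (hh v)" for v
  have e2_int: "integrable N e2" using P.integrable_fst[OF hhi] by (simp add: e2_def[abs_def])
  define Vr where "Vr = (\<integral>v. e2 v \<partial>N)"
  have Vr: "(\<integral>\<^sup>+\<omega>. (\<integral>\<^sup>+v\<in>{s..t}. ennreal (indicator (D v) \<omega> * (norm (h v \<omega>))\<^sup>2) \<partial>lborel) \<partial>M) = ennreal Vr"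
  proof -
    have "(\<integral>\<^sup>+v\<in>{s..t}. ennreal (indicator (D v) \<omega> * (norm (h v \<omega>))\<^sup>2) \<partial>lborel) = (\<integral>\<^sup>+v. ennreal (hh v \<omega>) \<partial>N)" for \<omega>
      unfolding N_def by (subst nn_integral_restrict_space) (auto intro!: nn_integral_cong simp: hh_def split: split_indicator)
    then have "(\<integral>\<^sup>+\<omega>. (\<integral>\<^sup>+v\<in>{s..t}. ennreal (indicator (D v) \<omega> * (norm (h v \<omega>))\<^sup>2) \<partial>lborel) \<partial>M) =
      (\<integral>\<^sup>+\<omega>. (\<integral>\<^sup>+v. ennreal (hh v \<omega>) \<partial>N) \<partial>M)" by simp
    also have "\<dots> = (\<integral>\<^sup>+v. (\<integral>\<^sup>+\<omega>. ennreal (hh v \<omega>) \<partial>M) \<partial>N)"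
      by (rule P.Fubini') measurable
    also have "\<dots> = (\<integral>\<^sup>+v. ennreal (e2 v) \<partial>N)"
    proof (rule nn_integral_cong)
      fix v assume v: "v \<in> space N"
      have [measurable]: "hh v \<in> borel_measurable M"
        using measurable_compose[OF measurable_Pair1'[OF v] hhm] by simp
      show "(\<integral>\<^sup>+\<omega>. ennreal (hh v \<omega>) \<partial>M) = ennreal (e2 v)"
        unfolding e2_def by (rule nn_integral_eq_integral) (use hh0 hhb bi[of "hh v" "K\<^sup>2"] in auto)
    qed
    also have "\<dots> = ennreal Vr"
      unfolding Vr_def by (rule nn_integral_eq_integral[OF e2_int]) (simp add: e2_def hh0)
    finally show ?thesis .
  qed
  have Vr0: "0 \<le> Vr" unfolding Vr_def e2_def by (simp add: hh0)
  have limsup: "\<forall>\<^sub>F k in sequentially. expectation (\<lambda>\<omega>. (norm (B k \<omega>))\<^sup>2) \<le> Vr + \<eta>" if \<eta>: "0 < \<eta>" for \<eta>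
  proof -
    define Err where "Err k \<omega> = (\<integral>\<^sup>+v\<in>{a..t}. ennreal ((norm (simple_value (n k) (q k) (Z k) v \<omega> - h v \<omega>))\<^sup>2) \<partial>lborel)" for k \<omega>
    define c0 where "c0 = 2 * K * (t - s + 1)"
    have c0: "0 < c0" unfolding c0_def using K ast by (intro mult_pos_pos) auto
    \<comment> \<open>The error that does not shrink with \<open>k\<close> is
      \<open>e * c0 = \<eta> / 2\<close>; the bad-event term and the mesh term eventually fit into
      the other half.\<close>
    define e where "e = \<eta> / (2 * c0)"
    have pos: "0 < e" and half: "e * c0 = \<eta> / 2" using \<eta> c0 by (simp_all add: e_def)
    have "2 * K * e * (t - s + 1) = e * c0" by (simp add: c0_def)
    note e = pos trans[OF this half]
    define pr where "pr k = prob {\<omega>\<in>space M. ennreal (e\<^sup>2) < Err k \<omega>}" for k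
    have "pr \<longlonglongrightarrow> 0"
      using conv e by (simp add: tends_in_prob_0_def pr_def[abs_def] Err_def)
    moreover have "(\<lambda>k. (t - a) / real (Suc k) * K\<^sup>2) \<longlonglongrightarrow> 0"
      using LIMSEQ_Suc[OF lim_const_over_n[of "t - a"]] by (intro tendsto_mult_left_zero)
    ultimately have "(\<lambda>k. 4 * K\<^sup>2 * (t - s) * pr k + (t - a) / real (Suc k) * K\<^sup>2) \<longlonglongrightarrow> 4 * K\<^sup>2 * (t - s) * 0 + 0"
      by (intro tendsto_intros)
    then have "\<forall>\<^sub>F k in sequentially. 4 * K\<^sup>2 * (t - s) * pr k + (t - a) / real (Suc k) * K\<^sup>2 < \<eta> / 2"
      by (rule order_tendstoD) (use \<eta> in simp)
    then show ?thesis
    proof eventually_elim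
      case (elim k)
      have "ennreal (expectation (\<lambda>\<omega>. (norm (B k \<omega>))\<^sup>2)) \<le> ennreal Vr +
        (ennreal (2 * K * e * (t - s + 1)) + ennreal (4 * K\<^sup>2 * (t - s)) * ennreal (pr k) + ennreal ((t - a) / real (Suc k) * K\<^sup>2))"
        using killed_second_moment[OF sp[of k] spG[of k] e(1) G4[of k]] unfolding Vr B_def pr_def Err_def .
      also have "\<dots> = ennreal (Vr + (\<eta> / 2 + 4 * K\<^sup>2 * (t - s) * pr k + (t - a) / real (Suc k) * K\<^sup>2))"
        unfolding e(2) using Vr0 \<eta> ast by (simp add: pr_def flip: ennreal_plus ennreal_mult')
      finally have "expectation (\<lambda>\<omega>. (norm (B k \<omega>))\<^sup>2) \<le> Vr + (\<eta> / 2 + 4 * K\<^sup>2 * (t - s) * pr k + (t - a) / real (Suc k) * K\<^sup>2)"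
        using Vr0 \<eta> ast by (subst (asm) ennreal_le_iff) (auto intro!: add_nonneg_nonneg simp: pr_def)
      then show ?case using elim by linarith
    qed
  qed
  have At: "A t \<omega> = A0 \<omega> + (\<integral>v. \<phi>D v \<omega> \<partial>N)" for \<omega>
    unfolding A_def by (intro arg_cong2[of _ _ _ _ plus] refl Bochner_Integration.integral_cong)
      (auto simp: spN)
  have \<phi>Di: "integrable N (\<lambda>v. \<phi>D v \<omega>)" if "\<omega> \<in> space M" for \<omega>
    by (rule N.integrable_const_bound[of _ K]) (use \<phi>Db \<phi>DNs[OF that] in auto)
  have A\<phi>i: "integrable (N \<Otimes>\<^sub>M M) (\<lambda>(v, \<omega>). \<phi>D v \<omega> \<bullet> A v \<omega>)"
    by (rule NM.integrable_const_bound[of _ "K * C"]) (use inner_b[OF \<phi>Db Ab] in \<open>auto simp: case_prod_beta\<close>)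
  have At2: "(norm (A t \<omega>))\<^sup>2 = (norm (A0 \<omega>))\<^sup>2 + 2 * (\<integral>v. \<phi>D v \<omega> \<bullet> A v \<omega> \<partial>N)" if \<omega>: "\<omega> \<in> space M" for \<omega>
  proof -
    define \<Phi> where "\<Phi> r = (\<integral>v. indicator {..r} v *\<^sub>R \<phi>D v \<omega> \<partial>N)" for r
    have [measurable]: "(\<lambda>v. \<phi>D v \<omega>) \<in> borel_measurable N" by (rule \<phi>DNs[OF \<omega>])
    have \<Phi>m [measurable]: "\<Phi> \<in> borel_measurable N" unfolding \<Phi>_def ind by measurable
    have \<Phi>b: "norm (\<Phi> r) \<le> C + K" for r
      using norm_triangle_ineq4[of "A r \<omega>" "A0 \<omega>"] Ab[of r \<omega>] A0b[of \<omega>] by (simp add: A_def \<Phi>_def)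
    have i: "integrable N (\<lambda>v. \<phi>D v \<omega> \<bullet> \<Phi> v)"
      by (rule N.integrable_const_bound[of _ "K * (C + K)"]) (use inner_b[OF \<phi>Db \<Phi>b] in auto)
    have "(\<integral>v. \<phi>D v \<omega> \<bullet> A v \<omega> \<partial>N) = A0 \<omega> \<bullet> (\<integral>v. \<phi>D v \<omega> \<partial>N) + (\<integral>v. \<phi>D v \<omega> \<bullet> \<Phi> v \<partial>N)"
      using \<phi>Di[OF \<omega>] i by (simp add: A_def \<Phi>_def[symmetric] inner_add_right inner_commute[of _ "A0 \<omega>"])
    moreover have "(\<integral>v. \<phi>D v \<omega> \<bullet> \<Phi> v \<partial>N) = (\<integral>v. \<Phi> v \<bullet> \<phi>D v \<omega> \<partial>N)"
      by (rule Bochner_Integration.integral_cong) (rule refl, rule inner_commute)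
    moreover have "2 * (\<integral>v. \<Phi> v \<bullet> \<phi>D v \<omega> \<partial>N) = (norm (\<integral>v. \<phi>D v \<omega> \<partial>N))\<^sup>2"
      unfolding \<Phi>_def N_def by (rule integral_primitive_inner[OF _ \<phi>Db]) (fold N_def, measurable)
    ultimately show ?thesis unfolding At norm_add_power2 by (simp add: algebra_simps)
  qed
  have A0i: "integrable M (\<lambda>\<omega>. (norm (A0 \<omega>))\<^sup>2)"
    by (rule bi[of _ "K\<^sup>2"]) (use A0b in \<open>auto intro!: power_mono\<close>)
  have [measurable]: "A t \<in> borel_measurable M" by (rule AM)
  have Ati: "integrable M (\<lambda>\<omega>. (norm (A t \<omega>))\<^sup>2)"
    by (rule bi[of _ "C\<^sup>2"]) (use Ab in \<open>auto intro!: power_mono\<close>)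
  have EAt: "expectation (\<lambda>\<omega>. (norm (A t \<omega>))\<^sup>2) = expectation (\<lambda>\<omega>. (norm (A0 \<omega>))\<^sup>2) +
    2 * (\<integral>v. expectation (\<lambda>\<omega>. \<phi>D v \<omega> \<bullet> A v \<omega>) \<partial>N)"
  proof -
    have i: "integrable M (\<lambda>\<omega>. \<integral>v. \<phi>D v \<omega> \<bullet> A v \<omega> \<partial>N)" using P.integrable_snd[OF A\<phi>i] by simp
    have "expectation (\<lambda>\<omega>. (norm (A t \<omega>))\<^sup>2) = expectation (\<lambda>\<omega>. (norm (A0 \<omega>))\<^sup>2 + 2 * (\<integral>v. \<phi>D v \<omega> \<bullet> A v \<omega> \<partial>N))"
      by (rule Bochner_Integration.integral_cong) (use At2 in auto)
    also have "\<dots> = expectation (\<lambda>\<omega>. (norm (A0 \<omega>))\<^sup>2) + 2 * expectation (\<lambda>\<omega>. \<integral>v. \<phi>D v \<omega> \<bullet> A v \<omega> \<partial>N)"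
      using A0i i by simp
    finally show ?thesis using P.Fubini_integral[OF A\<phi>i] by simp
  qed
  \<comment> \<open>\<open>B k\<close> is unbounded, so joint integrability comes from its first
    moment, which bounds the inner integral uniformly in \<open>v\<close>.\<close>
  have Bj: "integrable (N \<Otimes>\<^sub>M M) (\<lambda>(v, \<omega>). \<phi>D v \<omega> \<bullet> B k \<omega>)" for k
  proof (rule P.Fubini_integrable)
    show "(\<lambda>(v, \<omega>). \<phi>D v \<omega> \<bullet> B k \<omega>) \<in> borel_measurable (N \<Otimes>\<^sub>M M)" by measurable
    have "norm (expectation (\<lambda>\<omega>. norm (\<phi>D v \<omega> \<bullet> B k \<omega>))) \<le> K * (1 + (t - a) * K\<^sup>2)" if v: "v \<in> {s..t}" for v
    proof -
      have "expectation (\<lambda>\<omega>. norm (\<phi>D v \<omega> \<bullet> B k \<omega>)) \<le> expectation (\<lambda>\<omega>. K * norm (B k \<omega>))"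
        by (rule integral_mono) (use \<phi>B_i[OF v] B1i inner_b[OF \<phi>Db order_refl] in auto)
      also have "\<dots> \<le> K * (1 + (t - a) * K\<^sup>2)" using B1[of k] K by simp
      finally show ?thesis by simp
    qed
    then have "AE v in N. norm (expectation (\<lambda>\<omega>. norm (\<phi>D v \<omega> \<bullet> B k \<omega>))) \<le> K * (1 + (t - a) * K\<^sup>2)"
      by (intro AE_I2) (simp add: spN)
    then have "integrable N (\<lambda>v. expectation (\<lambda>\<omega>. norm (\<phi>D v \<omega> \<bullet> B k \<omega>)))"
      by (rule N.integrable_const_bound) measurable
    then show "integrable N (\<lambda>v. \<integral>\<omega>. norm (case (v, \<omega>) of (v, \<omega>) \<Rightarrow> \<phi>D v \<omega> \<bullet> B k \<omega>) \<partial>M)" by simp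
    show "AE v in N. integrable M (\<lambda>\<omega>. case (v, \<omega>) of (v, \<omega>) \<Rightarrow> \<phi>D v \<omega> \<bullet> B k \<omega>)"
      by (rule AE_I2) (simp add: \<phi>B_i spN)
  qed
  have A0B: "integrable M (\<lambda>\<omega>. A0 \<omega> \<bullet> B k \<omega>)" for k
    by (rule integrable_inner_of_power2[OF A0M BM A0i B2i])
  \<comment> \<open>\<open>B k\<close> is the integral up to \<open>t\<close> throughout. Replacing
    it by its value at time \<open>v\<close> is the martingale property, and this is already built
    into the limit of \<open>ek k\<close>.\<close>
  have EAB: "expectation (\<lambda>\<omega>. A t \<omega> \<bullet> B k \<omega>) = expectation (\<lambda>\<omega>. A0 \<omega> \<bullet> B k \<omega>) +
    (\<integral>v. expectation (\<lambda>\<omega>. \<phi>D v \<omega> \<bullet> B k \<omega>) \<partial>N)" for k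
  proof -
    have i: "integrable M (\<lambda>\<omega>. \<integral>v. \<phi>D v \<omega> \<bullet> B k \<omega> \<partial>N)" using P.integrable_snd[OF Bj[of k]] by simp
    have "expectation (\<lambda>\<omega>. A t \<omega> \<bullet> B k \<omega>) = expectation (\<lambda>\<omega>. A0 \<omega> \<bullet> B k \<omega> + (\<integral>v. \<phi>D v \<omega> \<bullet> B k \<omega> \<partial>N))"
      by (rule Bochner_Integration.integral_cong) (use \<phi>Di in \<open>auto simp: At inner_add_left\<close>)
    also have "\<dots> = expectation (\<lambda>\<omega>. A0 \<omega> \<bullet> B k \<omega>) + expectation (\<lambda>\<omega>. \<integral>v. \<phi>D v \<omega> \<bullet> B k \<omega> \<partial>N)"
      using A0B i by simp
    finally show ?thesis using P.Fubini_integral[OF Bj[of k]] by simp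
  qed
  define ns where "ns = expectation (\<lambda>\<omega>. indicator (D s) \<omega> * (norm (u s \<omega>))\<^sup>2)"
  define nt where "nt = expectation (\<lambda>\<omega>. indicator (D t) \<omega> * (norm (u t \<omega>))\<^sup>2)"
  have ns: "expectation (\<lambda>\<omega>. (norm (A0 \<omega>))\<^sup>2) = ns"
    unfolding ns_def A0_def by (rule Bochner_Integration.integral_cong) (auto split: split_indicator)
  have EY: "expectation (\<lambda>\<omega>. (norm (A t \<omega> + B k \<omega>))\<^sup>2) =
    ns + 2 * expectation (\<lambda>\<omega>. A0 \<omega> \<bullet> B k \<omega>) + (\<integral>v. ek k v \<partial>N) + expectation (\<lambda>\<omega>. (norm (B k \<omega>))\<^sup>2)" for k
  proof -
    have "(\<integral>v. ek k v \<partial>N) = (\<integral>v. 2 * (expectation (\<lambda>\<omega>. \<phi>D v \<omega> \<bullet> A v \<omega>) + expectation (\<lambda>\<omega>. \<phi>D v \<omega> \<bullet> B k \<omega>)) \<partial>N)"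
      by (rule Bochner_Integration.integral_cong) (use \<phi>A_i \<phi>B_i in \<open>auto simp: ek_def spN inner_add_right\<close>)
    also have "\<dots> = 2 * ((\<integral>v. expectation (\<lambda>\<omega>. \<phi>D v \<omega> \<bullet> A v \<omega>) \<partial>N) + (\<integral>v. expectation (\<lambda>\<omega>. \<phi>D v \<omega> \<bullet> B k \<omega>) \<partial>N))"
      using P.integrable_fst[OF A\<phi>i] P.integrable_fst[OF Bj[of k]] by simp
    finally show ?thesis
      unfolding norm_add_power2
      using Ati B2i[of k] integrable_inner_of_power2[OF AM BM Ati B2i[of k]] EAt EAB[of k] ns by simp
  qed
  \<comment> \<open>Tested at time \<open>s\<close>, where the noise has not started: the drift
    integral runs over a null set, and \<open>u s\<close> and \<open>A s\<close> agree on
    \<open>D s\<close>.\<close>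
  have A0_lim: "(\<lambda>k. expectation (\<lambda>\<omega>. A0 \<omega> \<bullet> B k \<omega>)) \<longlonglongrightarrow> 0"
  proof -
    have "(\<integral>v. indicator {..s} v *\<^sub>R \<phi>D v \<omega> \<partial>N) = 0" for \<omega>
    proof (rule integral_eq_zero_AE)
      have "AE v in lborel. v \<noteq> s" by (rule AE_lborel_singleton)
      then have "AE v in N. v \<noteq> s" unfolding N_def by (subst AE_restrict_space_iff) auto
      then show "AE v in N. indicator {..s} v *\<^sub>R \<phi>D v \<omega> = 0"
        by eventually_elim (auto simp: \<phi>D_def split: split_indicator)
    qed
    then have zero: "A0 \<omega> \<bullet> (u s \<omega> - A s \<omega>) = 0" for \<omega>
      by (auto simp: A_def A0_def split: split_indicator)
    have "(\<lambda>k. expectation (\<lambda>\<omega>. A0 \<omega> \<bullet> B k \<omega>)) \<longlonglongrightarrow> expectation (\<lambda>\<omega>. A0 \<omega> \<bullet> (u s \<omega> - A s \<omega>))"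
      by (rule weak[OF order_refl st A0F A0b]) (simp add: A0_def)
    then show ?thesis unfolding zero by simp
  qed
  \<comment> \<open>The test vector is the killed solution itself, so that
    \<open>\<zeta> \<bullet> (u t - A t)\<close> is \<open>|\<zeta>|^2\<close> minus a term in
    \<open>A t\<close>, and testing \<open>A t + B k\<close> returns \<open>nt\<close>.\<close>
  define \<zeta> where "\<zeta> \<omega> = indicator (D t) \<omega> *\<^sub>R u t \<omega>" for \<omega>
  have \<zeta>F: "\<zeta> \<in> borel_measurable (F t)"
  proof -
    have [measurable]: "D t \<in> sets (F t)" "u t \<in> borel_measurable (F t)" using D u st by auto
    show ?thesis unfolding \<zeta>_def by measurable
  qed
  have [measurable]: "\<zeta> \<in> borel_measurable M" by (rule borel_measurable_F[OF \<zeta>F]) (use ast in simp)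
  have \<zeta>b: "norm (\<zeta> \<omega>) \<le> K" for \<omega> using u_bound[of t \<omega>] K st by (auto simp: \<zeta>_def split: split_indicator)
  have \<zeta>i: "integrable M (\<lambda>\<omega>. (norm (\<zeta> \<omega>))\<^sup>2)"
    by (rule bi[of _ "K\<^sup>2"]) (use \<zeta>b in \<open>auto intro!: power_mono\<close>)
  have nt: "expectation (\<lambda>\<omega>. (norm (\<zeta> \<omega>))\<^sup>2) = nt"
    unfolding nt_def \<zeta>_def by (rule Bochner_Integration.integral_cong) (auto split: split_indicator)
  have \<zeta>lim: "(\<lambda>k. expectation (\<lambda>\<omega>. \<zeta> \<omega> \<bullet> (A t \<omega> + B k \<omega>))) \<longlonglongrightarrow> nt"
  proof -
    have iA: "integrable M (\<lambda>\<omega>. \<zeta> \<omega> \<bullet> A t \<omega>)" by (rule bi[of _ "K * C"]) (measurable, rule inner_b[OF \<zeta>b Ab])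
    have iB: "integrable M (\<lambda>\<omega>. \<zeta> \<omega> \<bullet> B k \<omega>)" for k by (rule integrable_inner_of_power2[OF _ BM \<zeta>i B2i]) measurable
    have "\<zeta> \<omega> \<bullet> (u t \<omega> - A t \<omega>) = (norm (\<zeta> \<omega>))\<^sup>2 - \<zeta> \<omega> \<bullet> A t \<omega>" for \<omega>
      by (auto simp: \<zeta>_def inner_diff_right power2_norm_eq_inner split: split_indicator)
    then have "expectation (\<lambda>\<omega>. \<zeta> \<omega> \<bullet> (u t \<omega> - A t \<omega>)) = nt - expectation (\<lambda>\<omega>. \<zeta> \<omega> \<bullet> A t \<omega>)"
      using iA \<zeta>i nt by simp
    then have "(\<lambda>k. expectation (\<lambda>\<omega>. \<zeta> \<omega> \<bullet> A t \<omega>) + expectation (\<lambda>\<omega>. \<zeta> \<omega> \<bullet> B k \<omega>)) \<longlonglongrightarrow>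
      expectation (\<lambda>\<omega>. \<zeta> \<omega> \<bullet> A t \<omega>) + (nt - expectation (\<lambda>\<omega>. \<zeta> \<omega> \<bullet> A t \<omega>))"
      using weak[OF st order_refl \<zeta>F \<zeta>b] by (intro tendsto_intros) (simp add: \<zeta>_def)
    then show ?thesis using iA iB by (simp add: inner_add_right)
  qed
  (* Only weak limits of B are available, so n t is recovered by testing A t + B k against \<zeta>. *)
  have AMGM: "2 * expectation (\<lambda>\<omega>. \<zeta> \<omega> \<bullet> (A t \<omega> + B k \<omega>)) \<le> nt + expectation (\<lambda>\<omega>. (norm (A t \<omega> + B k \<omega>))\<^sup>2)" for k
  proof -
    have Yi: "integrable M (\<lambda>\<omega>. (norm (A t \<omega> + B k \<omega>))\<^sup>2)"
      by (rule integrable_norm_add_power2[OF AM BM Ati B2i])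
    have "expectation (\<lambda>\<omega>. 2 * (\<zeta> \<omega> \<bullet> (A t \<omega> + B k \<omega>))) \<le> expectation (\<lambda>\<omega>. (norm (\<zeta> \<omega>))\<^sup>2 + (norm (A t \<omega> + B k \<omega>))\<^sup>2)"
    proof (rule integral_mono)
      show "integrable M (\<lambda>\<omega>. 2 * (\<zeta> \<omega> \<bullet> (A t \<omega> + B k \<omega>)))"
        by (intro integrable_mult_right integrable_inner_of_power2[OF _ _ \<zeta>i Yi]) measurable
      show "2 * (x \<bullet> y) \<le> (norm x)\<^sup>2 + (norm y)\<^sup>2" for x y :: "complex ^ 'd"
        using zero_le_power2[of "norm (x - y)"] by (simp add: power2_norm_eq_inner inner_diff_left inner_diff_right inner_commute)
    qed (use \<zeta>i Yi in auto)
    then show ?thesis using \<zeta>i Yi nt by simp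
  qed
  \<comment> \<open>The second moment of \<open>B k\<close> has only an upper limit, whence
    \<open>\<eta>\<close>; every other term converges. One of the two copies of \<open>nt\<close>
    cancels.\<close>
  have fin: "2 * nt \<le> nt + (ns + (\<integral>v. e1 v \<partial>N) + (Vr + \<eta>))" if \<eta>: "0 < \<eta>" for \<eta>
  proof (rule tendsto_le)
    show "(\<lambda>k. 2 * expectation (\<lambda>\<omega>. \<zeta> \<omega> \<bullet> (A t \<omega> + B k \<omega>))) \<longlonglongrightarrow> 2 * nt" using \<zeta>lim by (intro tendsto_intros)
    have "(\<lambda>k. nt + (ns + 2 * expectation (\<lambda>\<omega>. A0 \<omega> \<bullet> B k \<omega>) + (\<integral>v. ek k v \<partial>N) + (Vr + \<eta>))) \<longlonglongrightarrow>
      nt + (ns + 2 * 0 + (\<integral>v. e1 v \<partial>N) + (Vr + \<eta>))"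
      using A0_lim ek_conv by (intro tendsto_intros)
    then show "(\<lambda>k. nt + (ns + 2 * expectation (\<lambda>\<omega>. A0 \<omega> \<bullet> B k \<omega>) + (\<integral>v. ek k v \<partial>N) + (Vr + \<eta>))) \<longlonglongrightarrow>
      nt + (ns + (\<integral>v. e1 v \<partial>N) + (Vr + \<eta>))" by simp
    show "\<forall>\<^sub>F k in sequentially. 2 * expectation (\<lambda>\<omega>. \<zeta> \<omega> \<bullet> (A t \<omega> + B k \<omega>)) \<le>
      nt + (ns + 2 * expectation (\<lambda>\<omega>. A0 \<omega> \<bullet> B k \<omega>) + (\<integral>v. ek k v \<partial>N) + (Vr + \<eta>))"
      using limsup[OF \<eta>]
    proof eventually_elim
      case (elim k)
      then show ?case using AMGM[of k] EY[of k] by simp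
    qed
  qed simp
  then have "nt \<le> (ns + (\<integral>v. e1 v \<partial>N) + Vr) + \<eta>" if "0 < \<eta>" for \<eta> using fin[OF that] by simp
  then have main: "nt \<le> ns + (\<integral>v. e1 v \<partial>N) + Vr" by (rule field_le_epsilon)
  have "(\<integral>v. e1 v \<partial>N) + Vr = (\<integral>v. e1 v + e2 v \<partial>N)" unfolding Vr_def using e1_int e2_int by simp
  also have "(\<integral>v. e1 v + e2 v \<partial>N) \<le> (\<integral>v. e0 \<partial>N)"
  proof (rule integral_mono)
    fix v assume v: "v \<in> space N"
    then have v': "v \<in> {s..t}" "s \<le> v" "v \<le> t" by (auto simp: spN)
    have [measurable]: "\<phi>D v \<in> borel_measurable M" "u v \<in> borel_measurable M" "hh v \<in> borel_measurable M"
      using \<phi>DM v' uM measurable_compose[OF measurable_Pair1'[OF v] hhm] by auto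
    have ui: "integrable M (\<lambda>\<omega>. \<phi>D v \<omega> \<bullet> u v \<omega>)"
    proof (rule bi[of _ "K * K"])
      show "norm (\<phi>D v \<omega> \<bullet> u v \<omega>) \<le> K * K" for \<omega>
        using inner_b[OF \<phi>Db[of v \<omega>] u_bound[OF v'(2,3), of \<omega>]] K by (cases "\<omega> \<in> D v") (auto simp: \<phi>D_def)
    qed measurable
    have "e1 v + e2 v = expectation (\<lambda>\<omega>. 2 * (\<phi>D v \<omega> \<bullet> u v \<omega>) + hh v \<omega>)"
      unfolding e1_def e2_def using ui bi[of "hh v" "K\<^sup>2"] hhb by simp
    also have "\<dots> = expectation (\<lambda>\<omega>. indicator (D v) \<omega> * (2 * (\<phi> v \<omega> \<bullet> u v \<omega>) + (norm (h v \<omega>))\<^sup>2))"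
      by (rule Bochner_Integration.integral_cong) (use v' in \<open>auto simp: \<phi>D_def hh_def split: split_indicator\<close>)
    also have "\<dots> \<le> e0" by (rule e0[OF v'(2,3)])
    finally show "e1 v + e2 v \<le> e0" .
  qed (use e1_int e2_int in auto)
  also have "(\<integral>v. e0 \<partial>N) = e0 * (t - s)"
    using ast by (simp add: N_def space_restrict_space measure_restrict_space)
  finally show ?thesis using main unfolding nt_def ns_def by linarith
qed

end

section \<open>A comparison principle with delay\<close>

text \<open>
  The function \<open>n\<close> may jump downwards.  The one-sided Lipschitz estimate implied by the first
  assumption is enough for a first crossing argument.
\<close>

lemma delay_comparison:
  fixes n e A B :: "real \<Rightarrow> real"
  assumes mono: "\<And>s t e0. a \<le> s \<Longrightarrow> s < t \<Longrightarrow> t \<le> b \<Longrightarrow> (\<And>r. s \<le> r \<Longrightarrow> r \<le> t \<Longrightarrow> e r \<le> e0) \<Longrightarrow>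
      n t \<le> n s + e0 * (t - s)"
    and e: "\<And>r v. a \<le> r \<Longrightarrow> r \<le> b \<Longrightarrow> S \<le> v \<Longrightarrow> (\<And>r'. a \<le> r' \<Longrightarrow> r' \<le> r \<Longrightarrow> n r' \<le> v) \<Longrightarrow>
      e r \<le> A r * n r + B r * v"
    and AB: "\<And>r. a \<le> r \<Longrightarrow> r \<le> b \<Longrightarrow> \<bar>A r\<bar> \<le> L" "\<And>r. a \<le> r \<Longrightarrow> r \<le> b \<Longrightarrow> 0 \<le> B r"
      "\<And>r. a \<le> r \<Longrightarrow> r \<le> b \<Longrightarrow> B r \<le> L" "\<And>r. a \<le> r \<Longrightarrow> r \<le> b \<Longrightarrow> A r + B r \<le> c"
    and n: "\<And>r. a \<le> r \<Longrightarrow> r \<le> b \<Longrightarrow> 0 \<le> n r" "\<And>r. a \<le> r \<Longrightarrow> r \<le> b \<Longrightarrow> n r \<le> K"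
    and S: "0 \<le> S" "n a \<le> S" and c: "c \<le> C" "0 \<le> C" and t: "a \<le> t" "t \<le> b"
  shows "n t \<le> S * exp (C * (t - a))"
proof -
  have L: "0 \<le> L" using order_trans[OF abs_ge_zero AB(1)[OF t]] .
  \<comment> \<open>Crude bound for \<open>e\<close> on all of \<open>[a,b]\<close>, from
    \<open>v = max S K\<close>. It limits how fast \<open>n\<close> can rise; the summand
    \<open>1\<close> makes it positive for later divisions.\<close>
  define \<Lambda> where "\<Lambda> = L * max K 0 + L * max S K + 1"
  have \<Lambda>: "0 < \<Lambda>" using L S by (auto simp: \<Lambda>_def intro!: add_nonneg_pos add_nonneg_nonneg mult_nonneg_nonneg)
  have lip: "n t \<le> n s + \<Lambda> * (t - s)" if st: "a \<le> s" "s \<le> t" "t \<le> b" for s t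
  proof (cases "s = t")
    case False
    show ?thesis
    proof (rule mono)
      fix r assume "s \<le> r" "r \<le> t"
      then have r: "a \<le> r" "r \<le> b" using st by auto
      have "e r \<le> A r * n r + B r * max S K"
        by (rule e[OF r]) (use n(2) r in \<open>auto simp: le_max_iff_disj\<close>)
      also have "\<dots> \<le> L * max K 0 + L * max S K"
      proof (rule add_mono)
        have "A r * n r \<le> L * n r" using AB(1)[OF r] n(1)[OF r] by (intro mult_right_mono) auto
        also have "\<dots> \<le> L * max K 0" using n(2)[OF r] L by (intro mult_left_mono) auto
        finally show "A r * n r \<le> L * max K 0" .
        show "B r * max S K \<le> L * max S K" using AB(3)[OF r] S by (intro mult_right_mono) auto
      qed
      finally show "e r \<le> \<Lambda>" by (simp add: \<Lambda>_def)
    qed (use st False in auto)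
  qed simp
  \<comment> \<open>Raising initial value and rate by \<open>\<epsilon>\<close> gives a strict
    barrier: at a crossing the surplus \<open>\<epsilon> * w0\<close> would have to be outweighed by
    an error proportional to the length of a short interval.\<close>
  have strict: "n t \<le> (S + \<epsilon>) * exp ((C + \<epsilon>) * (t - a))" if \<epsilon>: "0 < \<epsilon>" and t: "a \<le> t" "t \<le> b" for \<epsilon> t
  proof (rule ccontr)
    define w where "w t = (S + \<epsilon>) * exp ((C + \<epsilon>) * (t - a))" for t
    assume "\<not> ?thesis"
    then have bad: "w t < n t" by (simp add: w_def)
    define X where "X = {r. a \<le> r \<and> r \<le> b \<and> w r < n r}"
    have tX: "t \<in> X" using t bad by (simp add: X_def)
    have bb: "bdd_below X" by (rule bdd_belowI[of _ a]) (simp add: X_def)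
    \<comment> \<open>\<open>n\<close> may be discontinuous, so the infimum need not itself be a
      crossing time. The estimates run between \<open>t0\<close> and a crossing time
      \<open>t'\<close> shortly after it.\<close>
    define t0 where "t0 = Inf X"
    have t0: "a \<le> t0" "t0 \<le> t"
      unfolding t0_def using tX bb by (auto intro!: cInf_greatest cInf_lower simp: X_def)
    \<comment> \<open>Here \<open>C \<ge> 0\<close> matters. The delayed term sees the whole past,
      and only a nondecreasing barrier bounds the past by its present value; for negative
      \<open>c\<close> the argument therefore gives a constant bound and no decay.\<close>
    have w_mono: "w r \<le> w r'" if "r \<le> r'" for r r'
      unfolding w_def using that S \<epsilon> c by (intro mult_left_mono) (auto intro!: mult_left_mono)
    have wS: "S + \<epsilon> \<le> w r" if "a \<le> r" for r
      using w_mono[OF that] by (simp add: w_def)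
    have before: "n r \<le> w r" if r: "a \<le> r" "r < t0" for r
    proof (rule ccontr)
      assume "\<not> n r \<le> w r"
      then have "r \<in> X" using r t0 t by (simp add: X_def)
      then show False using cInf_lower[OF _ bb, of r] r by (simp add: t0_def)
    qed
    define w0 where "w0 = w t0"
    have w0: "0 < w0" "S \<le> w0" using wS[OF t0(1)] S \<epsilon> by (auto simp: w0_def)
    \<comment> \<open>No upward jump at \<open>t0\<close>: the value exceeds those just before it,
      which lie below the barrier, by at most \<open>\<Lambda>\<close> times the distance.\<close>
    have at: "n t0 \<le> w0"
    proof (cases "t0 = a")
      case True
      then show ?thesis using S w0 wS[of a] \<epsilon> by (simp add: w0_def)
    next
      case False
      show ?thesis
      proof (rule field_le_epsilon)
        fix \<eta> :: real assume \<eta>: "0 < \<eta>"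
        define r where "r = max a (t0 - \<eta> / \<Lambda>)"
        have "0 < \<eta> / \<Lambda>" using \<eta> \<Lambda> by simp
        then have r: "a \<le> r" "r < t0" "t0 - r \<le> \<eta> / \<Lambda>" using False t0 by (auto simp: r_def)
        have "n t0 \<le> n r + \<Lambda> * (t0 - r)" using lip[of r t0] r t0 t by simp
        also have "\<dots> \<le> w0 + \<eta>"
        proof (rule add_mono)
          show "n r \<le> w0" using order_trans[OF before[OF r(1,2)] w_mono[of r t0]] r by (simp add: w0_def)
          show "\<Lambda> * (t0 - r) \<le> \<eta>" using r(3) \<Lambda> by (simp add: field_simps)
        qed
        finally show "n t0 \<le> w0 + \<eta>" .
      qed
    qed
    \<comment> \<open>Small enough that the error \<open>2 * L * \<Lambda> * d\<close> cannot reach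
      \<open>\<epsilon> * w0\<close> for \<open>d < d0\<close>.\<close>
    define d0 where "d0 = \<epsilon> * w0 / (2 * L * \<Lambda> + 1)"
    have d0: "0 < d0" "d0 * (2 * L * \<Lambda> + 1) = \<epsilon> * w0"
      using \<epsilon> w0 L \<Lambda> by (auto simp: d0_def intro!: divide_pos_pos mult_pos_pos add_nonneg_pos
        simp: add_nonneg_eq_0_iff)
    obtain t' where t': "t' \<in> X" "t' < t0 + d0"
      using cInf_lessD[of X "t0 + d0"] tX d0 by (auto simp: t0_def)
    have t'b: "a \<le> t'" "t' \<le> b" "w t' < n t'" using t' by (auto simp: X_def)
    have "t0 \<le> t'" using cInf_lower[OF t'(1) bb] by (simp add: t0_def)
    moreover have "t' \<noteq> t0" using t'b at by (auto simp: w0_def)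
    ultimately have lt: "t0 < t'" by simp
    define d where "d = t' - t0"
    have d: "0 < d" "d < d0" using lt t' by (auto simp: d_def)
    have eb: "e r \<le> c * w0 + 2 * L * \<Lambda> * d" if r: "t0 \<le> r" "r \<le> t'" for r
    proof -
      have rb: "a \<le> r" "r \<le> b" using r t0 t'b by auto
      have up: "n r' \<le> w0 + \<Lambda> * d" if r': "a \<le> r'" "r' \<le> r" for r'
      proof (cases "r' < t0")
        case True
        have "n r' \<le> w0" using order_trans[OF before[OF r'(1) True] w_mono[of r' t0]] True by (simp add: w0_def)
        then show ?thesis using \<Lambda> d by (intro add_increasing2) auto
      next
        case False
        have "n r' \<le> n t0 + \<Lambda> * (r' - t0)" using lip[of t0 r'] False t0 r' rb by simp
        also have "\<dots> \<le> w0 + \<Lambda> * d" using at r' r \<Lambda> by (intro add_mono mult_left_mono) (auto simp: d_def)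
        finally show ?thesis .
      qed
      \<comment> \<open>\<open>n\<close> may drop after \<open>t0\<close>, but not far: it exceeds
        the barrier again at \<open>t'\<close>, and it can climb back only with slope
        \<open>\<Lambda>\<close>.\<close>
      have low: "w0 - \<Lambda> * d \<le> n r"
      proof -
        have "w0 \<le> n t'" using w_mono[of t0 t'] lt t'b by (simp add: w0_def)
        also have "\<dots> \<le> n r + \<Lambda> * (t' - r)" using lip[of r t'] r rb t'b by simp
        also have "\<dots> \<le> n r + \<Lambda> * d" using r \<Lambda> by (intro add_left_mono mult_left_mono) (auto simp: d_def)
        finally show ?thesis by simp
      qed
      have "e r \<le> A r * n r + B r * (w0 + \<Lambda> * d)"
        by (rule e[OF rb]) (use w0 \<Lambda> d up in \<open>auto intro: add_increasing2\<close>)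
      also have "\<dots> = (A r + B r) * w0 + (A r * (n r - w0) + B r * (\<Lambda> * d))" by (simp add: algebra_simps)
      also have "\<dots> \<le> c * w0 + (L * (\<Lambda> * d) + L * (\<Lambda> * d))"
      proof (intro add_mono)
        show "(A r + B r) * w0 \<le> c * w0" using AB(4)[OF rb] w0 by (intro mult_right_mono) auto
        \<comment> \<open>\<open>A r\<close> may have either sign, so both the upper and the lower
          bound on \<open>n r\<close> are needed.\<close>
        have "A r * (n r - w0) \<le> \<bar>A r\<bar> * \<bar>n r - w0\<bar>" using abs_ge_self[of "A r * (n r - w0)"] by (simp add: abs_mult)
        also have "\<dots> \<le> L * (\<Lambda> * d)"
          using AB(1)[OF rb] low up[OF rb(1) order_refl] L by (intro mult_mono) auto
        finally show "A r * (n r - w0) \<le> L * (\<Lambda> * d)" .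
        show "B r * (\<Lambda> * d) \<le> L * (\<Lambda> * d)" using AB(3)[OF rb] \<Lambda> d by (intro mult_right_mono) auto
      qed
      finally show ?thesis by simp
    qed
    have "n t' \<le> n t0 + (c * w0 + 2 * L * \<Lambda> * d) * (t' - t0)"
      by (rule mono) (use t0 lt t'b eb in auto)
    then have "n t' \<le> w0 + (c * w0 + 2 * L * \<Lambda> * d) * d" using at by (simp add: d_def)
    moreover have "w0 * (1 + (C + \<epsilon>) * d) \<le> w t'"
    proof -
      have "w t' = w0 * exp ((C + \<epsilon>) * d)"
        by (simp add: w_def w0_def d_def algebra_simps flip: exp_add)
      moreover have "1 + (C + \<epsilon>) * d \<le> exp ((C + \<epsilon>) * d)" by (rule exp_ge_add_one_self)
      ultimately show ?thesis using w0 by simp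
    qed
    ultimately have "w0 * (C + \<epsilon>) * d < (c * w0 + 2 * L * \<Lambda> * d) * d"
      using t'b(3) by (simp add: algebra_simps)
    then have "w0 * (C + \<epsilon>) < c * w0 + 2 * L * \<Lambda> * d" using d by simp
    moreover have "c * w0 \<le> C * w0" using c w0 by simp
    ultimately have "\<epsilon> * w0 < 2 * L * \<Lambda> * d" by (simp add: algebra_simps)
    also have "\<dots> \<le> (2 * L * \<Lambda> + 1) * d" using d by (simp add: algebra_simps)
    also have "\<dots> \<le> (2 * L * \<Lambda> + 1) * d0" using d L \<Lambda> by (intro mult_left_mono) auto
    finally show False using d0 by (simp add: mult.commute)
  qed
  have "((\<lambda>\<epsilon>. (S + \<epsilon>) * exp ((C + \<epsilon>) * (t - a))) \<longlongrightarrow> (S + 0) * exp ((C + 0) * (t - a))) (at_right 0)"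
    by (intro tendsto_intros)
  then have "((\<lambda>\<epsilon>. (S + \<epsilon>) * exp ((C + \<epsilon>) * (t - a))) \<longlongrightarrow> S * exp (C * (t - a))) (at_right 0)" by simp
  then show ?thesis
    by (rule tendsto_lowerbound)
      (auto intro!: eventually_at_rightI[of 0 1] strict t)
qed

section \<open>The mean square estimate\<close>

lemma inner_eq_Re_cinner: "x \<bullet> y = Re (cinner x y)"
  by (simp add: inner_vec_def cinner_def inner_complex_def)

text \<open>Evaluation at a point is continuous for the supremum norm, hence Borel, and on
  \<open>[t1,t2]\<close> the constant extension does not change the path.\<close>

lemma Lp_initial_measurable:
  assumes L: "Lp_initial M G p t1 t2 \<psi>" and sp: "space G = space M" and \<theta>: "\<theta> \<in> {t1..t2}"
  shows "\<psi> \<theta> \<in> borel_measurable G"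
proof -
  let ?E = "\<lambda>\<omega>. Bcontfun (ext_cont (\<lambda>u. \<psi> u \<omega>) t1 t2)"
  have "continuous_on UNIV (\<lambda>f. apply_bcontfun f \<theta> :: complex ^ 'b)"
    unfolding continuous_on_iff using dist_fun_lt_imp_dist_val_lt by blast
  then have "(\<lambda>f. apply_bcontfun f \<theta> :: complex ^ 'b) \<in> borel_measurable borel"
    by (rule borel_measurable_continuous_onI)
  moreover have "?E \<in> borel_measurable G" using L by (simp add: Lp_initial_def)
  ultimately have "(\<lambda>\<omega>. apply_bcontfun (?E \<omega>) \<theta>) \<in> borel_measurable G"
    by (rule measurable_compose[rotated])
  moreover have "apply_bcontfun (?E \<omega>) \<theta> = \<psi> \<theta> \<omega>" if "\<omega> \<in> space G" for \<omega>
  proof -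
    have "continuous_on (cbox t1 t2) (\<lambda>u. \<psi> u \<omega>)" using L that sp by (simp add: Lp_initial_def)
    then obtain g where g: "\<And>u. u \<in> cbox t1 t2 \<Longrightarrow> apply_bcontfun g u = \<psi> u \<omega>"
      "\<And>u. apply_bcontfun g u = \<psi> (clamp t1 t2 u) \<omega>"
      by (rule continuous_on_cbox_bcontfunE) (rule that; blast)
    have "apply_bcontfun g = ext_cont (\<lambda>u. \<psi> u \<omega>) t1 t2" using g(2) by (simp add: ext_cont_def fun_eq_iff)
    then show ?thesis using g(1)[of \<theta>] \<theta> by (metis apply_bcontfun_inverse cbox_interval)
  qed
  ultimately show ?thesis by (rule measurable_cong[THEN iffD1, rotated]) 
qed

section \<open>Survival events of continuous paths\<close>

definition bounded_until ::
  "'w set \<Rightarrow> (real \<Rightarrow> 'w \<Rightarrow> 'e :: real_normed_vector) \<Rightarrow> real \<Rightarrow> real \<Rightarrow> real \<Rightarrow> 'w set"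
where
  "bounded_until S z a0 K r = {\<omega>\<in>S. \<forall>v\<in>{a0..r}. norm (z v \<omega>) \<le> K}"

lemma bounded_until_mono: "r \<le> r' \<Longrightarrow> bounded_until S z a0 K r' \<subseteq> bounded_until S z a0 K r"
  by (auto simp: bounded_until_def)

text \<open>Continuity reduces the bound to a countable dense set of times. The variables
  \<open>z'\<close> are needed because on the initial segment the solutions are measurable only
  through the initial functions, with which they agree on \<open>S\<close>.\<close>

lemma bounded_until_sets:
  fixes z :: "real \<Rightarrow> 'w \<Rightarrow> 'e :: {real_normed_vector, second_countable_topology}"
  assumes S: "S \<in> sets G"
    and cont: "\<And>\<omega>. \<omega> \<in> S \<Longrightarrow> continuous_on {a0..r} (\<lambda>v. z v \<omega>)"
    and meas: "\<And>v. v \<in> {a0..r} \<Longrightarrow> \<exists>z'. z' \<in> borel_measurable G \<and> (\<forall>\<omega>\<in>S. z v \<omega> = z' \<omega>)"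
  shows "bounded_until S z a0 K r \<in> sets G"
proof -
  obtain T where T: "countable T" "T \<subseteq> {a0..r}" "{a0..r} \<subseteq> closure T" by (rule separable)
  have clT: "closure T \<subseteq> {a0..r}" using T(2) by (simp add: closure_minimal)
  obtain z' where "\<forall>v\<in>{a0..r}. z' v \<in> borel_measurable G \<and> (\<forall>\<omega>\<in>S. z v \<omega> = z' v \<omega>)"
    using bchoice[of "{a0..r}" "\<lambda>v z'. z' \<in> borel_measurable G \<and> (\<forall>\<omega>\<in>S. z v \<omega> = z' \<omega>)"] meas by blast
  then have z': "\<And>v. v \<in> {a0..r} \<Longrightarrow> z' v \<in> borel_measurable G"
    "\<And>v \<omega>. v \<in> {a0..r} \<Longrightarrow> \<omega> \<in> S \<Longrightarrow> z v \<omega> = z' v \<omega>" by blast+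
  have "bounded_until S z a0 K r = S \<inter> (\<Inter>v\<in>T. {\<omega>\<in>space G. norm (z' v \<omega>) \<le> K})" if "T \<noteq> {}"
  proof safe
    fix \<omega> v assume \<omega>: "\<omega> \<in> bounded_until S z a0 K r" and "v \<in> T"
    then have v: "v \<in> {a0..r}" using T(2) by blast
    have "norm (z v \<omega>) \<le> K" "\<omega> \<in> S" using \<omega> v unfolding bounded_until_def by blast+
    then show "norm (z' v \<omega>) \<le> K" using z'(2)[OF v, of \<omega>] by simp
  next
    fix \<omega> assume \<omega>: "\<omega> \<in> S" "\<omega> \<in> (\<Inter>v\<in>T. {\<omega>\<in>space G. norm (z' v \<omega>) \<le> K})"
    have "norm (z v \<omega>) \<le> K" if v: "v \<in> {a0..r}" for v
    proof (rule continuous_on_closure_norm_le[of T "\<lambda>v. z v \<omega>"])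
      show "continuous_on (closure T) (\<lambda>v. z v \<omega>)" using cont[OF \<omega>(1)] clT by (rule continuous_on_subset)
      show "\<forall>v\<in>T. norm (z v \<omega>) \<le> K"
      proof
        fix v assume v: "v \<in> T"
        then have "v \<in> {a0..r}" using T(2) by blast
        then show "norm (z v \<omega>) \<le> K" using \<omega> z'(2) v by auto
      qed
      show "v \<in> closure T" using T(3) v by blast
    qed
    then show "\<omega> \<in> bounded_until S z a0 K r" using \<omega>(1) by (simp add: bounded_until_def)
  qed (use sets.sets_into_space[OF S] in \<open>auto simp: bounded_until_def\<close>)
  moreover have "{\<omega>\<in>space G. norm (z' v \<omega>) \<le> K} \<in> sets G" if "v \<in> T" for v
  proof -
    have [measurable]: "z' v \<in> borel_measurable G" using z'(1) T(2) that by blast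
    show ?thesis by measurable
  qed
  ultimately show ?thesis
  proof (cases "T = {}")
    case True
    then have "{a0..r} = {}" using T(3) by simp
    then have "bounded_until S z a0 K r = S" by (simp add: bounded_until_def)
    then show ?thesis using S by simp
  qed (use S T(1) in \<open>auto intro!: sets.Int sets.countable_INT'\<close>)
qed

text \<open>Survival is decreasing in \<open>r\<close>, and path continuity makes it
  left-continuous. Thus survival up to \<open>r\<close> means survival up to \<open>s\<close> and up
  to every rational \<open>q < r\<close>, a countable intersection: for each \<open>q\<close>,
  either \<open>r \<le> q\<close> or the path survives up to \<open>q\<close>. Survival up to
  \<open>s\<close> is added for the case \<open>r = s\<close>.\<close>

lemma bounded_until_joint:
  fixes z :: "real \<Rightarrow> 'w \<Rightarrow> 'e :: real_normed_vector"
  assumes D: "\<And>r. r \<in> {s..t} \<Longrightarrow> bounded_until S z a0 K r \<in> sets M" and st: "a0 \<le> s" "s \<le> t"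
    and cont: "\<And>\<omega>. \<omega> \<in> S \<Longrightarrow> continuous_on {a0..t} (\<lambda>v. z v \<omega>)"
  shows "(\<lambda>(r, \<omega>). indicator (bounded_until S z a0 K r) \<omega> :: real) \<in> borel_measurable (restrict_space borel {s..t} \<Otimes>\<^sub>M M)"
proof -
  let ?D = "bounded_until S z a0 K" and ?N = "restrict_space borel {s..t}"
  define Q where "Q = insert s (\<rat> \<inter> {s..t})"
  have Q: "countable Q" "Q \<noteq> {}" "Q \<subseteq> {s..t}" using st by (auto simp: Q_def countable_rat)
  define E where "E = (\<Inter>q\<in>Q. ({r\<in>{s..t}. r \<le> q} \<times> space M) \<union> ({s..t} \<times> ?D q)) \<inter> ({s..t} \<times> ?D s)"
  have "E \<in> sets (?N \<Otimes>\<^sub>M M)"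
  proof -
    have i: "{s..t} \<in> sets ?N" using sets.top[of ?N] by (simp add: space_restrict_space)
    have "{r\<in>{s..t}. r \<le> q} \<in> sets ?N" for q
    proof -
      have "{r\<in>{s..t}. r \<le> q} = {s..t} \<inter> {..q}" by auto
      then show ?thesis unfolding sets_restrict_space by auto
    qed
    then show ?thesis
      unfolding E_def using i D Q st by (auto intro!: sets.Int sets.countable_INT' sets.Un pair_measureI)
  qed
  moreover have "(r, \<omega>) \<in> E \<longleftrightarrow> \<omega> \<in> ?D r" if r: "r \<in> {s..t}" and \<omega>: "\<omega> \<in> space M" for r \<omega>
  proof
    assume D: "\<omega> \<in> ?D r"
    have "r \<le> q \<or> \<omega> \<in> ?D q" for q
      using bounded_until_mono[of q r S z a0 K] D by (cases "q \<le> r") auto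
    moreover have "\<omega> \<in> ?D s" using bounded_until_mono[of s r S z a0 K] D r by auto
    ultimately show "(r, \<omega>) \<in> E" using r \<omega> by (auto simp: E_def)
  next
    assume *: "(r, \<omega>) \<in> E"
    then have s: "\<omega> \<in> ?D s" by (simp add: E_def)
    then have S: "\<omega> \<in> S" by (simp add: bounded_until_def)
    have less: "norm (z v \<omega>) \<le> K" if v: "a0 \<le> v" "v < r" for v
    proof -
      obtain q where q: "q \<in> \<rat>" "max v s < q" "q < r" if "s < r" using Rats_dense_in_real[of "max v s" r] v by auto
      show ?thesis
      proof (cases "s < r")
        case True
        note q = q[OF this]
        have "q \<in> Q" using q r by (auto simp: Q_def)
        then have "\<omega> \<in> ?D q" using * q by (auto simp: E_def)
        then show ?thesis using v q by (auto simp: bounded_until_def)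
      next
        case False
        then show ?thesis using s v r by (auto simp: bounded_until_def)
      qed
    qed
    \<comment> \<open>The bound is known strictly before \<open>r\<close> and reaches
      \<open>r\<close> by continuity.\<close>
    have "norm (z r \<omega>) \<le> K"
    proof (cases "a0 < r")
      case True
      show ?thesis
      proof (rule continuous_on_closure_norm_le[of "{a0..<r}" "\<lambda>v. z v \<omega>"])
        show "continuous_on (closure {a0..<r}) (\<lambda>v. z v \<omega>)"
          using cont[OF S] r True by (intro continuous_on_subset[OF cont[OF S]]) auto
      qed (use less True in auto)
    next
      case False
      then show ?thesis using s r st by (auto simp: bounded_until_def)
    qed
    then have "norm (z v \<omega>) \<le> K" if "v \<in> {a0..r}" for v
      using less[of v] that by (cases "v = r") auto
    then show "\<omega> \<in> ?D r" using S by (simp add: bounded_until_def)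
  qed
  ultimately have "(\<lambda>x. indicator E x :: real) \<in> borel_measurable (?N \<Otimes>\<^sub>M M)"
    and eq: "\<And>r \<omega>. r \<in> {s..t} \<Longrightarrow> \<omega> \<in> space M \<Longrightarrow> (r, \<omega>) \<in> E \<longleftrightarrow> \<omega> \<in> ?D r" by auto
  then show ?thesis
    by (rule_tac measurable_cong[THEN iffD1, rotated, of "\<lambda>x. indicator E x :: real"])
      (auto simp: space_pair_measure space_restrict_space indicator_def)
qed

section \<open>The difference of two solutions\<close>

locale sdde_pair = wiener_process M F a W
  for M :: "'w measure" and F :: "real \<Rightarrow> 'w measure" and a :: real
    and W :: "real \<Rightarrow> 'w \<Rightarrow> real ^ 'm" +
  fixes b \<tau>0 p :: real and \<tau> \<alpha> \<beta> \<gamma>1 \<gamma>2 :: "real \<Rightarrow> real"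
    and f :: "real \<Rightarrow> complex ^ 'd \<Rightarrow> complex ^ 'd \<Rightarrow> complex ^ 'd"
    and g :: "real \<Rightarrow> complex ^ 'd \<Rightarrow> complex ^ 'd \<Rightarrow> complex ^ 'm ^ 'd"
    and \<xi> \<eta> x y :: "real \<Rightarrow> 'w \<Rightarrow> complex ^ 'd"
  assumes ab: "a < b" and \<tau>0: "0 \<le> \<tau>0"
    and \<tau>: "\<forall>t\<in>{a..b}. 0 \<le> \<tau> t" "\<forall>t\<in>{a..b}. a - \<tau>0 \<le> t - \<tau> t"
    and f_cont: "continuous_on ({a..b} \<times> UNIV \<times> UNIV) (\<lambda>(t, u, v). f t u v)"
    and g_cont: "continuous_on ({a..b} \<times> UNIV \<times> UNIV) (\<lambda>(t, u, v). g t u v)"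
    and SD: "SD a b f g \<alpha> \<beta> \<gamma>1 \<gamma>2"
    and L\<xi>: "Lp_initial M (F a) p (a - \<tau>0) a \<xi>" and L\<eta>: "Lp_initial M (F a) p (a - \<tau>0) a \<eta>"
    and x_sol: "sdde_solution M F W a b \<tau>0 \<tau> f g \<xi> x"
    and y_sol: "sdde_solution M F W a b \<tau>0 \<tau> f g \<eta> y"
begin

definition u :: "real \<Rightarrow> 'w \<Rightarrow> complex ^ 'd" where "u v \<omega> = x v \<omega> - y v \<omega>"
definition \<phi> :: "real \<Rightarrow> 'w \<Rightarrow> complex ^ 'd" where
  "\<phi> v \<omega> = f v (x v \<omega>) (x (v - \<tau> v) \<omega>) - f v (y v \<omega>) (y (v - \<tau> v) \<omega>)"
definition h :: "real \<Rightarrow> 'w \<Rightarrow> complex ^ 'm ^ 'd" where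
  "h v \<omega> = g v (x v \<omega>) (x (v - \<tau> v) \<omega>) - g v (y v \<omega>) (y (v - \<tau> v) \<omega>)"

text \<open>Testing the Lipschitz conditions with a unit vector forces the signs. They are what
  allows the mixed terms to be split by the arithmetic-geometric mean inequality, and what makes the
  delayed coefficient monotone.\<close>

lemma coefficients_nonneg:
  assumes t: "t \<in> {a..b}"
  shows "0 \<le> \<beta> t" "0 \<le> \<gamma>1 t" "0 \<le> \<gamma>2 t"
proof -
  obtain e :: "complex ^ 'd" where e: "norm e = 1" using vector_choose_size[of 1] by auto
  have "norm (f t 0 e - f t 0 0) \<le> \<beta> t * norm (e - 0)"
    and "norm (g t e 0 - g t 0 0) \<le> \<gamma>1 t * norm (e - 0) + \<gamma>2 t * norm (0 - 0 :: complex ^ 'd)"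
    and "norm (g t 0 e - g t 0 0) \<le> \<gamma>1 t * norm (0 - 0 :: complex ^ 'd) + \<gamma>2 t * norm (e - 0)"
    using SD t unfolding SD_def by blast+
  then show "0 \<le> \<beta> t" "0 \<le> \<gamma>1 t" "0 \<le> \<gamma>2 t"
    using e by (simp_all add: order_trans[OF norm_ge_zero])
qed

text \<open>The drift difference passes through \<open>f t Y X'\<close>: the one-sided condition
  handles the change of the current argument, the Lipschitz condition that of the delayed one. The
  mixed terms with \<open>\<beta>\<close> and \<open>\<gamma>1 * \<gamma>2\<close> are split evenly
  between the two squares.\<close>

lemma drift_diffusion_bound:
  assumes t: "t \<in> {a..b}"
  shows "2 * (\<phi> t \<omega> \<bullet> u t \<omega>) + (norm (h t \<omega>))\<^sup>2 \<le>
    (2 * \<alpha> t + \<beta> t + (\<gamma>1 t)\<^sup>2 + \<gamma>1 t * \<gamma>2 t) * (norm (u t \<omega>))\<^sup>2 +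
    (\<beta> t + \<gamma>1 t * \<gamma>2 t + (\<gamma>2 t)\<^sup>2) * (norm (u (t - \<tau> t) \<omega>))\<^sup>2"
proof -
  note nn = coefficients_nonneg[OF t]
  define X Y X' Y' where "X = x t \<omega>" and "Y = y t \<omega>" and "X' = x (t - \<tau> t) \<omega>" and "Y' = y (t - \<tau> t) \<omega>"
  let ?u = "norm (X - Y)" and ?v = "norm (X' - Y')"
  have a1: "Re (cinner (X - Y) (f t X X' - f t Y X')) \<le> \<alpha> t * ?u\<^sup>2"
    and a2: "norm (f t Y X' - f t Y Y') \<le> \<beta> t * ?v"
    and a3: "norm (g t X X' - g t Y Y') \<le> \<gamma>1 t * ?u + \<gamma>2 t * ?v"
    using SD t unfolding SD_def by blast+
  have AM: "2 * (?u * ?v) \<le> ?u\<^sup>2 + ?v\<^sup>2" using sum_squares_bound[of ?u ?v] by simp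
  have "(X - Y) \<bullet> (f t Y X' - f t Y Y') \<le> ?u * norm (f t Y X' - f t Y Y')"
    by (rule norm_cauchy_schwarz)
  also have "\<dots> \<le> ?u * (\<beta> t * ?v)" using a2 by (intro mult_left_mono) auto
  finally have i: "(X - Y) \<bullet> (f t X X' - f t Y Y') \<le> \<alpha> t * ?u\<^sup>2 + \<beta> t * (?u * ?v)"
    using a1 inner_add_right[of "X - Y" "f t X X' - f t Y X'" "f t Y X' - f t Y Y'"]
    by (simp add: inner_eq_Re_cinner[symmetric] algebra_simps)
  have "(norm (g t X X' - g t Y Y'))\<^sup>2 \<le> (\<gamma>1 t * ?u + \<gamma>2 t * ?v)\<^sup>2"
    using a3 by (intro power_mono) auto
  also have "\<dots> = (\<gamma>1 t)\<^sup>2 * ?u\<^sup>2 + \<gamma>1 t * \<gamma>2 t * (2 * (?u * ?v)) + (\<gamma>2 t)\<^sup>2 * ?v\<^sup>2"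
    by (simp add: power2_eq_square algebra_simps)
  finally have "2 * ((X - Y) \<bullet> (f t X X' - f t Y Y')) + (norm (g t X X' - g t Y Y'))\<^sup>2 \<le>
    2 * \<alpha> t * ?u\<^sup>2 + \<beta> t * (2 * (?u * ?v)) + ((\<gamma>1 t)\<^sup>2 * ?u\<^sup>2 + \<gamma>1 t * \<gamma>2 t * (2 * (?u * ?v)) + (\<gamma>2 t)\<^sup>2 * ?v\<^sup>2)"
    using i by simp
  also have "\<dots> \<le> 2 * \<alpha> t * ?u\<^sup>2 + \<beta> t * (?u\<^sup>2 + ?v\<^sup>2) +
    ((\<gamma>1 t)\<^sup>2 * ?u\<^sup>2 + \<gamma>1 t * \<gamma>2 t * (?u\<^sup>2 + ?v\<^sup>2) + (\<gamma>2 t)\<^sup>2 * ?v\<^sup>2)"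
    using nn AM by (intro add_mono mult_left_mono order_refl) auto
  finally show ?thesis
    unfolding \<phi>_def h_def u_def X_def[symmetric] Y_def[symmetric] X'_def[symmetric] Y'_def[symmetric]
    by (simp add: inner_commute algebra_simps)
qed

text \<open>The exceptional null set belongs to \<open>F a\<close>, so restricting to good paths
  keeps the survival events adapted.\<close>

lemma good_paths:
  obtains \<Omega> where "\<Omega> \<in> sets (F a)" "AE \<omega> in M. \<omega> \<in> \<Omega>"
    "\<And>\<omega>. \<omega> \<in> \<Omega> \<Longrightarrow> continuous_on {a - \<tau>0..b} (\<lambda>t. x t \<omega>)"
    "\<And>\<omega>. \<omega> \<in> \<Omega> \<Longrightarrow> continuous_on {a - \<tau>0..b} (\<lambda>t. y t \<omega>)"
    "\<And>\<omega> t. \<omega> \<in> \<Omega> \<Longrightarrow> t \<in> {a - \<tau>0..a} \<Longrightarrow> x t \<omega> = \<xi> t \<omega> \<and> y t \<omega> = \<eta> t \<omega>"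
proof -
  define P where "P \<omega> \<longleftrightarrow> continuous_on {a - \<tau>0..b} (\<lambda>t. x t \<omega>) \<and> continuous_on {a - \<tau>0..b} (\<lambda>t. y t \<omega>) \<and>
    (\<forall>t\<in>{a - \<tau>0..a}. x t \<omega> = \<xi> t \<omega>) \<and> (\<forall>t\<in>{a - \<tau>0..a}. y t \<omega> = \<eta> t \<omega>)" for \<omega>
  have "AE \<omega> in M. P \<omega>"
    using x_sol y_sol unfolding P_def sdde_solution_def by (auto intro: AE_conjI)
  then obtain N where N: "\<And>\<omega>. \<omega> \<in> space M - N \<Longrightarrow> P \<omega>" "N \<in> null_sets M"
    by (rule AE_E3) blast
  have "space M - N \<in> sets (F a)"
    using sets.compl_sets[of N "F a"] null_sets_F N(2) space_F[of a] by auto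
  moreover have "AE \<omega> in M. \<omega> \<in> space M - N" using AE_not_in[OF N(2)] AE_space by eventually_elim auto
  ultimately show ?thesis using N(1) unfolding P_def by (intro that[of "space M - N"]) blast+
qed

lemma bounded_coefficient:
  fixes k :: "real \<Rightarrow> complex ^ 'd \<Rightarrow> complex ^ 'd \<Rightarrow> 'e :: real_normed_vector"
  assumes "continuous_on ({a..b} \<times> UNIV \<times> UNIV) (\<lambda>(t, u, v). k t u v)"
  obtains C where "\<And>t u v. t \<in> {a..b} \<Longrightarrow> norm u \<le> K \<Longrightarrow> norm v \<le> K \<Longrightarrow> norm (k t u v) \<le> C"
proof -
  let ?S = "{a..b} \<times> cball (0 :: complex ^ 'd) K \<times> cball (0 :: complex ^ 'd) K"
  have "compact ((\<lambda>(t, u, v). k t u v) ` ?S)"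
    by (intro compact_continuous_image continuous_on_subset[OF assms] compact_Times) auto
  then obtain C where C: "\<forall>z\<in>(\<lambda>(t, u, v). k t u v) ` ?S. norm z \<le> C"
    by (meson bounded_iff compact_imp_bounded)
  show ?thesis
  proof (rule that[of C])
    fix t and u v :: "complex ^ 'd" assume *: "t \<in> {a..b}" "norm u \<le> K" "norm v \<le> K"
    then have "k t u v \<in> (\<lambda>(t, u, v). k t u v) ` ?S" by (intro image_eqI[of _ _ "(t, u, v)"]) auto
    then show "norm (k t u v) \<le> C" using C by blast
  qed
qed

text \<open>The initial values cancel between times \<open>s\<close> and \<open>r\<close>. The drift
  integrals are split at \<open>s\<close> path by path, which is justified by almost sure
  integrability over all of \<open>[a,b]\<close>.\<close>

lemma ito_h:
  obtains J where "\<And>r. r \<in> {a..b} \<Longrightarrow> ito_integral M F W a r h (J r)"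
    "\<And>s r. a \<le> s \<Longrightarrow> s \<le> r \<Longrightarrow> r \<le> b \<Longrightarrow>
      AE \<omega> in M. u r \<omega> = u s \<omega> + (LINT v:{s..r}|lborel. \<phi> v \<omega>) + (J r \<omega> - J s \<omega>)"
proof -
  define fx where "fx v \<omega> = f v (x v \<omega>) (x (v - \<tau> v) \<omega>)" for v \<omega>
  define fy where "fy v \<omega> = f v (y v \<omega>) (y (v - \<tau> v) \<omega>)" for v \<omega>
  have \<phi>: "\<phi> v \<omega> = fx v \<omega> - fy v \<omega>" for v \<omega> by (simp add: \<phi>_def fx_def fy_def)
  have "\<forall>t\<in>{a..b}. \<exists>J. ito_integral M F W a t (\<lambda>s \<omega>. g s (x s \<omega>) (x (s - \<tau> s) \<omega>)) J \<and>
    (AE \<omega> in M. x t \<omega> = \<xi> a \<omega> + (LINT s:{a..t}|lborel. fx s \<omega>) + J \<omega>)"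
    using x_sol unfolding sdde_solution_def fx_def by blast
  from bchoice[OF this] obtain Jx where Jx: "\<forall>t\<in>{a..b}. ito_integral M F W a t (\<lambda>s \<omega>. g s (x s \<omega>) (x (s - \<tau> s) \<omega>)) (Jx t) \<and>
    (AE \<omega> in M. x t \<omega> = \<xi> a \<omega> + (LINT s:{a..t}|lborel. fx s \<omega>) + Jx t \<omega>)" ..
  have "\<forall>t\<in>{a..b}. \<exists>J. ito_integral M F W a t (\<lambda>s \<omega>. g s (y s \<omega>) (y (s - \<tau> s) \<omega>)) J \<and>
    (AE \<omega> in M. y t \<omega> = \<eta> a \<omega> + (LINT s:{a..t}|lborel. fy s \<omega>) + J \<omega>)"
    using y_sol unfolding sdde_solution_def fy_def by blast
  from bchoice[OF this] obtain Jy where Jy: "\<forall>t\<in>{a..b}. ito_integral M F W a t (\<lambda>s \<omega>. g s (y s \<omega>) (y (s - \<tau> s) \<omega>)) (Jy t) \<and>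
    (AE \<omega> in M. y t \<omega> = \<eta> a \<omega> + (LINT s:{a..t}|lborel. fy s \<omega>) + Jy t \<omega>)" ..
  have xi: "AE \<omega> in M. set_integrable lborel {a..b} (\<lambda>s. fx s \<omega>)"
    and yi: "AE \<omega> in M. set_integrable lborel {a..b} (\<lambda>s. fy s \<omega>)"
    using x_sol y_sol by (simp_all add: sdde_solution_def fx_def fy_def)
  have split: "(LINT v:{a..r}|lborel. k v) = (LINT v:{a..s}|lborel. k v) + (LINT v:{s..r}|lborel. k v)"
    if k: "set_integrable lborel {a..b} k" and sr: "a \<le> s" "s \<le> r" "r \<le> b" for k :: "real \<Rightarrow> complex ^ 'd" and s r
  proof -
    have "{a..r} = {a..s} \<union> {s..r}" using sr by auto
    moreover have "AE v in lborel. \<not> (v \<in> {a..s} \<and> v \<in> {s..r})"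
      using AE_lborel_singleton[of s] by eventually_elim auto
    ultimately show ?thesis
      using sr by (simp add: set_integral_Un_AE set_integrable_subset[OF k])
  qed
  show ?thesis
  proof (rule that[of "\<lambda>r \<omega>. Jx r \<omega> - Jy r \<omega>"])
    show "ito_integral M F W a r h (\<lambda>\<omega>. Jx r \<omega> - Jy r \<omega>)" if "r \<in> {a..b}" for r
      using ito_integral_diff[of r _ "Jx r" _ "Jy r"] Jx Jy that unfolding h_def by blast
    fix s r assume sr: "a \<le> s" "s \<le> r" "r \<le> b"
    have "AE \<omega> in M. x r \<omega> = \<xi> a \<omega> + (LINT s:{a..r}|lborel. fx s \<omega>) + Jx r \<omega>"
      "AE \<omega> in M. x s \<omega> = \<xi> a \<omega> + (LINT s:{a..s}|lborel. fx s \<omega>) + Jx s \<omega>"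
      "AE \<omega> in M. y r \<omega> = \<eta> a \<omega> + (LINT s:{a..r}|lborel. fy s \<omega>) + Jy r \<omega>"
      "AE \<omega> in M. y s \<omega> = \<eta> a \<omega> + (LINT s:{a..s}|lborel. fy s \<omega>) + Jy s \<omega>"
      using Jx Jy sr by auto
    then show "AE \<omega> in M. u r \<omega> = u s \<omega> + (LINT v:{s..r}|lborel. \<phi> v \<omega>) + ((Jx r \<omega> - Jy r \<omega>) - (Jx s \<omega> - Jy s \<omega>))"
      using xi yi
    proof eventually_elim
      case (elim \<omega>)
      have sub: "{s..r} \<subseteq> {a..b}" using sr by auto
      have "(LINT v:{s..r}|lborel. \<phi> v \<omega>) = (LINT v:{s..r}|lborel. fx v \<omega>) - (LINT v:{s..r}|lborel. fy v \<omega>)"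
        unfolding \<phi> by (rule set_integral_diff(2); rule set_integrable_subset[OF _ _ sub])
          (use elim in auto)
      then show ?case
        unfolding u_def elim(1-4) split[OF elim(5) sr] split[OF elim(6) sr] by simp
    qed
  qed
qed

end

lemma continuous_on_bounded_above:
  fixes k :: "real \<Rightarrow> real"
  assumes "continuous_on {a..b} k"
  obtains L where "\<And>r. r \<in> {a..b} \<Longrightarrow> \<bar>k r\<bar> \<le> L"
proof -
  obtain L where L: "\<forall>z\<in>k ` {a..b}. norm z \<le> L"
    using compact_imp_bounded[OF compact_continuous_image[OF assms compact_Icc]] unfolding bounded_iff ..
  show ?thesis by (rule that[of L]) (use L in auto)
qed

section \<open>Mean square bounds, killed and unrestricted\<close>

context sdde_pair
begin

text \<open>Survival demands the bound for both solutions on the whole past including the initial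
  segment, so that delayed arguments are bounded too. The cut-off \<open>K\<close> does not occur in
  the final estimate; this is what permits letting it grow.\<close>

lemma killed_mean_square:
  fixes \<Omega> K
  defines "D \<equiv> bounded_until \<Omega> (\<lambda>v \<omega>. (x v \<omega>, y v \<omega>)) (a - \<tau>0) K"
  assumes K: "0 < K" and \<Omega>: "\<Omega> \<in> sets (F a)"
    and x_cont: "\<And>\<omega>. \<omega> \<in> \<Omega> \<Longrightarrow> continuous_on {a - \<tau>0..b} (\<lambda>t. x t \<omega>)"
    and y_cont: "\<And>\<omega>. \<omega> \<in> \<Omega> \<Longrightarrow> continuous_on {a - \<tau>0..b} (\<lambda>t. y t \<omega>)"
    and initial: "\<And>\<omega> t. \<omega> \<in> \<Omega> \<Longrightarrow> t \<in> {a - \<tau>0..a} \<Longrightarrow> x t \<omega> = \<xi> t \<omega> \<and> y t \<omega> = \<eta> t \<omega>"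
    and S0: "0 \<le> S"
    and S: "\<And>\<theta>. \<theta> \<in> {a - \<tau>0..a} \<Longrightarrow> (\<integral>\<^sup>+\<omega>. ennreal ((norm (\<xi> \<theta> \<omega> - \<eta> \<theta> \<omega>))\<^sup>2) \<partial>M) \<le> ennreal S"
    and c: "\<And>t. t \<in> {a..b} \<Longrightarrow> 2 * \<alpha> t + 2 * \<beta> t + (\<gamma>1 t)\<^sup>2 + 2 * \<gamma>1 t * \<gamma>2 t + (\<gamma>2 t)\<^sup>2 \<le> c"
    and C: "c \<le> C" "0 \<le> C" and t: "t \<in> {a..b}"
  shows "D t \<in> events"
    and "(\<lambda>\<omega>. indicator (D t) \<omega> * (norm (u t \<omega>))\<^sup>2) \<in> borel_measurable M"
    and "(\<integral>\<^sup>+\<omega>. ennreal (indicator (D t) \<omega> * (norm (u t \<omega>))\<^sup>2) \<partial>M) \<le> ennreal (S * exp (C * (t - a)))"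
proof -
  have D_mono: "D r' \<subseteq> D r" if "r \<le> r'" for r r' unfolding D_def by (rule bounded_until_mono[OF that])
  have D\<Omega>: "\<omega> \<in> \<Omega>" if "\<omega> \<in> D r" for \<omega> r using that by (simp add: D_def bounded_until_def)
  have z_cont: "continuous_on {a - \<tau>0..b} (\<lambda>v. (x v \<omega>, y v \<omega>))" if "\<omega> \<in> \<Omega>" for \<omega>
    using x_cont[OF that] y_cont[OF that] by (rule continuous_on_Pair)
  have xF: "x v \<in> borel_measurable (F v)" "y v \<in> borel_measurable (F v)" if "v \<in> {a..b}" for v
    using x_sol y_sol that by (auto simp: sdde_solution_def)
  have \<xi>F: "\<xi> v \<in> borel_measurable (F a)" "\<eta> v \<in> borel_measurable (F a)" if "v \<in> {a - \<tau>0..a}" for v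
    using Lp_initial_measurable[OF L\<xi> space_F[OF order_refl] that] Lp_initial_measurable[OF L\<eta> space_F[OF order_refl] that] by auto
  \<comment> \<open>Before \<open>a\<close> the solution is measurable only as the initial function,
    and the two agree just on \<open>\<Omega>\<close>; hence a version \<open>z'\<close> instead of
    the solution itself.\<close>
  have z_meas: "\<exists>z'. z' \<in> borel_measurable (F r) \<and> (\<forall>\<omega>\<in>\<Omega>. (x v \<omega>, y v \<omega>) = z' \<omega>)"
    if v: "v \<in> {a - \<tau>0..r}" and r: "r \<in> {a..b}" for v r
  proof (cases "a \<le> v")
    case True
    then have [measurable]: "x v \<in> borel_measurable (F r)" "y v \<in> borel_measurable (F r)"
      using borel_measurable_F_mono[OF xF(1)[of v], of r] borel_measurable_F_mono[OF xF(2)[of v], of r] v r by auto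
    have "(\<lambda>\<omega>. (x v \<omega>, y v \<omega>)) \<in> borel_measurable (F r)" by measurable
    then show ?thesis by blast
  next
    case False
    then have v': "v \<in> {a - \<tau>0..a}" using v by auto
    have [measurable]: "\<xi> v \<in> borel_measurable (F r)" "\<eta> v \<in> borel_measurable (F r)"
      using borel_measurable_F_mono[OF \<xi>F(1)[OF v'], of r] borel_measurable_F_mono[OF \<xi>F(2)[OF v'], of r] r by auto
    have "(\<lambda>\<omega>. (\<xi> v \<omega>, \<eta> v \<omega>)) \<in> borel_measurable (F r)" by measurable
    then show ?thesis using initial[OF _ v'] by (intro exI[of _ "\<lambda>\<omega>. (\<xi> v \<omega>, \<eta> v \<omega>)"]) auto
  qed
  have DF: "D r \<in> sets (F r)" if r: "r \<in> {a..b}" for r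
    unfolding D_def
  proof (rule bounded_until_sets)
    show "\<Omega> \<in> sets (F r)" using mono_F[of a r] \<Omega> r by auto
    show "continuous_on {a - \<tau>0..r} (\<lambda>v. (x v \<omega>, y v \<omega>))" if "\<omega> \<in> \<Omega>" for \<omega>
      by (rule continuous_on_subset[OF z_cont[OF that]]) (use r in auto)
  qed (rule z_meas[OF _ r])
  have DM: "D r \<in> events" if "r \<in> {a..b}" for r using sets_F_M[OF _ DF[OF that]] that by auto
  have xyb: "norm (x v \<omega>) \<le> K" "norm (y v \<omega>) \<le> K" if "\<omega> \<in> D r" "v \<in> {a - \<tau>0..r}" for v r \<omega>
  proof -
    have "norm (x v \<omega>, y v \<omega>) \<le> K" using that unfolding D_def bounded_until_def by blast
    then show "norm (x v \<omega>) \<le> K" "norm (y v \<omega>) \<le> K"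
      using norm_fst_le[of "x v \<omega>" "y v \<omega>"] norm_snd_le[of "y v \<omega>" "x v \<omega>"] by auto
  qed
  have ub: "norm (u v \<omega>) \<le> 2 * K" if "\<omega> \<in> D r" "v \<in> {a - \<tau>0..r}" for v r \<omega>
    unfolding u_def using norm_triangle_ineq4[of "x v \<omega>" "y v \<omega>"] xyb[OF that] by simp
  have um: "(\<lambda>\<omega>. indicator (D r) \<omega> * (norm (u v \<omega>))\<^sup>2) \<in> borel_measurable M"
    if v: "v \<in> {a - \<tau>0..r}" and r: "r \<in> {a..b}" for v r
  proof -
    obtain z' where z': "z' \<in> borel_measurable (F r)" "\<And>\<omega>. \<omega> \<in> \<Omega> \<Longrightarrow> (x v \<omega>, y v \<omega>) = z' \<omega>"
      using z_meas[OF v r] by blast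
    have "z' \<in> borel_measurable M" and [measurable]: "D r \<in> events"
      using borel_measurable_F[OF z'(1)] DM r by auto
    then have [measurable]: "(\<lambda>\<omega>. fst (z' \<omega>) - snd (z' \<omega>)) \<in> borel_measurable M"
      by (intro borel_measurable_continuous_on[where f = "\<lambda>z. fst z - snd z"] continuous_intros)
    have "(\<lambda>\<omega>. indicator (D r) \<omega> * (norm (fst (z' \<omega>) - snd (z' \<omega>)))\<^sup>2) \<in> borel_measurable M" by measurable
    moreover have "indicator (D r) \<omega> * (norm (fst (z' \<omega>) - snd (z' \<omega>)))\<^sup>2 = indicator (D r) \<omega> * (norm (u v \<omega>))\<^sup>2" for \<omega>
      using z'(2)[OF D\<Omega>, of \<omega> r, symmetric] by (auto simp: u_def split: split_indicator)
    ultimately show ?thesis by simp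
  qed
  have ub2: "norm (indicator (D r) \<omega> * (norm (u v \<omega>))\<^sup>2) \<le> (2 * K)\<^sup>2" if "v \<in> {a - \<tau>0..r}" for v r \<omega>
  proof (cases "\<omega> \<in> D r")
    case True
    then show ?thesis using power_mono[OF ub[OF True that] norm_ge_zero, of 2] by simp
  qed simp
  have ui: "integrable M (\<lambda>\<omega>. indicator (D r) \<omega> * (norm (u v \<omega>))\<^sup>2)"
    if v: "v \<in> {a - \<tau>0..r}" and r: "r \<in> {a..b}" for v r
    by (rule integrable_const_bound[OF AE_I2[OF ub2[OF v]] um[OF v r]])
  have in_range: "r \<in> {a - \<tau>0..r}" if "r \<in> {a..b}" for r using that \<tau>0 by auto
  define n where "n r = expectation (\<lambda>\<omega>. indicator (D r) \<omega> * (norm (u r \<omega>))\<^sup>2)" for r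
  define e where "e r = expectation (\<lambda>\<omega>. indicator (D r) \<omega> * (2 * (\<phi> r \<omega> \<bullet> u r \<omega>) + (norm (h r \<omega>))\<^sup>2))" for r
  define A where "A r = 2 * \<alpha> r + \<beta> r + (\<gamma>1 r)\<^sup>2 + \<gamma>1 r * \<gamma>2 r" for r
  define B where "B r = \<beta> r + \<gamma>1 r * \<gamma>2 r + (\<gamma>2 r)\<^sup>2" for r
  obtain Cf where Cf: "\<And>t u v. t \<in> {a..b} \<Longrightarrow> norm u \<le> K \<Longrightarrow> norm v \<le> K \<Longrightarrow> norm (f t u v) \<le> Cf"
    by (rule bounded_coefficient[OF f_cont]) blast
  obtain Cg where Cg: "\<And>t u v. t \<in> {a..b} \<Longrightarrow> norm u \<le> K \<Longrightarrow> norm v \<le> K \<Longrightarrow> norm (g t u v) \<le> Cg"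
    by (rule bounded_coefficient[OF g_cont]) blast
  \<comment> \<open>A common bound for \<open>u\<close>, \<open>\<phi>\<close> and \<open>h\<close>
    on survival, as the energy inequality works with one constant. Each is a difference, hence the
    factors \<open>2\<close>.\<close>
  define K' where "K' = max (2 * K) (max (2 * Cf) (2 * Cg))"
  have K': "0 < K'" "2 * K \<le> K'" "2 * Cf \<le> K'" "2 * Cg \<le> K'" using K by (auto simp: K'_def)
  have lag: "r - \<tau> r \<in> {a - \<tau>0..r}" if "r \<in> {a..b}" for r using \<tau> that by auto
  have \<phi>b: "norm (\<phi> r \<omega>) \<le> K'" and hb: "norm (h r \<omega>) \<le> K'" if r: "r \<in> {a..b}" and \<omega>: "\<omega> \<in> D r" for r \<omega>
  proof -
    note b = xyb[OF \<omega> in_range[OF r]] xyb[OF \<omega> lag[OF r]]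
    have "norm (\<phi> r \<omega>) \<le> Cf + Cf"
      unfolding \<phi>_def using Cf[OF r b(1) b(3)] Cf[OF r b(2) b(4)] by (intro order_trans[OF norm_triangle_ineq4] add_mono)
    then show "norm (\<phi> r \<omega>) \<le> K'" using K' by simp
    have "norm (h r \<omega>) \<le> Cg + Cg"
      unfolding h_def using Cg[OF r b(1) b(3)] Cg[OF r b(2) b(4)] by (intro order_trans[OF norm_triangle_ineq4] add_mono)
    then show "norm (h r \<omega>) \<le> K'" using K' by simp
  qed
  obtain J where J: "\<And>r. r \<in> {a..b} \<Longrightarrow> ito_integral M F W a r h (J r)"
    and J_sol: "\<And>s r. a \<le> s \<Longrightarrow> s \<le> r \<Longrightarrow> r \<le> b \<Longrightarrow>
      AE \<omega> in M. u r \<omega> = u s \<omega> + (LINT v:{s..r}|lborel. \<phi> v \<omega>) + (J r \<omega> - J s \<omega>)"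
    by (rule ito_h) blast
  have h_adapted: "measurable_adapted M F a r h" if "r \<in> {a..b}" for r using J[OF that] by (simp add: ito_integral_def)
  have \<phi>_adapted: "measurable_adapted M F a r \<phi>" if "r \<in> {a..b}" for r
  proof -
    have "measurable_adapted M F a b (\<lambda>v \<omega>. f v (x v \<omega>) (x (v - \<tau> v) \<omega>) - f v (y v \<omega>) (y (v - \<tau> v) \<omega>))"
      by (rule measurable_adapted_diff) (use x_sol y_sol in \<open>simp_all add: sdde_solution_def\<close>)
    then have "measurable_adapted M F a b \<phi>" unfolding \<phi>_def .
    then show ?thesis by (rule measurable_adapted_subset) (use that in auto)
  qed
  have uF: "u r \<in> borel_measurable (F r)" if "r \<in> {a..b}" for r
    unfolding u_def using xF[OF that] by (rule borel_measurable_diff)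
  have energy: "n t \<le> n s + e0 * (t - s)"
    if st: "a \<le> s" "s < t" "t \<le> b" and e0: "\<And>r. s \<le> r \<Longrightarrow> r \<le> t \<Longrightarrow> e r \<le> e0" for s t e0
  proof -
    interpret killed_integrand M F a W s t K' D h
    proof
      show "a \<le> s" "s < t" "0 < K'" using st K' by auto
      show "measurable_adapted M F a t h" using h_adapted st by auto
      show "D r \<in> sets (F r)" if "s \<le> r" "r \<le> t" for r using DF that st by auto
      show "D r' \<subseteq> D r" if "r \<le> r'" for r r' by (rule D_mono[OF that])
      show "(\<lambda>(r, \<omega>). indicator (D r) \<omega> :: real) \<in> borel_measurable (restrict_space borel {s..t} \<Otimes>\<^sub>M M)"
        unfolding D_def
      proof (rule bounded_until_joint)
        show "bounded_until \<Omega> (\<lambda>v \<omega>. (x v \<omega>, y v \<omega>)) (a - \<tau>0) K r \<in> events" if "r \<in> {s..t}" for r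
          using DM[of r] that st unfolding D_def by auto
        show "continuous_on {a - \<tau>0..t} (\<lambda>v. (x v \<omega>, y v \<omega>))" if "\<omega> \<in> \<Omega>" for \<omega>
          by (rule continuous_on_subset[OF z_cont[OF that]]) (use st in auto)
      qed (use st \<tau>0 in auto)
      show "norm (h r \<omega>) \<le> K'" if "s \<le> r" "r \<le> t" "\<omega> \<in> D r" for r \<omega> using hb that st by auto
    qed
    show ?thesis
      unfolding n_def
    proof (rule killed_energy)
      show "measurable_adapted M F a t \<phi>" using \<phi>_adapted st by auto
      fix r assume "s \<le> r" "r \<le> t"
      then have r: "r \<in> {a..b}" and sr: "s \<le> r" "r \<le> t" "r \<le> b" using st by auto
      show "norm (\<phi> r \<omega>) \<le> K'" if "\<omega> \<in> D r" for \<omega> by (rule \<phi>b[OF r that])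
      show "u r \<in> borel_measurable (F r)" by (rule uF[OF r])
      show "norm (u r \<omega>) \<le> K'" if "\<omega> \<in> D r" for \<omega> using ub[OF that in_range[OF r]] K' by simp
      show "ito_integral M F W a r h (J r)" by (rule J[OF r])
      show "AE \<omega> in M. u r \<omega> = u s \<omega> + (LINT v:{s..r}|lborel. \<phi> v \<omega>) + (J r \<omega> - J s \<omega>)"
        by (rule J_sol[OF st(1) sr(1,3)])
      show "expectation (\<lambda>\<omega>. indicator (D r) \<omega> * (2 * (\<phi> r \<omega> \<bullet> u r \<omega>) + (norm (h r \<omega>))\<^sup>2)) \<le> e0"
        using e0[OF sr(1,2)] unfolding e_def .
    qed
  qed
  have init: "expectation (\<lambda>\<omega>. indicator (D r) \<omega> * (norm (u \<theta> \<omega>))\<^sup>2) \<le> S"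
    if \<theta>: "\<theta> \<in> {a - \<tau>0..a}" and r: "r \<in> {a..b}" for \<theta> r
  proof -
    have \<theta>r: "\<theta> \<in> {a - \<tau>0..r}" using \<theta> r by auto
    have "ennreal (expectation (\<lambda>\<omega>. indicator (D r) \<omega> * (norm (u \<theta> \<omega>))\<^sup>2)) =
      (\<integral>\<^sup>+\<omega>. ennreal (indicator (D r) \<omega> * (norm (u \<theta> \<omega>))\<^sup>2) \<partial>M)"
      by (rule nn_integral_eq_integral[OF ui[OF \<theta>r r], symmetric]) simp
    also have "\<dots> \<le> (\<integral>\<^sup>+\<omega>. ennreal ((norm (\<xi> \<theta> \<omega> - \<eta> \<theta> \<omega>))\<^sup>2) \<partial>M)"
      by (intro nn_integral_mono) (use initial[OF D\<Omega> \<theta>] in \<open>auto simp: u_def split: split_indicator\<close>)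
    also have "\<dots> \<le> ennreal S" by (rule S[OF \<theta>])
    finally show ?thesis using S0 by simp
  qed
  have e_le: "e r \<le> A r * n r + B r * v"
    if r': "a \<le> r" "r \<le> b" and v: "S \<le> v" "\<And>r'. a \<le> r' \<Longrightarrow> r' \<le> r \<Longrightarrow> n r' \<le> v" for r v
  proof -
    have r: "r \<in> {a..b}" using r' by simp
    define w where "w = expectation (\<lambda>\<omega>. indicator (D r) \<omega> * (norm (u (r - \<tau> r) \<omega>))\<^sup>2)"
    \<comment> \<open>If the delayed time is at least \<open>a\<close>, survival up to
      \<open>r\<close> implies survival up to it, and the bound on past values of \<open>n\<close>
      applies. Otherwise the difference of the initial functions is seen, which \<open>S\<close>
      bounds; this is why \<open>v\<close> has to dominate \<open>S\<close>.\<close>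
    have wv: "w \<le> v"
    proof (cases "a \<le> r - \<tau> r")
      case True
      then have l: "r - \<tau> r \<in> {a..b}" "r - \<tau> r \<le> r" using lag[OF r] r by auto
      have "w \<le> n (r - \<tau> r)"
        unfolding w_def n_def
      proof (rule integral_mono[OF ui[OF lag[OF r] r] ui[OF in_range[OF l(1)] l(1)]])
        fix \<omega>
        show "indicator (D r) \<omega> * (norm (u (r - \<tau> r) \<omega>))\<^sup>2 \<le> indicator (D (r - \<tau> r)) \<omega> * (norm (u (r - \<tau> r) \<omega>))\<^sup>2"
          using D_mono[OF l(2)] by (auto split: split_indicator)
      qed
      also have "\<dots> \<le> v" using v(2) True l by simp
      finally show ?thesis .
    next
      case False
      then show ?thesis using init[of "r - \<tau> r" r] lag[OF r] r v(1) unfolding w_def by auto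
    qed
    have [measurable]: "D r \<in> events" "\<phi> r \<in> borel_measurable M" "h r \<in> borel_measurable M" "u r \<in> borel_measurable M"
      using DM[OF r] borel_measurable_F[OF uF[OF r]] borel_measurable_F[of "\<phi> r" r] borel_measurable_F[of "h r" r]
        h_adapted[OF r] \<phi>_adapted[OF r] r by (auto simp: measurable_adapted_def)
    have "e r \<le> expectation (\<lambda>\<omega>. A r * (indicator (D r) \<omega> * (norm (u r \<omega>))\<^sup>2) + B r * (indicator (D r) \<omega> * (norm (u (r - \<tau> r) \<omega>))\<^sup>2))"
      unfolding e_def
    proof (rule integral_mono)
      show "integrable M (\<lambda>\<omega>. indicator (D r) \<omega> * (2 * (\<phi> r \<omega> \<bullet> u r \<omega>) + (norm (h r \<omega>))\<^sup>2))"
      proof (rule integrable_const_bound)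
        have "\<bar>2 * (\<phi> r \<omega> \<bullet> u r \<omega>) + (norm (h r \<omega>))\<^sup>2\<bar> \<le> 2 * (K' * K') + K'\<^sup>2" if \<omega>: "\<omega> \<in> D r" for \<omega>
        proof -
          have "\<bar>\<phi> r \<omega> \<bullet> u r \<omega>\<bar> \<le> norm (\<phi> r \<omega>) * norm (u r \<omega>)" by (rule Cauchy_Schwarz_ineq2)
          also have "\<dots> \<le> K' * K'"
            using \<phi>b[OF r \<omega>] ub[OF \<omega> in_range[OF r]] K' by (intro mult_mono) auto
          finally have 1: "\<bar>\<phi> r \<omega> \<bullet> u r \<omega>\<bar> \<le> K' * K'" .
          have 2: "(norm (h r \<omega>))\<^sup>2 \<le> K'\<^sup>2" using hb[OF r \<omega>] by (intro power_mono) auto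
          have 3: "0 \<le> (norm (h r \<omega>))\<^sup>2" by simp
          from 1 2 3 show ?thesis by linarith
        qed
        then show "AE \<omega> in M. norm (indicator (D r) \<omega> * (2 * (\<phi> r \<omega> \<bullet> u r \<omega>) + (norm (h r \<omega>))\<^sup>2)) \<le> 2 * (K' * K') + K'\<^sup>2"
          using K' by (auto split: split_indicator)
      qed measurable
      show "integrable M (\<lambda>\<omega>. A r * (indicator (D r) \<omega> * (norm (u r \<omega>))\<^sup>2) + B r * (indicator (D r) \<omega> * (norm (u (r - \<tau> r) \<omega>))\<^sup>2))"
        using ui[OF in_range[OF r] r] ui[OF lag[OF r] r] by simp
      show "indicator (D r) \<omega> * (2 * (\<phi> r \<omega> \<bullet> u r \<omega>) + (norm (h r \<omega>))\<^sup>2) \<le>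
        A r * (indicator (D r) \<omega> * (norm (u r \<omega>))\<^sup>2) + B r * (indicator (D r) \<omega> * (norm (u (r - \<tau> r) \<omega>))\<^sup>2)" for \<omega>
        using drift_diffusion_bound[OF r, of \<omega>] unfolding A_def B_def by (cases "\<omega> \<in> D r") auto
    qed
    also have "\<dots> = A r * n r + B r * w"
      using ui[OF in_range[OF r] r] ui[OF lag[OF r] r] unfolding n_def w_def by simp
    also have "\<dots> \<le> A r * n r + B r * v"
      using wv coefficients_nonneg[OF r] by (intro add_left_mono mult_left_mono) (auto simp: B_def)
    finally show ?thesis .
  qed
  have "continuous_on {a..b} A" "continuous_on {a..b} B"
    unfolding A_def B_def using SD by (auto simp: SD_def intro!: continuous_intros)
  then obtain LA LB where L: "\<And>r. r \<in> {a..b} \<Longrightarrow> \<bar>A r\<bar> \<le> LA" "\<And>r. r \<in> {a..b} \<Longrightarrow> \<bar>B r\<bar> \<le> LB"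
    using continuous_on_bounded_above by metis
  have "n t \<le> S * exp (C * (t - a))"
  \<comment> \<open>The bound \<open>(2 * K)^2\<close> on \<open>n\<close> and the bound
    \<open>L\<close> on the coefficients enter only through the slope inside the comparison, not
    through its conclusion.\<close>
  proof (rule delay_comparison[where e = e and A = A and B = B and c = c and b = b and K = "(2 * K)\<^sup>2" and L = "max LA LB", OF energy e_le])
    fix r assume "a \<le> r" "r \<le> b"
    then have r: "r \<in> {a..b}" by simp
    show "\<bar>A r\<bar> \<le> max LA LB" "B r \<le> max LA LB" using L[OF r] by auto
    show "0 \<le> B r" using coefficients_nonneg[OF r] by (simp add: B_def)
    show "A r + B r \<le> c" using c[OF r] by (simp add: A_def B_def algebra_simps)
    show "0 \<le> n r" unfolding n_def by simp
    show "n r \<le> (2 * K)\<^sup>2"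
      unfolding n_def by (rule integral_le_const[OF ui[OF in_range[OF r] r]]) (use ub2[OF in_range[OF r]] in auto)
  next
    show "n a \<le> S" unfolding n_def by (rule init) (use ab \<tau>0 in auto)
  qed (use S0 C t in auto)
  then have "ennreal (n t) \<le> ennreal (S * exp (C * (t - a)))" by (rule ennreal_leI)
  moreover have "ennreal (n t) = (\<integral>\<^sup>+\<omega>. ennreal (indicator (D t) \<omega> * (norm (u t \<omega>))\<^sup>2) \<partial>M)"
    unfolding n_def by (rule nn_integral_eq_integral[OF ui[OF in_range[OF t] t], symmetric]) simp
  ultimately show "(\<integral>\<^sup>+\<omega>. ennreal (indicator (D t) \<omega> * (norm (u t \<omega>))\<^sup>2) \<partial>M) \<le> ennreal (S * exp (C * (t - a)))"
    by simp
  show "D t \<in> events" by (rule DM[OF t])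
  show "(\<lambda>\<omega>. indicator (D t) \<omega> * (norm (u t \<omega>))\<^sup>2) \<in> borel_measurable M" by (rule um[OF in_range[OF t] t])
qed

text \<open>The killed bounds are uniform in the cut-off. A continuous path is bounded on a compact
  interval, so almost every path survives for some cut-off, and monotone convergence removes the
  killing.\<close>

lemma mean_square_bound:
  assumes S0: "0 \<le> S"
    and S: "\<And>\<theta>. \<theta> \<in> {a - \<tau>0..a} \<Longrightarrow> (\<integral>\<^sup>+\<omega>. ennreal ((norm (\<xi> \<theta> \<omega> - \<eta> \<theta> \<omega>))\<^sup>2) \<partial>M) \<le> ennreal S"
    and c: "\<And>t. t \<in> {a..b} \<Longrightarrow> 2 * \<alpha> t + 2 * \<beta> t + (\<gamma>1 t)\<^sup>2 + 2 * \<gamma>1 t * \<gamma>2 t + (\<gamma>2 t)\<^sup>2 \<le> c"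
    and C: "c \<le> C" "0 \<le> C" and t: "t \<in> {a..b}"
  shows "(\<integral>\<^sup>+\<omega>. ennreal ((norm (x t \<omega> - y t \<omega>))\<^sup>2) \<partial>M) \<le> ennreal (S * exp (C * (t - a)))"
proof -
  obtain \<Omega> where \<Omega>: "\<Omega> \<in> sets (F a)" "AE \<omega> in M. \<omega> \<in> \<Omega>"
    "\<And>\<omega>. \<omega> \<in> \<Omega> \<Longrightarrow> continuous_on {a - \<tau>0..b} (\<lambda>t. x t \<omega>)"
    "\<And>\<omega>. \<omega> \<in> \<Omega> \<Longrightarrow> continuous_on {a - \<tau>0..b} (\<lambda>t. y t \<omega>)"
    "\<And>\<omega> t. \<omega> \<in> \<Omega> \<Longrightarrow> t \<in> {a - \<tau>0..a} \<Longrightarrow> x t \<omega> = \<xi> t \<omega> \<and> y t \<omega> = \<eta> t \<omega>"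
    by (rule good_paths) blast
  define D where "D k = bounded_until \<Omega> (\<lambda>v \<omega>. (x v \<omega>, y v \<omega>)) (a - \<tau>0) (real (Suc k)) t" for k
  define X where "X k \<omega> = ennreal (indicator (D k) \<omega> * (norm (u t \<omega>))\<^sup>2)" for k \<omega>
  note ms = killed_mean_square[OF _ \<Omega>(1,3,4,5) S0 S c C t, of "real (Suc k)" for k, folded D_def]
  have Xm [measurable]: "X k \<in> borel_measurable M" for k
    unfolding X_def using ms(2)[of k] by simp
  have Xb: "(\<integral>\<^sup>+\<omega>. X k \<omega> \<partial>M) \<le> ennreal (S * exp (C * (t - a)))" for k
    unfolding X_def using ms(3)[of k] by simp
  have inc: "incseq X"
    unfolding incseq_def le_fun_def X_def
    by (auto intro!: ennreal_leI simp: D_def bounded_until_def intro: order_trans split: split_indicator)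
  have lim: "AE \<omega> in M. ennreal ((norm (u t \<omega>))\<^sup>2) = (SUP k. X k \<omega>)"
    using \<Omega>(2)
  proof eventually_elim
    case (elim \<omega>)
    have "compact ((\<lambda>v. (x v \<omega>, y v \<omega>)) ` {a - \<tau>0..b})"
      using \<Omega>(3,4)[OF elim] by (intro compact_continuous_image continuous_on_Pair) auto
    then obtain R where R: "\<forall>z\<in>(\<lambda>v. (x v \<omega>, y v \<omega>)) ` {a - \<tau>0..b}. norm z \<le> R"
      by (meson bounded_iff compact_imp_bounded)
    obtain k where "R \<le> real k" using real_arch_simple by blast
    have "norm (x v \<omega>, y v \<omega>) \<le> real (Suc k)" if "v \<in> {a - \<tau>0..t}" for v
    proof -
      have "v \<in> {a - \<tau>0..b}" using that t by auto
      then have "norm (x v \<omega>, y v \<omega>) \<le> R" using R by blast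
      then show ?thesis using \<open>R \<le> real k\<close> by simp
    qed
    then have "\<omega> \<in> D k" using elim by (simp add: D_def bounded_until_def)
    then have "X k \<omega> = ennreal ((norm (u t \<omega>))\<^sup>2)" by (simp add: X_def)
    moreover have "X j \<omega> \<le> ennreal ((norm (u t \<omega>))\<^sup>2)" for j
      by (auto simp: X_def split: split_indicator)
    ultimately show ?case
      by (intro antisym) (auto intro: SUP_upper2[of k] SUP_least)
  qed
  have "(\<integral>\<^sup>+\<omega>. ennreal ((norm (x t \<omega> - y t \<omega>))\<^sup>2) \<partial>M) = (\<integral>\<^sup>+\<omega>. (SUP k. X k \<omega>) \<partial>M)"
    using lim by (intro nn_integral_cong_AE) (simp add: u_def)
  also have "\<dots> = (SUP k. \<integral>\<^sup>+\<omega>. X k \<omega> \<partial>M)"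
    by (rule nn_integral_monotone_convergence_SUP[OF inc Xm])
  also have "\<dots> \<le> ennreal (S * exp (C * (t - a)))" using Xb by (intro SUP_least)
  finally show ?thesis .
qed

end

theorem theorem3p10:
  fixes M :: "'w measure" and F :: "real \<Rightarrow> 'w measure" and W :: "real \<Rightarrow> 'w \<Rightarrow> real ^ 'm"
    and a b \<tau>0 p c :: real and \<tau> \<alpha> \<beta> \<gamma>1 \<gamma>2 :: "real \<Rightarrow> real"
    and f :: "real \<Rightarrow> complex ^ 'd \<Rightarrow> complex ^ 'd \<Rightarrow> complex ^ 'd"
    and g :: "real \<Rightarrow> complex ^ 'd \<Rightarrow> complex ^ 'd \<Rightarrow> complex ^ 'm ^ 'd"
    and \<xi> \<eta> x y :: "real \<Rightarrow> 'w \<Rightarrow> complex ^ 'd"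
  assumes "wiener_process M F a W"
    and "a < b" and "0 \<le> \<tau>0" and "2 < p"
    and "\<forall>t\<in>{a..b}. 0 \<le> \<tau> t" and "\<forall>t\<in>{a..b}. a - \<tau>0 \<le> t - \<tau> t"
    and "continuous_on ({a..b} \<times> UNIV \<times> UNIV) (\<lambda>(t, u, v). f t u v)"
    and "continuous_on ({a..b} \<times> UNIV \<times> UNIV) (\<lambda>(t, u, v). g t u v)"
    and "SD a b f g \<alpha> \<beta> \<gamma>1 \<gamma>2"
    and "Lp_initial M (F a) p (a - \<tau>0) a \<xi>" and "Lp_initial M (F a) p (a - \<tau>0) a \<eta>"
    and "sdde_solution M F W a b \<tau>0 \<tau> f g \<xi> x"
    and "sdde_solution M F W a b \<tau>0 \<tau> f g \<eta> y"
    and "c = (SUP t\<in>{a..b}. 2 * \<alpha> t + 2 * \<beta> t + (\<gamma>1 t)\<^sup>2 + 2 * \<gamma>1 t * \<gamma>2 t + (\<gamma>2 t)\<^sup>2)"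
  shows "\<forall>t\<in>{a..b}.
    (0 \<le> c \<longrightarrow>
      (\<integral>\<^sup>+\<omega>. ennreal ((norm (x t \<omega> - y t \<omega>))\<^sup>2) \<partial>M) \<le> ennreal (exp (c * (t - a))) *
        (SUP \<theta>\<in>{a - \<tau>0..a}. \<integral>\<^sup>+\<omega>. ennreal ((norm (\<xi> \<theta> \<omega> - \<eta> \<theta> \<omega>))\<^sup>2) \<partial>M)) \<and>
    (c \<le> 0 \<longrightarrow>
      (\<integral>\<^sup>+\<omega>. ennreal ((norm (x t \<omega> - y t \<omega>))\<^sup>2) \<partial>M) \<le>
        (SUP \<theta>\<in>{a - \<tau>0..a}. \<integral>\<^sup>+\<omega>. ennreal ((norm (\<xi> \<theta> \<omega> - \<eta> \<theta> \<omega>))\<^sup>2) \<partial>M))"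
proof (rule ballI)
  fix t assume t: "t \<in> {a..b}"
  interpret sdde_pair M F a W b \<tau>0 p \<tau> \<alpha> \<beta> \<gamma>1 \<gamma>2 f g \<xi> \<eta> x y
    using assms(1-3,5-13) by (intro sdde_pair.intro sdde_pair_axioms.intro)
  let ?q = "\<lambda>t. 2 * \<alpha> t + 2 * \<beta> t + (\<gamma>1 t)\<^sup>2 + 2 * \<gamma>1 t * \<gamma>2 t + (\<gamma>2 t)\<^sup>2"
  let ?m = "\<integral>\<^sup>+\<omega>. ennreal ((norm (x t \<omega> - y t \<omega>))\<^sup>2) \<partial>M"
  define S where "S = (SUP \<theta>\<in>{a - \<tau>0..a}. \<integral>\<^sup>+\<omega>. ennreal ((norm (\<xi> \<theta> \<omega> - \<eta> \<theta> \<omega>))\<^sup>2) \<partial>M)"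
  have "continuous_on {a..b} ?q"
    using SD by (auto simp: SD_def intro!: continuous_intros)
  then have "bdd_above (?q ` {a..b})"
    by (intro bounded_imp_bdd_above compact_imp_bounded compact_continuous_image) auto
  then have c: "?q r \<le> c" if "r \<in> {a..b}" for r
    unfolding assms(14) using that by (rule cSUP_upper[rotated])
  \<comment> \<open>Used with \<open>C = c\<close> and with \<open>C = 0\<close>, which are the two
    cases of the claim. If the supremum of initial differences is infinite, so is the right-hand
    side, because the exponential is positive.\<close>
  have key: "?m \<le> ennreal (exp (C * (t - a))) * S" if C: "c \<le> C" "0 \<le> C" for C
  proof (cases S)
    case (real s)
    have "?m \<le> ennreal (s * exp (C * (t - a)))"
    proof (rule mean_square_bound[OF real(1) _ c C t])
      fix \<theta> assume "\<theta> \<in> {a - \<tau>0..a}"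
      then show "(\<integral>\<^sup>+\<omega>. ennreal ((norm (\<xi> \<theta> \<omega> - \<eta> \<theta> \<omega>))\<^sup>2) \<partial>M) \<le> ennreal s"
        unfolding real(2)[symmetric] S_def by (rule SUP_upper)
    qed
    then show ?thesis using real by (simp add: ennreal_mult mult.commute)
  next
    case top
    then show ?thesis by (simp add: ennreal_mult_top)
  qed
  show "(0 \<le> c \<longrightarrow> ?m \<le> ennreal (exp (c * (t - a))) *
        (SUP \<theta>\<in>{a - \<tau>0..a}. \<integral>\<^sup>+\<omega>. ennreal ((norm (\<xi> \<theta> \<omega> - \<eta> \<theta> \<omega>))\<^sup>2) \<partial>M)) \<and>
    (c \<le> 0 \<longrightarrow> ?m \<le> (SUP \<theta>\<in>{a - \<tau>0..a}. \<integral>\<^sup>+\<omega>. ennreal ((norm (\<xi> \<theta> \<omega> - \<eta> \<theta> \<omega>))\<^sup>2) \<partial>M))"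
    using key[of c] key[of 0] by (simp add: S_def)
qed

end
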